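(* Let $$(A,B)_{\rm can}=\bigoplus_{i=1}^{a}\mathcal H_{h_i}(\lambda_i)\oplus\bigoplus_{j=1}^{b}\mathcal K_{k_j}\oplus\bigoplus_{r=1}^{c}\mathcal L_{l_r}=\mathcal X_1\oplus\dots\oplus\mathcal X_t$$ be a canonical pair of skew-symmetric complex $\hat n\times\hat n$ matrices for congruence ($t=a+b+c$, the $\mathcal X_i$ being the listed direct summands in this order). A simplest miniversal deformation of $(A,B)_{\rm can}$ can be taken in the form $(A,B)_{\rm can}+\mathcal D$, in which $\mathcal D=([D_{ij}]_{i,j=1}^t,[D'_{ij}]_{i,j=1}^t)$ is a pair of $(0,* )$ matrices (the stars denote parameters that are independent up to skew-symmetry), partitioned into blocks conformally to the decomposition $\mathcal X_1\oplus\dots\oplus\mathcal X_t$, with $(D_{ji},D'_{ji})=(-D_{ij}^T,-D_{ij}'^T)$, whose blocks $\mathcal D(\mathcal X_i):=(D_{ii},D'_{ii})$ and $\mathcal D(\mathcal X_i,\mathcal X_j):=(D_{ij},D'_{ij})$ for $i<j$ are defined as follows. (i) Diagonal blocks: $$\mathcal D(\mathcal H_n(\lambda))=\left(0,\begin{bmatrix}0&0^{\swarrow}\\0^{\nearrow}&0\end{bmatrix}\right),\qquad \mathcal D(\mathcal K_n)=\left(\begin{bmatrix}0&0^{\swarrow}\\0^{\nearrow}&0\end{bmatrix},0\right),\qquad \mathcal D(\mathcal L_n)=(0,0).$$ (ii) Off-diagonal blocks corresponding to summands of the same type: $$\mathcal D(\mathcal H_n(\lambda),\mathcal H_m(\mu))=\begin{cases}(0,0)&\text{if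 }\lambda\ne\mu,\\ \left(0,\begin{bmatrix}0^{\searrow}&0^{\swarrow}\\0^{\nearrow}&0^{\nwarrow}\end{bmatrix}\right)&\text{if }\lambda=\mu,\end{cases}$$ $$\mathcal D(\mathcal K_n,\mathcal K_m)=\left(\begin{bmatrix}0^{\searrow}&0^{\swarrow}\\0^{\nearrow}&0^{\nwarrow}\end{bmatrix},0\right),$$ $$\mathcal D(\mathcal L_n,\mathcal L_m)=\left(\begin{bmatrix}0&0\\0&0_{*}\end{bmatrix},\begin{bmatrix}0&(0^{\boxminus}_{m+1,n})^{T}\\0^{\boxminus}_{n+1,m}&0^{\mathsf L}\end{bmatrix}\right).$$ (iii) Off-diagonal blocks corresponding to summands of different types: $$\mathcal D(\mathcal H_n(\lambda),\mathcal K_m)=(0,0),\qquad \mathcal D(\mathcal H_n(\lambda),\mathcal L_m)=\left(0,\begin{bmatrix}0&0^{\leftarrow}\end{bmatrix}\right),\qquad \mathcal D(\mathcal K_n,\mathcal L_m)=\left(0^{\rightarrow},0\right).$$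
   Context: All matrices are over $\mathbb C$. Canonical pairs. $J_k(\lambda)$ is the $k\times k$ upper-triangular Jordan block with eigenvalue $\lambda\in\mathbb C$ ($\lambda$ on the diagonal, $1$ on the first superdiagonal), $I_k$ is the identity matrix; for $k\ge 0$, $F_k=[I_k\ 0]$ and $G_k=[0\ I_k]$ are $k\times(k+1)$. Define the pairs of skew-symmetric matrices $$\mathcal H_n(\lambda)=\left(\begin{bmatrix}0&I_n\\-I_n&0\end{bmatrix},\begin{bmatrix}0&J_n(\lambda)\\-J_n(\lambda)^T&0\end{bmatrix}\right),\quad \mathcal K_n=\left(\begin{bmatrix}0&J_n(0)\\-J_n(0)^T&0\end{bmatrix},\begin{bmatrix}0&I_n\\-I_n&0\end{bmatrix}\right)\quad(n\ge1),$$ $$\mathcal L_n=\left(\begin{bmatrix}0&F_n\\-F_n^T&0\end{bmatrix},\begin{bmatrix}0&G_n\\-G_n^T&0\end{bmatrix}\right)\quad(n\ge0).$$ So $\mathcal H_n(\lambda),\mathcal K_n$ have size $2n\times2n$ and $\mathcal L_n$ has size $(2n+1)\times(2n+1)$. Every pair of skew-symmetric complex matrices is congruent to a direct sum of such pairs, determined uniquely up to permutation of summands. For a pair and matrices $S,R$ we write $S(A,B)R=(SAR,SBR)$. Deformations. A deformation of a pair $(A,B)$ of skew-symmetric $\hat n\times\hat n$ matrices is a holomorphic map $\mathcal A(\vec\delta)$, $\vec\delta=(\delta_1,\dots,\delta_k)$, from a neighborhood of $\vec 0$ in $\mathbb C^k$ to the space of pairs of skew-symmetric $\hat n\times\hat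 n$ matrices with $\mathcal A(\vec0)=(A,B)$. A deformation of the identity matrix is likewise a holomorphic matrix-valued map on a neighborhood of $\vec 0$ with value the identity at $\vec 0$. The deformation $\mathcal A(\delta_1,\dots,\delta_k)$ is versal if for every deformation $\mathcal B(\sigma_1,\dots,\sigma_l)$ of $(A,B)$ one has $\mathcal B(\vec\sigma)=I(\vec\sigma)^T\mathcal A(\varphi_1(\vec\sigma),\dots,\varphi_k(\vec\sigma))I(\vec\sigma)$ (near $\vec 0$), where $I(\vec\sigma)$ is a deformation of the identity matrix and all $\varphi_i$ are power series convergent in a neighborhood of $\vec0$ with $\varphi_i(\vec0)=0$. A versal deformation is miniversal if no versal deformation of $(A,B)$ has fewer than $k$ parameters. $(0,* )$ matrices. A $(0,* )$ matrix has entries in $\{0,*\}$. Pairs $\mathcal D$ of $\hat n\times\hat n$ $(0,* )$ matrices considered here have zero diagonals and symmetric star positions. Let $\mathrm{Ind}_1(\mathcal D),\mathrm{Ind}_2(\mathcal D)$ be the sets of positions of stars in the strictly upper-triangular parts of the first and second matrix. Let $E_{ij}$ ($i<j$) be the $\hat n\times \hat n$ matrix with $(i,j)$ entry $1$, $(j,i)$ entry $-1$ and other entries $0$. Then $$\mathcal D(\vec\varepsilon)=\Big(\sum_{(i,j)\in \mathrm{Ind}_1(\mathcal D)}\varepsilon_{ij}E_{ij},\ \sum_{(i,j)\in \mathrm{Ind}_2(\mathcal D)}\varepsilon'_{ij}E_{ij}\Big),$$ with independent complex parameters $\varepsilon_{ij},\varepsilon'_{ij}$. A miniversal deformation of $(A,B)$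 is simplest if it has the form $(A,B)+\mathcal D(\vec\varepsilon)$ for some pair $\mathcal D$ of $(0,* )$ matrices; "$(A,B)+\mathcal D$" denotes this deformation. All parameters replacing stars above the diagonal are independent; the entries below the diagonal are determined by skew-symmetry (in particular $D_{ji}=-D_{ij}^T$ means that the star positions of $D_{ji}$ are the transposes of those of $D_{ij}$). Star patterns (unspecified entries are zero; sizes are those of the corresponding subblock; a block written $0$ is a zero matrix). - $0_{*}$: the only star is the bottom-right entry. - $p\times q$ matrix $0^{\nwarrow}$: stars fill the first column if $p\le q$, the first row if $p\ge q$ (if $p=q$ either choice may be taken). - $0^{\nearrow},0^{\searrow},0^{\swarrow}$ are obtained from matrices $0^{\nwarrow}$ by clockwise rotation by $90^\circ,180^\circ,270^\circ$ respectively. Thus for size $p\times q$: $0^{\nearrow}$ has stars in the last column if $p\le q$, in the first row if $p\ge q$; $0^{\searrow}$ has stars in the last column if $p\le q$, in the last row if $p\ge q$; $0^{\swarrow}$ has stars in the first column if $p\le q$, in the last row if $p\ge q$ (either choice if $p=q$). - $0^{\leftarrow}$: stars fill the first column. $0^{\rightarrow}$: stars fill the last column. - $0^{\mathsf L}$: stars fill the first column and the last row. - $0^{\boxminus}_{pq}$ ($p\times q$): if $p<q$, the only nonzero row is the last one, equal to $(0,\dots,0,*,\dots,*,0)$ with $p-1$ leading zeros, then $q-p$ stars, then one zero; if $p\ge q$, it is the zero matrix. Subblock sizes: in $\mathcal D(\mathcal H_n(\lambda))$, $\mathcal D(\mathcal K_n)$ all four subblocks are $n\times n$ (the choice in $0^{\nearrow}$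 being the transpose of that in $0^{\swarrow}$); in $\mathcal D(\mathcal H_n(\lambda),\mathcal H_m(\mu))$ and $\mathcal D(\mathcal K_n,\mathcal K_m)$ all four subblocks are $n\times m$; in $\mathcal D(\mathcal L_n,\mathcal L_m)$ the row partition is $n,n+1$ and the column partition is $m,m+1$; in $\mathcal D(\mathcal H_n(\lambda),\mathcal L_m)$ the second matrix is $[0\ \ 0^{\leftarrow}]$ with subblocks of sizes $2n\times m$ and $2n\times(m+1)$; in $\mathcal D(\mathcal K_n,\mathcal L_m)$ the matrix $0^{\rightarrow}$ has size $2n\times(2m+1)$. *)

theory Defs
  imports "HOL-Analysis.Infinite_Sum" "Jordan_Normal_Form.Jordan_Normal_Form"
begin

section \<open>Holomorphic functions of several complex variables\<close>

text \<open>
  Since numbers of parameters are quantified over, the space of \<open>k\<close> complex parameters is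
  \<^term>\<open>carrier_vec k\<close>. A function is holomorphic on an open set if around each point of the
  set it is the sum of a convergent power series (the definition of Gunning and Rossi).
  Multi-indices are the extensional functions from \<open>{..<k}\<close> to the naturals; the sums are
  unconditional, that is, absolutely convergent.
\<close>

definition polydisc :: "nat \<Rightarrow> complex vec \<Rightarrow> real \<Rightarrow> complex vec set" where
  "polydisc k w r = {z \<in> carrier_vec k. \<forall>i<k. cmod (z $ i - w $ i) < r}"

definition open_params :: "nat \<Rightarrow> complex vec set \<Rightarrow> bool" where
  "open_params k U \<longleftrightarrow>
     U \<subseteq> carrier_vec k \<and> (\<forall>w\<in>U. \<exists>r>0. polydisc k w r \<subseteq> U)"

definition open_nbhd0 :: "nat \<Rightarrow> complex vec set \<Rightarrow> bool" where
  "open_nbhd0 k U \<longleftrightarrow> open_params k U \<and> 0\<^sub>v k \<in> U"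

definition multi_indices :: "nat \<Rightarrow> (nat \<Rightarrow> nat) set" where
  "multi_indices k = PiE {..<k} (\<lambda>_. UNIV)"

definition power_series_at :: "nat \<Rightarrow> (complex vec \<Rightarrow> complex) \<Rightarrow> complex vec \<Rightarrow> bool" where
  "power_series_at k f w \<longleftrightarrow>
     (\<exists>(c :: (nat \<Rightarrow> nat) \<Rightarrow> complex) r. r > 0 \<and>
        (\<forall>z \<in> polydisc k w r.
           ((\<lambda>\<alpha>. c \<alpha> * (\<Prod>i<k. (z $ i - w $ i) ^ \<alpha> i)) has_sum f z) (multi_indices k)))"

definition holomorphic_params ::
    "nat \<Rightarrow> (complex vec \<Rightarrow> complex) \<Rightarrow> complex vec set \<Rightarrow> bool" where
  "holomorphic_params k f U \<longleftrightarrow> open_params k U \<and> (\<forall>w\<in>U. power_series_at k f w)"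

definition holomorphic_mat ::
    "nat \<Rightarrow> nat \<Rightarrow> (complex vec \<Rightarrow> complex mat) \<Rightarrow> complex vec set \<Rightarrow> bool" where
  "holomorphic_mat n k M U \<longleftrightarrow>
     (\<forall>\<delta>\<in>U. M \<delta> \<in> carrier_mat n n) \<and>
     (\<forall>i<n. \<forall>j<n. holomorphic_params k (\<lambda>\<delta>. M \<delta> $$ (i, j)) U)"


section \<open>Deformations of pairs of skew-symmetric matrices\<close>

type_synonym mat_pair = "complex mat \<times> complex mat"

definition skew_mat :: "nat \<Rightarrow> complex mat \<Rightarrow> bool" where
  "skew_mat n A \<longleftrightarrow> A \<in> carrier_mat n n \<and> transpose_mat A = - A"

definition skew_pair :: "nat \<Rightarrow> mat_pair \<Rightarrow> bool" where
  "skew_pair n P \<longleftrightarrow> skew_mat n (fst P) \<and> skew_mat n (snd P)"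

definition mult_pair :: "complex mat \<Rightarrow> mat_pair \<Rightarrow> complex mat \<Rightarrow> mat_pair" where
  "mult_pair S P R = (S * fst P * R, S * snd P * R)"

definition add_pair :: "mat_pair \<Rightarrow> mat_pair \<Rightarrow> mat_pair" where
  "add_pair P Q = (fst P + fst Q, snd P + snd Q)"

text \<open>Deformations are total functions; their values off some neighbourhood of the origin are
  irrelevant.\<close>

definition deformation :: "nat \<Rightarrow> nat \<Rightarrow> mat_pair \<Rightarrow> (complex vec \<Rightarrow> mat_pair) \<Rightarrow> bool" where
  "deformation n k P F \<longleftrightarrow>
     F (0\<^sub>v k) = P \<and>
     (\<exists>U. open_nbhd0 k U \<and> (\<forall>\<delta>\<in>U. skew_pair n (F \<delta>)) \<and>
        holomorphic_mat n k (\<lambda>\<delta>. fst (F \<delta>)) U \<and> holomorphic_mat n k (\<lambda>\<delta>. snd (F \<delta>)) U)"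

definition identity_deformation :: "nat \<Rightarrow> nat \<Rightarrow> (complex vec \<Rightarrow> complex mat) \<Rightarrow> bool" where
  "identity_deformation n k M \<longleftrightarrow>
     M (0\<^sub>v k) = 1\<^sub>m n \<and> (\<exists>U. open_nbhd0 k U \<and> holomorphic_mat n k M U)"

definition versal :: "nat \<Rightarrow> nat \<Rightarrow> mat_pair \<Rightarrow> (complex vec \<Rightarrow> mat_pair) \<Rightarrow> bool" where
  "versal n k P F \<longleftrightarrow>
     deformation n k P F \<and>
     (\<forall>l G. deformation n l P G \<longrightarrow>
        (\<exists>M (\<phi> :: nat \<Rightarrow> complex vec \<Rightarrow> complex).
           identity_deformation n l M \<and>
           (\<forall>i<k. power_series_at l (\<phi> i) (0\<^sub>v l) \<and> \<phi> i (0\<^sub>v l) = 0) \<and>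
           (\<exists>V. open_nbhd0 l V \<and>
              (\<forall>\<sigma>\<in>V. G \<sigma> =
                 mult_pair (transpose_mat (M \<sigma>)) (F (vec k (\<lambda>i. \<phi> i \<sigma>))) (M \<sigma>)))))"

definition miniversal :: "nat \<Rightarrow> nat \<Rightarrow> mat_pair \<Rightarrow> (complex vec \<Rightarrow> mat_pair) \<Rightarrow> bool" where
  "miniversal n k P F \<longleftrightarrow> versal n k P F \<and> (\<forall>k'<k. \<not> (\<exists>F'. versal n k' P F'))"


section \<open>Canonical pairs\<close>

definition F_mat :: "nat \<Rightarrow> complex mat" where
  "F_mat k = mat k (k + 1) (\<lambda>(i, j). if j = i then 1 else 0)"

definition G_mat :: "nat \<Rightarrow> complex mat" where
  "G_mat k = mat k (k + 1) (\<lambda>(i, j). if j = i + 1 then 1 else 0)"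

definition skew_block :: "complex mat \<Rightarrow> complex mat" where
  "skew_block M = four_block_mat
     (0\<^sub>m (dim_row M) (dim_row M)) M
     (- transpose_mat M) (0\<^sub>m (dim_col M) (dim_col M))"

datatype summand = Hpair nat complex | Kpair nat | Lpair nat

fun summand_pair :: "summand \<Rightarrow> mat_pair" where
  "summand_pair (Hpair n \<mu>) = (skew_block (1\<^sub>m n), skew_block (jordan_block n \<mu>))"
| "summand_pair (Kpair n) = (skew_block (jordan_block n 0), skew_block (1\<^sub>m n))"
| "summand_pair (Lpair n) = (skew_block (F_mat n), skew_block (G_mat n))"

fun summand_size :: "summand \<Rightarrow> nat" where
  "summand_size (Hpair n \<mu>) = 2 * n"
| "summand_size (Kpair n) = 2 * n"
| "summand_size (Lpair n) = 2 * n + 1"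

definition total_size :: "summand list \<Rightarrow> nat" where
  "total_size Xs = sum_list (map summand_size Xs)"

definition direct_sum_pair :: "summand list \<Rightarrow> mat_pair" where
  "direct_sum_pair Xs =
     (diag_block_mat (map (fst \<circ> summand_pair) Xs), diag_block_mat (map (snd \<circ> summand_pair) Xs))"

definition canonical_summands :: "(nat \<times> complex) list \<Rightarrow> nat list \<Rightarrow> nat list \<Rightarrow> summand list" where
  "canonical_summands hs ks ls =
     map (\<lambda>(h, \<mu>). Hpair h \<mu>) hs @ map Kpair ks @ map Lpair ls"


section \<open>Star matrices and the deformations they define\<close>

text \<open>A \<open>(0,*)\<close> matrix is a Boolean matrix in which \<^const>\<open>True\<close> stands for a star.\<close>

type_synonym star_mat = "bool mat"
type_synonym star_pair = "star_mat \<times> star_mat"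

definition star_symmetric :: "nat \<Rightarrow> star_mat \<Rightarrow> bool" where
  "star_symmetric n D \<longleftrightarrow>
     D \<in> carrier_mat n n \<and> (\<forall>i<n. \<not> D $$ (i, i)) \<and> transpose_mat D = D"

text \<open>The star positions above the diagonal are enumerated row by row. The parameters of the
  deformation given by \<open>(D, D')\<close> are those of \<open>D\<close> followed by those of \<open>D'\<close>.\<close>

definition Ind :: "nat \<Rightarrow> star_mat \<Rightarrow> (nat \<times> nat) list" where
  "Ind n D = filter (\<lambda>(i, j). i < j \<and> D $$ (i, j)) (List.product [0..<n] [0..<n])"

definition E_mat :: "nat \<Rightarrow> nat \<times> nat \<Rightarrow> complex mat" where
  "E_mat n p = mat n n (\<lambda>q. if q = p then 1 else if q = prod.swap p then - 1 else 0)"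

definition star_sum :: "nat \<Rightarrow> star_mat \<Rightarrow> complex vec \<Rightarrow> complex mat" where
  "star_sum n D \<epsilon> =
     mat n n (\<lambda>q. \<Sum>s<length (Ind n D). \<epsilon> $ s * E_mat n (Ind n D ! s) $$ q)"

definition num_params :: "nat \<Rightarrow> star_pair \<Rightarrow> nat" where
  "num_params n D = length (Ind n (fst D)) + length (Ind n (snd D))"

definition star_pair_sum :: "nat \<Rightarrow> star_pair \<Rightarrow> complex vec \<Rightarrow> mat_pair" where
  "star_pair_sum n D \<epsilon> =
     (star_sum n (fst D) (vec_first \<epsilon> (length (Ind n (fst D)))),
      star_sum n (snd D) (vec_last \<epsilon> (length (Ind n (snd D)))))"

definition simplest_miniversal :: "nat \<Rightarrow> mat_pair \<Rightarrow> star_pair \<Rightarrow> bool" where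
  "simplest_miniversal n P D \<longleftrightarrow>
     star_symmetric n (fst D) \<and> star_symmetric n (snd D) \<and>
     miniversal n (num_params n D) P (\<lambda>\<epsilon>. add_pair P (star_pair_sum n D \<epsilon>))"


section \<open>Star patterns\<close>

text \<open>The patterns given by diagonal arrows leave a choice for square blocks, so they are sets
  of matrices.\<close>

definition no_stars :: "nat \<Rightarrow> nat \<Rightarrow> star_mat" where
  "no_stars p q = mat p q (\<lambda>_. False)"

definition first_col :: "nat \<Rightarrow> nat \<Rightarrow> star_mat" where
  "first_col p q = mat p q (\<lambda>(i, j). j = 0)"

definition last_col :: "nat \<Rightarrow> nat \<Rightarrow> star_mat" where
  "last_col p q = mat p q (\<lambda>(i, j). j + 1 = q)"

definition first_row :: "nat \<Rightarrow> nat \<Rightarrow> star_mat" where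
  "first_row p q = mat p q (\<lambda>(i, j). i = 0)"

definition last_row :: "nat \<Rightarrow> nat \<Rightarrow> star_mat" where
  "last_row p q = mat p q (\<lambda>(i, j). i + 1 = p)"

definition corner_star :: "nat \<Rightarrow> nat \<Rightarrow> star_mat" where
  "corner_star p q = mat p q (\<lambda>(i, j). i + 1 = p \<and> j + 1 = q)"

definition L_stars :: "nat \<Rightarrow> nat \<Rightarrow> star_mat" where
  "L_stars p q = mat p q (\<lambda>(i, j). j = 0 \<or> i + 1 = p)"

definition boxminus :: "nat \<Rightarrow> nat \<Rightarrow> star_mat" where
  "boxminus p q = mat p q (\<lambda>(i, j). p < q \<and> i + 1 = p \<and> p \<le> j + 1 \<and> j + 1 < q)"

definition nw_stars :: "nat \<Rightarrow> nat \<Rightarrow> star_mat set" where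
  "nw_stars p q = {D. p \<le> q \<and> D = first_col p q \<or> q \<le> p \<and> D = first_row p q}"

definition ne_stars :: "nat \<Rightarrow> nat \<Rightarrow> star_mat set" where
  "ne_stars p q = {D. p \<le> q \<and> D = last_col p q \<or> q \<le> p \<and> D = first_row p q}"

definition se_stars :: "nat \<Rightarrow> nat \<Rightarrow> star_mat set" where
  "se_stars p q = {D. p \<le> q \<and> D = last_col p q \<or> q \<le> p \<and> D = last_row p q}"

definition sw_stars :: "nat \<Rightarrow> nat \<Rightarrow> star_mat set" where
  "sw_stars p q = {D. p \<le> q \<and> D = first_col p q \<or> q \<le> p \<and> D = last_row p q}"

definition diag_stars :: "nat \<Rightarrow> star_mat set" where
  "diag_stars n =
     {four_block_mat (no_stars n n) S (transpose_mat S) (no_stars n n) | S. S \<in> sw_stars n n}"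

definition offdiag_stars :: "nat \<Rightarrow> nat \<Rightarrow> star_mat set" where
  "offdiag_stars n m =
     {four_block_mat SE SW NE NW | SE SW NE NW.
        SE \<in> se_stars n m \<and> SW \<in> sw_stars n m \<and> NE \<in> ne_stars n m \<and> NW \<in> nw_stars n m}"


section \<open>The blocks\<close>

fun diag_block :: "summand \<Rightarrow> star_pair set" where
  "diag_block (Hpair n \<mu>) = {no_stars (2 * n) (2 * n)} \<times> diag_stars n"
| "diag_block (Kpair n) = diag_stars n \<times> {no_stars (2 * n) (2 * n)}"
| "diag_block (Lpair n) = {(no_stars (2 * n + 1) (2 * n + 1), no_stars (2 * n + 1) (2 * n + 1))}"

text \<open>The summands are ordered by type, so the blocks \<open>(K, H)\<close>, \<open>(L, H)\<close> and \<open>(L, K)\<close>, left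
  empty here, do not occur above the diagonal.\<close>

fun offdiag_block :: "summand \<Rightarrow> summand \<Rightarrow> star_pair set" where
  "offdiag_block (Hpair n \<mu>) (Hpair m \<nu>) =
     {no_stars (2 * n) (2 * m)} \<times>
     (if \<mu> = \<nu> then offdiag_stars n m else {no_stars (2 * n) (2 * m)})"
| "offdiag_block (Kpair n) (Kpair m) = offdiag_stars n m \<times> {no_stars (2 * n) (2 * m)}"
| "offdiag_block (Lpair n) (Lpair m) =
     {(four_block_mat (no_stars n m) (no_stars n (m + 1))
         (no_stars (n + 1) m) (corner_star (n + 1) (m + 1)),
       four_block_mat (no_stars n m) (transpose_mat (boxminus (m + 1) n))
         (boxminus (n + 1) m) (L_stars (n + 1) (m + 1)))}"
| "offdiag_block (Hpair n \<mu>) (Kpair m) = {(no_stars (2 * n) (2 * m), no_stars (2 * n) (2 * m))}"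
| "offdiag_block (Hpair n \<mu>) (Lpair m) =
     {(no_stars (2 * n) (2 * m + 1),
       four_block_mat (no_stars (2 * n) m) (first_col (2 * n) (m + 1))
         (no_stars 0 m) (no_stars 0 (m + 1)))}"
| "offdiag_block (Kpair n) (Lpair m) =
     {(last_col (2 * n) (2 * m + 1), no_stars (2 * n) (2 * m + 1))}"
| "offdiag_block _ _ = {}"

definition offset :: "summand list \<Rightarrow> nat \<Rightarrow> nat" where
  "offset Xs i = total_size (take i Xs)"

definition block :: "summand list \<Rightarrow> 'a mat \<Rightarrow> nat \<Rightarrow> nat \<Rightarrow> 'a mat" where
  "block Xs M i j = mat (summand_size (Xs ! i)) (summand_size (Xs ! j))
     (\<lambda>(r, s). M $$ (offset Xs i + r, offset Xs j + s))"

text \<open>The sign in \<open>D\<^sub>j\<^sub>i = - D\<^sub>i\<^sub>j\<^sup>T\<close> concerns the parameter values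
  only and is taken care of by \<^const>\<open>E_mat\<close>; the star positions are just transposed.\<close>

definition deformation_patterns :: "summand list \<Rightarrow> star_pair set" where
  "deformation_patterns Xs =
     {(D, D').
        D \<in> carrier_mat (total_size Xs) (total_size Xs) \<and>
        D' \<in> carrier_mat (total_size Xs) (total_size Xs) \<and>
        (\<forall>i<length Xs. (block Xs D i i, block Xs D' i i) \<in> diag_block (Xs ! i)) \<and>
        (\<forall>j<length Xs. \<forall>i<j.
           (block Xs D i j, block Xs D' i j) \<in> offdiag_block (Xs ! i) (Xs ! j) \<and>
           block Xs D j i = transpose_mat (block Xs D i j) \<and>
           block Xs D' j i = transpose_mat (block Xs D' i j))}"

end

theory Submission
  imports Defs "HOL-Analysis.Elementary_Metric_Spaces"
begin

text \<open>
  A deformation \<open>(A, B) + \<D>(\<epsilon>)\<close> that is linear in its parameters is miniversal as soon as the parameter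
  space is a complement of the tangent space \<open>{(S\<^sup>T A + A S, S\<^sup>T B + B S)}\<close> of the congruence orbit. To
  see that it is versal, write the unknown transformation as \<open>I + X\<close>; a linear right inverse of
  \<open>(X, \<epsilon>) \<mapsto> X\<^sup>T (A, B) + (A, B) X + \<D>(\<epsilon>)\<close> turns the equation to be solved into \<open>y = z - q(y)\<close> with
  \<open>z\<close> the perturbation and \<open>q\<close> a polynomial without constant and linear terms. This is a contraction
  on small absolutely convergent power series. The number of parameters is minimal because a
  versal deformation with fewer parameters would, along some line in the parameter space, be
  stationary to first order modulo the tangent space, so that the direction of this line would be
  tangent to the orbit.

  For a direct sum of canonical pairs the tangent space is a product over the pairs of halves of
  the summands: each factor is \<open>{(X M + N Y, X M' + N' Y)}\<close> for two of the pencils \<open>(I, J)\<close>, \<open>(J, I)\<close>,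
  \<open>(F, G)\<close> or their transposes, or \<open>{(N Z - (N Z)\<^sup>T, N' Z - (N' Z)\<^sup>T)}\<close> on the diagonal. Since all these
  pencils shift rows and columns, the complements are found by solving recursions along the
  diagonals.
\<close>

section \<open>Absolutely convergent power series\<close>

text \<open>The number of variables is quantified inside \<open>versal\<close>, so no single type
  can carry a Banach space of power series. The predicate \<open>abs_series l r N f\<close> stands
  in for it: N is an upper bound of the weighted l^1 norm of the coefficients on the polydisc of
  radius r. This norm is submultiplicative, which makes polynomial maps Lipschitz on small balls and
  lets the contraction run in one estimate per monomial. Being a complement has two halves.
  Surjectivity off the stars yields the right inverse used for versality; trivial intersection
  yields the contradiction used for minimality. The tangent space splits because the rows of one
  half of a summand contain a single nonzero block of A, in the columns of the opposite half. A
  block of S^T A + A S therefore involves at most two blocks of S, and each block of S serves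
  exactly one block on or above the diagonal, so these blocks of S can be prescribed independently.
  Within a block, a star marks an equation left over once the others have exhausted the
  unknowns.\<close>

abbreviation monom_at :: "nat \<Rightarrow> (nat \<Rightarrow> 'a::comm_monoid_mult) \<Rightarrow> (nat \<Rightarrow> nat) \<Rightarrow> 'a" where
  "monom_at l v \<alpha> \<equiv> \<Prod>i<l. v i ^ \<alpha> i"

definition closed_polydisc :: "nat \<Rightarrow> real \<Rightarrow> complex vec set" where
  "closed_polydisc l r = {z \<in> carrier_vec l. \<forall>i<l. cmod (z $ i) \<le> r}"

text \<open>\<open>s\<close> is the weighted l^1 norm of the coefficients, the sum of |c_\<alpha>|
  r^|\<alpha>|, and \<open>f\<close> is tied to the series only on the closed polydisc. The
  predicate \<open>abs_series\<close> built on it carries estimates along without naming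
  coefficients.\<close>

definition has_abs_series ::
    "nat \<Rightarrow> real \<Rightarrow> ((nat \<Rightarrow> nat) \<Rightarrow> complex) \<Rightarrow> real \<Rightarrow> (complex vec \<Rightarrow> complex) \<Rightarrow> bool" where
  "has_abs_series l r c s f \<longleftrightarrow>
     ((\<lambda>\<alpha>. cmod (c \<alpha>) * monom_at l (\<lambda>_. r) \<alpha>) has_sum s) (multi_indices l) \<and>
     (\<forall>z\<in>closed_polydisc l r. ((\<lambda>\<alpha>. c \<alpha> * monom_at l (($) z) \<alpha>) has_sum f z) (multi_indices l))"

definition abs_series :: "nat \<Rightarrow> real \<Rightarrow> real \<Rightarrow> (complex vec \<Rightarrow> complex) \<Rightarrow> bool" where
  "abs_series l r N f \<longleftrightarrow> (\<exists>c s. has_abs_series l r c s f \<and> s \<le> N)"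

lemma has_abs_seriesD:
  assumes "has_abs_series l r c s f"
  shows "((\<lambda>\<alpha>. cmod (c \<alpha>) * monom_at l (\<lambda>_. r) \<alpha>) has_sum s) (multi_indices l)"
    and "z \<in> closed_polydisc l r \<Longrightarrow> ((\<lambda>\<alpha>. c \<alpha> * monom_at l (($) z) \<alpha>) has_sum f z) (multi_indices l)"
  using assms unfolding has_abs_series_def by auto

lemma norm_monom_at_le:
  assumes "z \<in> closed_polydisc l r"
  shows "cmod (monom_at l (($) z) \<alpha>) \<le> monom_at l (\<lambda>_. r) \<alpha>"
  unfolding prod_norm [symmetric] norm_power
  using assms by (intro prod_mono) (auto simp: closed_polydisc_def intro: power_mono)

lemma has_sum_norm_le:
  fixes f :: "'x \<Rightarrow> complex"
  assumes "(f has_sum a) A" "(g has_sum b) A" "\<And>x. x \<in> A \<Longrightarrow> cmod (f x) \<le> g x"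
  shows "cmod a \<le> b"
proof -
  have "f abs_summable_on A"
    using assms by (intro abs_summable_on_comparison_test'[OF has_sum_imp_summable[OF assms(2)]])
  note su = has_sum_infsum[OF this]
  show ?thesis
    using norm_has_sum_bound[OF su assms(1)] has_sum_mono[OF su assms(2,3)] by linarith
qed

text \<open>A series over any index set \<open>X\<close>, with exponents \<open>m x\<close>, becomes
  a power series once terms of equal exponent are collected; the triangle inequality on each fibre
  can only lower the weighted norm. Products, infinite sums and recentring are all obtained this
  way, each from its natural index set.\<close>

lemma abs_series_regroup:
  fixes c :: "'x \<Rightarrow> complex"
  assumes r: "r > 0" and m: "\<And>x. x \<in> X \<Longrightarrow> m x \<in> multi_indices l"
    and w: "((\<lambda>x. cmod (c x) * monom_at l (\<lambda>_. r) (m x)) has_sum s) X" and "s \<le> N"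
    and f: "\<And>z. z \<in> closed_polydisc l r \<Longrightarrow> ((\<lambda>x. c x * monom_at l (($) z) (m x)) has_sum f z) X"
  shows "abs_series l r N f"
proof -
  define B where "B \<alpha> = {x \<in> X. m x = \<alpha>}" for \<alpha>
  define C where "C \<alpha> = infsum c (B \<alpha>)" for \<alpha>
  have reidx: "((\<lambda>(\<alpha>, x). g x) has_sum a) (Sigma (multi_indices l) B) \<longleftrightarrow> (g has_sum a) X"
    for g :: "'x \<Rightarrow> 'b::real_normed_vector" and a
    by (rule has_sum_reindex_bij_witness[where i = "\<lambda>x. (m x, x)" and j = snd])
      (auto simp: B_def m)
  have pos: "monom_at l (\<lambda>_. r) \<alpha> > 0" for \<alpha>
    using r by (intro prod_pos) auto
  \<comment> \<open>On a fibre of \<open>m\<close> the weight is a constant, positive because r > 0,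
    and can be cancelled.\<close>
  have sB: "(\<lambda>x. cmod (c x)) summable_on B \<alpha>" for \<alpha>
  proof -
    have "(\<lambda>x. cmod (c x) * monom_at l (\<lambda>_. r) (m x)) summable_on B \<alpha>"
      using w by (intro summable_on_subset[OF has_sum_imp_summable]) (auto simp: B_def)
    also have "?this \<longleftrightarrow> (\<lambda>x. cmod (c x) * monom_at l (\<lambda>_. r) \<alpha>) summable_on B \<alpha>"
      by (intro summable_on_cong) (auto simp: B_def)
    finally show ?thesis
      using pos[of \<alpha>] r by (subst (asm) summable_on_cmult_left') (auto simp del: prod_constant)
  qed
  have cB: "(c has_sum C \<alpha>) (B \<alpha>)" for \<alpha>
    unfolding C_def using sB abs_summable_summable by (intro has_sum_infsum) blast
  have C_le: "cmod (C \<alpha>) \<le> infsum (\<lambda>x. cmod (c x)) (B \<alpha>)" for \<alpha>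
    unfolding C_def using sB by (intro norm_infsum_bound)
  define h where "h \<alpha> = infsum (\<lambda>x. cmod (c x)) (B \<alpha>) * monom_at l (\<lambda>_. r) \<alpha>" for \<alpha>
  have h: "(h has_sum s) (multi_indices l)"
  proof (rule has_sum_SigmaD[OF reidx[THEN iffD2, OF w]])
    fix \<alpha>
    have "((\<lambda>y. cmod (c y) * monom_at l (\<lambda>_. r) \<alpha>) has_sum h \<alpha>) (B \<alpha>)"
      unfolding h_def using sB by (intro has_sum_cmult_left has_sum_infsum)
    then show "((\<lambda>y. case (\<alpha>, y) of (\<alpha>, x) \<Rightarrow> cmod (c x) * monom_at l (\<lambda>_. r) (m x)) has_sum h \<alpha>) (B \<alpha>)"
      by (rule has_sum_cong[THEN iffD1, rotated]) (auto simp: B_def)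
  qed
  have Ch: "cmod (C \<alpha>) * monom_at l (\<lambda>_. r) \<alpha> \<le> h \<alpha>" for \<alpha>
    unfolding h_def using C_le pos[of \<alpha>] by (intro mult_right_mono) auto
  have sC: "(\<lambda>\<alpha>. cmod (C \<alpha>) * monom_at l (\<lambda>_. r) \<alpha>) summable_on multi_indices l"
    by (rule summable_on_comparison_test[OF has_sum_imp_summable[OF h] Ch])
      (use r in \<open>auto intro!: mult_nonneg_nonneg prod_nonneg\<close>)
  show ?thesis
    unfolding abs_series_def has_abs_series_def
  proof (intro exI conjI ballI)
    show "((\<lambda>\<alpha>. cmod (C \<alpha>) * monom_at l (\<lambda>_. r) \<alpha>) has_sum
        (infsum (\<lambda>\<alpha>. cmod (C \<alpha>) * monom_at l (\<lambda>_. r) \<alpha>) (multi_indices l))) (multi_indices l)"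
      using sC by (rule has_sum_infsum)
    then show "infsum (\<lambda>\<alpha>. cmod (C \<alpha>) * monom_at l (\<lambda>_. r) \<alpha>) (multi_indices l) \<le> N"
      using has_sum_mono[OF _ h Ch] \<open>s \<le> N\<close> by force
    fix z assume z: "z \<in> closed_polydisc l r"
    show "((\<lambda>\<alpha>. C \<alpha> * monom_at l (($) z) \<alpha>) has_sum f z) (multi_indices l)"
    proof (rule has_sum_SigmaD[OF reidx[THEN iffD2, OF f[OF z]]])
      fix \<alpha>
      have "((\<lambda>y. c y * monom_at l (($) z) \<alpha>) has_sum C \<alpha> * monom_at l (($) z) \<alpha>) (B \<alpha>)"
        using cB by (intro has_sum_cmult_left)
      then show "((\<lambda>y. case (\<alpha>, y) of (\<alpha>, x) \<Rightarrow> c x * monom_at l (($) z) (m x)) has_sum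
          C \<alpha> * monom_at l (($) z) \<alpha>) (B \<alpha>)"
        by (rule has_sum_cong[THEN iffD1, rotated]) (auto simp: B_def)
    qed
  qed
qed

lemma abs_series_mono: "abs_series l r N f \<Longrightarrow> N \<le> N' \<Longrightarrow> abs_series l r N' f"
  unfolding abs_series_def by (meson order_trans)

lemma abs_series_cong:
  "abs_series l r N f \<Longrightarrow> (\<And>z. z \<in> closed_polydisc l r \<Longrightarrow> f z = g z) \<Longrightarrow> abs_series l r N g"
  unfolding abs_series_def has_abs_series_def by simp

lemma abs_series_norm_le:
  assumes "abs_series l r N f" "z \<in> closed_polydisc l r"
  shows "cmod (f z) \<le> N"
proof -
  obtain c s where hc: "has_abs_series l r c s f" and "s \<le> N"
    using assms unfolding abs_series_def by blast
  note c = has_abs_seriesD(1)[OF hc] \<open>s \<le> N\<close> has_abs_seriesD(2)[OF hc assms(2)]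
  have "cmod (f z) \<le> s"
    using c(3,1)
  proof (rule has_sum_norm_le)
    show "cmod (c \<alpha> * monom_at l (($) z) \<alpha>) \<le> cmod (c \<alpha>) * monom_at l (\<lambda>_. r) \<alpha>" for \<alpha>
      unfolding norm_mult[of "c \<alpha>"] by (intro mult_left_mono norm_monom_at_le assms) auto
  qed
  then show ?thesis using c(2) by simp
qed

text \<open>The Cauchy product is not written as a convolution: its terms are indexed by pairs of
  multi-indices, with the sum as exponent, and collected by \<open>abs_series_regroup\<close>. The
  norm of this double series is the product of the two norms.\<close>

lemma abs_series_mult:
  assumes r: "r > 0" and "abs_series l r M f" "abs_series l r N g" "M \<ge> 0"
  shows "abs_series l r (M * N) (\<lambda>z. f z * g z)"
proof -
  let ?I = "multi_indices l"
  obtain c s where hc: "has_abs_series l r c s f" and "s \<le> M"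
    using assms unfolding abs_series_def by blast
  note c = has_abs_seriesD(1)[OF hc] \<open>s \<le> M\<close> has_abs_seriesD(2)[OF hc]
  obtain d t where hd: "has_abs_series l r d t g" and "t \<le> N"
    using assms unfolding abs_series_def by blast
  note d = has_abs_seriesD(1)[OF hd] \<open>t \<le> N\<close> has_abs_seriesD(2)[OF hd]
  let ?m = "\<lambda>p. \<lambda>i\<in>{..<l}. fst p i + snd p i"
  have mon: "monom_at l v (?m (\<alpha>, \<beta>)) = monom_at l v \<alpha> * monom_at l v \<beta>"
    for v :: "nat \<Rightarrow> 'b::comm_monoid_mult" and \<alpha> \<beta>
    by (simp add: power_add flip: prod.distrib)
  have w: "((\<lambda>p. cmod (c (fst p) * d (snd p)) * monom_at l (\<lambda>_. r) (?m p)) has_sum s * t) (?I \<times> ?I)"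
  proof (rule has_sum_SigmaI[where g = "\<lambda>x. cmod (c x) * monom_at l (\<lambda>_. r) x * t"])
    have *: "((\<lambda>y. (cmod (c x) * monom_at l (\<lambda>_. r) x) * (cmod (d y) * monom_at l (\<lambda>_. r) y))
          has_sum (cmod (c x) * monom_at l (\<lambda>_. r) x) * t) ?I" for x
      by (intro has_sum_cmult_right d)
    show **: "((\<lambda>y. cmod (c (fst (x, y)) * d (snd (x, y))) * monom_at l (\<lambda>_. r) (?m (x, y)))
          has_sum (cmod (c x) * monom_at l (\<lambda>_. r) x) * t) ?I" for x
      by (rule has_sum_cong[THEN iffD1, OF _ *[of x]], unfold mon, unfold norm_mult) (simp add: mult_ac)
    show "((\<lambda>x. (cmod (c x) * monom_at l (\<lambda>_. r) x) * t) has_sum s * t) ?I"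
      by (intro has_sum_cmult_left c)
    show "(\<lambda>p. cmod (c (fst p) * d (snd p)) * monom_at l (\<lambda>_. r) (?m p)) summable_on (?I \<times> ?I)"
      by (rule summable_on_SigmaI[OF **])
        (use r in \<open>auto intro!: summable_on_cmult_left has_sum_imp_summable[OF c(1)] mult_nonneg_nonneg prod_nonneg\<close>)
  qed
  have "s \<ge> 0" "t \<ge> 0"
    using c(1) d(1) r by (auto elim!: has_sum_nonneg intro!: mult_nonneg_nonneg prod_nonneg)
  then have "s * t \<le> M * N"
    using c(2) d(2) assms(4) by (intro mult_mono) auto
  moreover have "((\<lambda>p. c (fst p) * d (snd p) * monom_at l (($) z) (?m p)) has_sum f z * g z) (?I \<times> ?I)"
    if z: "z \<in> closed_polydisc l r" for z
  proof (rule has_sum_SigmaI[where g = "\<lambda>x. c x * monom_at l (($) z) x * g z"])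
    have *: "((\<lambda>y. (c x * monom_at l (($) z) x) * (d y * monom_at l (($) z) y))
          has_sum (c x * monom_at l (($) z) x) * g z) ?I" for x
      by (intro has_sum_cmult_right d z)
    show "((\<lambda>y. c (fst (x, y)) * d (snd (x, y)) * monom_at l (($) z) (?m (x, y)))
          has_sum (c x * monom_at l (($) z) x) * g z) ?I" for x
      by (rule has_sum_cong[THEN iffD1, OF _ *[of x]], unfold mon) (simp add: mult_ac)
    show "((\<lambda>x. (c x * monom_at l (($) z) x) * g z) has_sum f z * g z) ?I"
      by (intro has_sum_cmult_left c z)
    have "(\<lambda>p. c (fst p) * d (snd p) * monom_at l (($) z) (?m p)) abs_summable_on (?I \<times> ?I)"
    proof (rule abs_summable_on_comparison_test'[OF has_sum_imp_summable[OF w]])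
      fix p
      show "cmod (c (fst p) * d (snd p) * monom_at l (($) z) (?m p))
        \<le> cmod (c (fst p) * d (snd p)) * monom_at l (\<lambda>_. r) (?m p)"
        unfolding norm_mult[of "c (fst p) * d (snd p)"]
        by (intro mult_left_mono norm_monom_at_le z) auto
    qed
    then show "(\<lambda>p. c (fst p) * d (snd p) * monom_at l (($) z) (?m p)) summable_on (?I \<times> ?I)"
      by (rule abs_summable_summable)
  qed
  moreover have "?m p \<in> ?I" if "p \<in> ?I \<times> ?I" for p
    by (auto simp: multi_indices_def)
  ultimately show ?thesis
    by (intro abs_series_regroup[OF r _ w])
qed

text \<open>Completeness of the algebra of absolutely convergent series, in the form of summable
  norms. It will show that the limit of the contracting iteration is analytic.\<close>

lemma abs_series_suminf:
  assumes r: "r > 0" and g: "\<And>n::nat. abs_series l r (a n) (g n)" and a: "summable a" "suminf a \<le> N"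
  shows "abs_series l r N (\<lambda>z. \<Sum>n. g n z)"
proof -
  let ?I = "multi_indices l"
  obtain c s where hc: "\<And>n. has_abs_series l r (c n) (s n) (g n)" and sa: "\<And>n. s n \<le> a n"
    using g unfolding abs_series_def by metis
  note c = has_abs_seriesD(1)[OF hc] and f = has_abs_seriesD(2)[OF hc]
  have s0: "s n \<ge> 0" for n
    by (rule has_sum_nonneg[OF c]) (use r in \<open>auto intro!: mult_nonneg_nonneg prod_nonneg\<close>)
  have "summable s"
    by (rule summable_comparison_test'[OF a(1), of 0]) (use sa s0 in auto)
  then have hs: "(s has_sum suminf s) UNIV"
    using s0 by (intro sums_nonneg_imp_has_sum) (auto intro: summable_sums)
  have w: "((\<lambda>p. cmod (c (fst p) (snd p)) * monom_at l (\<lambda>_. r) (snd p)) has_sum suminf s) (UNIV \<times> ?I)"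
    by (rule has_sum_SigmaI[where g = s])
      (use r in \<open>auto intro!: c hs summable_on_SigmaI[where g = s] has_sum_imp_summable[OF hs] mult_nonneg_nonneg prod_nonneg\<close>)
  have "suminf s \<le> N"
    using suminf_le[OF sa \<open>summable s\<close> a(1)] a(2) by simp
  moreover have "((\<lambda>p. c (fst p) (snd p) * monom_at l (($) z) (snd p)) has_sum (\<Sum>n. g n z)) (UNIV \<times> ?I)"
    if z: "z \<in> closed_polydisc l r" for z
  proof (rule has_sum_SigmaI[where g = "\<lambda>n. g n z"])
    have "cmod (g n z) \<le> s n" for n
      using f[OF z, of n] c[of n]
    proof (rule has_sum_norm_le)
      show "cmod (c n \<alpha> * monom_at l (($) z) \<alpha>) \<le> cmod (c n \<alpha>) * monom_at l (\<lambda>_. r) \<alpha>" for \<alpha>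
        unfolding norm_mult[of "c n \<alpha>"] by (intro mult_left_mono norm_monom_at_le z) auto
    qed
    then have "(\<lambda>n. g n z) abs_summable_on UNIV"
      by (intro abs_summable_on_comparison_test'[OF has_sum_imp_summable[OF hs]]) auto
    then have "(\<lambda>n. g n z) summable_on UNIV" by (rule abs_summable_summable)
    then show "((\<lambda>n. g n z) has_sum (\<Sum>n. g n z)) UNIV"
      using has_sum_imp_sums has_sum_infsum sums_unique by metis
    have "(\<lambda>p. c (fst p) (snd p) * monom_at l (($) z) (snd p)) abs_summable_on (UNIV \<times> ?I)"
    proof (rule abs_summable_on_comparison_test'[OF has_sum_imp_summable[OF w]])
      fix p :: "nat \<times> (nat \<Rightarrow> nat)"
      show "cmod (c (fst p) (snd p) * monom_at l (($) z) (snd p))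
        \<le> cmod (c (fst p) (snd p)) * monom_at l (\<lambda>_. r) (snd p)"
        unfolding norm_mult[of "c (fst p) (snd p)"]
        by (intro mult_left_mono norm_monom_at_le z) auto
    qed
    then show "(\<lambda>p. c (fst p) (snd p) * monom_at l (($) z) (snd p)) summable_on (UNIV \<times> ?I)"
      by (rule abs_summable_summable)
  qed (auto intro: f z)
  ultimately show ?thesis
    by (intro abs_series_regroup[OF r _ w]) auto
qed

lemma abs_series_cmult:
  assumes "r > 0" "abs_series l r N f"
  shows "abs_series l r (cmod a * N) (\<lambda>z. a * f z)"
proof -
  obtain c s where hc: "has_abs_series l r c s f" and "s \<le> N"
    using assms unfolding abs_series_def by blast
  note c = has_abs_seriesD(1)[OF hc] \<open>s \<le> N\<close> has_abs_seriesD(2)[OF hc]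
  have "has_abs_series l r (\<lambda>\<alpha>. a * c \<alpha>) (cmod a * s) (\<lambda>z. a * f z)"
    unfolding has_abs_series_def norm_mult mult.assoc
    using c by (auto intro: has_sum_cmult_right)
  then show ?thesis
    unfolding abs_series_def using c(2) by (meson mult_left_mono norm_ge_zero)
qed

lemma abs_series_add:
  assumes "r > 0" "abs_series l r M f" "abs_series l r N g"
  shows "abs_series l r (M + N) (\<lambda>z. f z + g z)"
proof -
  let ?I = "multi_indices l"
  obtain c s where hc: "has_abs_series l r c s f" and "s \<le> M"
    using assms unfolding abs_series_def by blast
  note c = has_abs_seriesD(1)[OF hc] \<open>s \<le> M\<close> has_abs_seriesD(2)[OF hc]
  obtain d t where hd: "has_abs_series l r d t g" and "t \<le> N"
    using assms unfolding abs_series_def by blast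
  note d = has_abs_seriesD(1)[OF hd] \<open>t \<le> N\<close> has_abs_seriesD(2)[OF hd]
  have st: "((\<lambda>\<alpha>. cmod (c \<alpha>) * monom_at l (\<lambda>_. r) \<alpha> + cmod (d \<alpha>) * monom_at l (\<lambda>_. r) \<alpha>) has_sum (s + t)) ?I"
    by (intro has_sum_add c d)
  have le: "cmod (c \<alpha> + d \<alpha>) * monom_at l (\<lambda>_. r) \<alpha> \<le>
      cmod (c \<alpha>) * monom_at l (\<lambda>_. r) \<alpha> + cmod (d \<alpha>) * monom_at l (\<lambda>_. r) \<alpha>" for \<alpha>
    unfolding distrib_right [symmetric]
    using assms(1) by (intro mult_right_mono norm_triangle_ineq prod_nonneg) auto
  have "(\<lambda>\<alpha>. cmod (c \<alpha> + d \<alpha>) * monom_at l (\<lambda>_. r) \<alpha>) summable_on ?I"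
    by (rule summable_on_comparison_test[OF has_sum_imp_summable[OF st] le])
      (use assms(1) in \<open>auto intro!: mult_nonneg_nonneg prod_nonneg\<close>)
  note su = has_sum_infsum[OF this]
  show ?thesis
    unfolding abs_series_def has_abs_series_def
  proof (intro exI conjI ballI)
    show "infsum (\<lambda>\<alpha>. cmod (c \<alpha> + d \<alpha>) * monom_at l (\<lambda>_. r) \<alpha>) ?I \<le> M + N"
      using has_sum_mono[OF su st le] c(2) d(2) by simp
    show "((\<lambda>\<alpha>. (c \<alpha> + d \<alpha>) * monom_at l (($) z) \<alpha>) has_sum f z + g z) ?I"
      if "z \<in> closed_polydisc l r" for z
      unfolding distrib_right using that by (intro has_sum_add c d)
  qed (rule su)
qed

section \<open>Multi-indices of degree at most one, constants and coordinates\<close>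

definition unit_index :: "nat \<Rightarrow> nat \<Rightarrow> nat \<Rightarrow> nat" where
  "unit_index l j = (\<lambda>i\<in>{..<l}. if i = j then 1 else 0)"

definition zero_index :: "nat \<Rightarrow> nat \<Rightarrow> nat" where
  "zero_index l = (\<lambda>i\<in>{..<l}. 0)"

lemma monom_at_zero_index [simp]: "monom_at l v (zero_index l) = 1"
  by (simp add: zero_index_def)

lemma monom_at_unit_index [simp]:
  assumes "j < l" shows "monom_at l v (unit_index l j) = v j"
proof -
  have "monom_at l v (unit_index l j) = (\<Prod>i<l. if i = j then v i else 1)"
    by (intro prod.cong) (auto simp: unit_index_def)
  also have "\<dots> = v j" using assms by (simp add: prod.delta)
  finally show ?thesis .
qed

lemma zero_index_in [simp]: "zero_index l \<in> multi_indices l"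
  and unit_index_in [simp]: "unit_index l j \<in> multi_indices l"
  by (auto simp: zero_index_def unit_index_def multi_indices_def)

lemma abs_series_const:
  assumes "r > 0" shows "abs_series l r (cmod a) (\<lambda>_. a)"
  by (rule abs_series_regroup[where X = "{()}" and c = "\<lambda>_. a" and m = "\<lambda>_. zero_index l"])
    (use assms in \<open>auto intro!: has_sum_finiteI\<close>)

lemma abs_series_coord:
  assumes "r > 0" "j < l" shows "abs_series l r r (\<lambda>z. z $ j)"
  by (rule abs_series_regroup[where X = "{()}" and c = "\<lambda>_. 1" and m = "\<lambda>_. unit_index l j"])
    (use assms in \<open>auto intro!: has_sum_finiteI\<close>)

lemma abs_series_sum:
  assumes "r > 0" "finite A" "\<And>a. a \<in> A \<Longrightarrow> abs_series l r (N a) (f a)"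
  shows "abs_series l r (\<Sum>a\<in>A. N a) (\<lambda>z. \<Sum>a\<in>A. f a z)"
  using assms(2,3)
  by (induction A rule: finite_induct)
    (use abs_series_const[OF assms(1), of l 0] in \<open>auto intro: abs_series_add assms(1)\<close>)

lemma abs_series_diff:
  assumes "r > 0" "abs_series l r M f" "abs_series l r N g"
  shows "abs_series l r (M + N) (\<lambda>z. f z - g z)"
  using abs_series_add[OF assms(1,2) abs_series_cmult[OF assms(1,3), of "-1"]] by simp

lemma zero_in_closed_polydisc: "r \<ge> 0 \<Longrightarrow> 0\<^sub>v l \<in> closed_polydisc l r"
  by (simp add: closed_polydisc_def)

lemma multi_index_degree_less_2:
  assumes "\<alpha> \<in> multi_indices l" "(\<Sum>i<l. \<alpha> i) < 2"
  shows "\<alpha> \<in> insert (zero_index l) (unit_index l ` {..<l})"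
proof (cases "\<forall>i<l. \<alpha> i = 0")
  case True
  then have "\<alpha> = zero_index l"
    using assms(1) by (auto simp: zero_index_def multi_indices_def fun_eq_iff PiE_def extensional_def)
  then show ?thesis by simp
next
  case False
  then obtain j where j: "j < l" "\<alpha> j \<noteq> 0" by auto
  have "\<alpha> j + (\<Sum>i\<in>{..<l} - {j}. \<alpha> i) < 2"
    using assms(2) j by (subst sum.remove[symmetric]) auto
  then have 1: "\<alpha> j = 1" and "(\<Sum>i\<in>{..<l} - {j}. \<alpha> i) = 0"
    using j(2) by linarith+
  then have "\<forall>i\<in>{..<l} - {j}. \<alpha> i = 0" by simp
  then have "\<alpha> = unit_index l j"
    using assms(1) 1 j by (auto simp: unit_index_def multi_indices_def fun_eq_iff PiE_def extensional_def)
  then show ?thesis using j by simp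
qed

lemma inj_unit_index: "inj_on (unit_index l) {..<l}"
proof (rule inj_onI)
  fix i j assume "i \<in> {..<l}" "j \<in> {..<l}" "unit_index l i = unit_index l j"
  then show "i = j" by (auto simp: unit_index_def fun_eq_iff split: if_splits dest!: spec[of _ i])
qed

lemma zero_index_not_unit: "j < l \<Longrightarrow> zero_index l \<noteq> unit_index l j"
  by (auto simp: zero_index_def unit_index_def fun_eq_iff intro!: exI[of _ j])

lemma has_abs_series_zero:
  assumes "has_abs_series l r c s f" "r > 0"
  shows "f (0\<^sub>v l) = c (zero_index l)"
proof -
  have "((\<lambda>\<alpha>. c \<alpha> * monom_at l (($) (0\<^sub>v l)) \<alpha>) has_sum c (zero_index l)) (multi_indices l)"
  proof (rule has_sum_finite_neutralI[where B = "{zero_index l}"])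
    fix \<alpha> assume a: "\<alpha> \<in> multi_indices l - {zero_index l}"
    then obtain j where "j < l" "\<alpha> j \<noteq> 0"
      by (auto simp: zero_index_def multi_indices_def fun_eq_iff PiE_def extensional_def split: if_splits)
    then show "c \<alpha> * monom_at l (($) (0\<^sub>v l)) \<alpha> = 0" by auto
  qed auto
  moreover have "0\<^sub>v l \<in> closed_polydisc l r"
    using assms(2) by (intro zero_in_closed_polydisc) simp
  ultimately show ?thesis using has_abs_seriesD(2)[OF assms(1)] has_sum_unique by blast
qed

text \<open>A term of degree |\<alpha>| \<ge> d shrinks by \<theta>^|\<alpha>| \<le> \<theta>^d. The
  case d = 0 gives monotonicity in the radius, d = 1 the smallness of functions vanishing at the
  origin, d = 2 the quadratic Taylor remainder.\<close>

lemma has_abs_series_shrink: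
  assumes "has_abs_series l R c s f" "R > 0" "0 < \<theta>" "\<theta> \<le> 1"
    and c0: "\<And>\<alpha>. \<alpha> \<in> multi_indices l \<Longrightarrow> (\<Sum>i<l. \<alpha> i) < d \<Longrightarrow> c \<alpha> = 0"
  shows "abs_series l (\<theta> * R) (\<theta> ^ d * s) f"
proof -
  let ?I = "multi_indices l"
  have st: "((\<lambda>\<alpha>. \<theta> ^ d * (cmod (c \<alpha>) * monom_at l (\<lambda>_. R) \<alpha>)) has_sum (\<theta> ^ d * s)) ?I"
    by (intro has_sum_cmult_right has_abs_seriesD(1)[OF assms(1)])
  have le: "cmod (c \<alpha>) * monom_at l (\<lambda>_. \<theta> * R) \<alpha> \<le> \<theta> ^ d * (cmod (c \<alpha>) * monom_at l (\<lambda>_. R) \<alpha>)"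
    if a: "\<alpha> \<in> ?I" for \<alpha>
  proof (cases "(\<Sum>i<l. \<alpha> i) < d")
    case True
    then show ?thesis using c0 a by simp
  next
    case False
    have "monom_at l (\<lambda>_. \<theta> * R) \<alpha> = monom_at l (\<lambda>_. \<theta>) \<alpha> * monom_at l (\<lambda>_. R) \<alpha>"
      by (simp add: power_mult_distrib prod.distrib)
    also have "monom_at l (\<lambda>_. \<theta>) \<alpha> = \<theta> ^ (\<Sum>i<l. \<alpha> i)"
      by (simp add: power_sum)
    also have "\<theta> ^ (\<Sum>i<l. \<alpha> i) * monom_at l (\<lambda>_. R) \<alpha> \<le> \<theta> ^ d * monom_at l (\<lambda>_. R) \<alpha>"
      using assms False by (intro mult_right_mono power_decreasing prod_nonneg) auto
    finally have "monom_at l (\<lambda>_. \<theta> * R) \<alpha> \<le> \<theta> ^ d * monom_at l (\<lambda>_. R) \<alpha>" .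
    from mult_left_mono[OF this, of "cmod (c \<alpha>)"] show ?thesis by (simp add: mult_ac)
  qed
  have "(\<lambda>\<alpha>. cmod (c \<alpha>) * monom_at l (\<lambda>_. \<theta> * R) \<alpha>) summable_on ?I"
    by (rule summable_on_comparison_test[OF has_sum_imp_summable[OF st]])
      (use le assms(2,3) in \<open>auto intro!: mult_nonneg_nonneg prod_nonneg\<close>)
  note su = has_sum_infsum[OF this]
  have "has_abs_series l (\<theta> * R) c (infsum (\<lambda>\<alpha>. cmod (c \<alpha>) * monom_at l (\<lambda>_. \<theta> * R) \<alpha>) ?I) f"
    unfolding has_abs_series_def
  proof (intro conjI ballI su)
    have "\<theta> * R \<le> R" using assms(2-4) by (simp add: mult_le_cancel_right1)
    then show "((\<lambda>\<alpha>. c \<alpha> * monom_at l (($) z) \<alpha>) has_sum f z) ?I"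
      if "z \<in> closed_polydisc l (\<theta> * R)" for z
      using that by (intro has_abs_seriesD(2)[OF assms(1)]) (force simp: closed_polydisc_def)
  qed
  moreover have "infsum (\<lambda>\<alpha>. cmod (c \<alpha>) * monom_at l (\<lambda>_. \<theta> * R) \<alpha>) ?I \<le> \<theta> ^ d * s"
    using has_sum_mono[OF su st le] .
  ultimately show ?thesis unfolding abs_series_def by blast
qed

lemma abs_series_antimono_radius:
  assumes "0 < R'" "R' \<le> R" "abs_series l R N f"
  shows "abs_series l R' N f"
proof -
  obtain c s where "has_abs_series l R c s f" and "s \<le> N"
    using assms unfolding abs_series_def by blast
  then show ?thesis
    using has_abs_series_shrink[of l R c s f "R' / R" 0] assms by (auto elim: abs_series_mono)
qed

lemma abs_series_shrink:
  assumes "abs_series l R N f" "R > 0" "0 < \<theta>" "\<theta> \<le> 1" "f (0\<^sub>v l) = 0"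
  shows "abs_series l (\<theta> * R) (\<theta> * N) f"
proof -
  obtain c s where hc: "has_abs_series l R c s f" and "s \<le> N"
    using assms unfolding abs_series_def by blast
  have "abs_series l (\<theta> * R) (\<theta> ^ 1 * s) f"
  proof (rule has_abs_series_shrink[OF hc])
    fix \<alpha> assume a: "\<alpha> \<in> multi_indices l" "(\<Sum>i<l. \<alpha> i) < 1"
    then have "\<alpha> = zero_index l"
      by (auto simp: zero_index_def multi_indices_def fun_eq_iff PiE_def extensional_def)
    then show "c \<alpha> = 0" using has_abs_series_zero[OF hc] assms by simp
  qed (use assms in auto)
  then show ?thesis
    using assms \<open>s \<le> N\<close> by (auto elim!: abs_series_mono)
qed

text \<open>Abel's lemma: unconditional summability at the one point whose coordinates all equal r /
  2 bounds the series on the whole closed polydisc of that radius.\<close>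

lemma power_series_at_imp_has_abs_series:
  assumes "power_series_at l f (0\<^sub>v l)"
  obtains R c s where "R > 0" "has_abs_series l R c s f"
proof -
  obtain c r where "r > 0" and c: "\<And>z. z \<in> polydisc l (0\<^sub>v l) r \<Longrightarrow>
      ((\<lambda>\<alpha>. c \<alpha> * (\<Prod>i<l. (z $ i - 0\<^sub>v l $ i) ^ \<alpha> i)) has_sum f z) (multi_indices l)"
    using assms unfolding power_series_at_def by blast
  have c: "((\<lambda>\<alpha>. c \<alpha> * monom_at l (($) z) \<alpha>) has_sum f z) (multi_indices l)"
    if "z \<in> polydisc l (0\<^sub>v l) r" for z
    using c[OF that] by simp
  define z where "z = vec l (\<lambda>_. complex_of_real (r / 2))"
  have "z \<in> polydisc l (0\<^sub>v l) r"
    using \<open>r > 0\<close> by (auto simp: z_def polydisc_def norm_divide)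
  then have "(\<lambda>\<alpha>. c \<alpha> * monom_at l (($) z) \<alpha>) summable_on multi_indices l"
    using c has_sum_imp_summable by blast
  then have "(\<lambda>\<alpha>. c \<alpha> * monom_at l (($) z) \<alpha>) abs_summable_on multi_indices l"
    by (simp only: summable_on_iff_abs_summable_on_complex)
  also have "(\<lambda>\<alpha>. cmod (c \<alpha> * monom_at l (($) z) \<alpha>)) = (\<lambda>\<alpha>. cmod (c \<alpha>) * monom_at l (\<lambda>_. r / 2) \<alpha>)"
  proof
    fix \<alpha>
    have "cmod (monom_at l (($) z) \<alpha>) = monom_at l (\<lambda>_. r / 2) \<alpha>"
      unfolding prod_norm [symmetric] norm_power
      using \<open>r > 0\<close> by (intro prod.cong) (auto simp: z_def norm_divide)
    then show "cmod (c \<alpha> * monom_at l (($) z) \<alpha>) = cmod (c \<alpha>) * monom_at l (\<lambda>_. r / 2) \<alpha>"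
      by (simp only: norm_mult)
  qed
  finally have su: "(\<lambda>\<alpha>. cmod (c \<alpha>) * monom_at l (\<lambda>_. r / 2) \<alpha>) summable_on multi_indices l" .
  have "has_abs_series l (r / 2) c (infsum (\<lambda>\<alpha>. cmod (c \<alpha>) * monom_at l (\<lambda>_. r / 2) \<alpha>) (multi_indices l)) f"
    unfolding has_abs_series_def
  proof (intro conjI ballI has_sum_infsum su c)
    fix z assume "z \<in> closed_polydisc l (r / 2)"
    then show "z \<in> polydisc l (0\<^sub>v l) r"
      using \<open>r > 0\<close> by (force simp: closed_polydisc_def polydisc_def)
  qed
  then show ?thesis using that[of "r / 2"] \<open>r > 0\<close> by simp
qed

text \<open>The filter \<open>at_right 0\<close> allows such bounds for finitely many functions to
  be met on a common radius.\<close>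

lemma eventually_abs_series_small:
  assumes "power_series_at l f (0\<^sub>v l)" "f (0\<^sub>v l) = 0" "e > 0"
  shows "\<forall>\<^sub>F r in at_right 0. abs_series l r e f"
proof -
  obtain R c s where R: "R > 0" and hc: "has_abs_series l R c s f"
    using power_series_at_imp_has_abs_series[OF assms(1)] .
  \<comment> \<open>Raising the bound to at least \<open>e\<close> makes the ratio \<theta> = e / N
    at most 1, as shrinking requires.\<close>
  define N where "N = max s e"
  have *: "abs_series l R N f" using hc unfolding abs_series_def N_def by (meson max.cobounded1)
  have N: "N > 0" "e \<le> N" using assms(3) unfolding N_def by auto
  define \<theta> where "\<theta> = e / N"
  have \<theta>: "0 < \<theta>" "\<theta> \<le> 1" using N assms(3) by (auto simp: \<theta>_def)
  have "abs_series l (\<theta> * R) (\<theta> * N) f"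
    using abs_series_shrink[OF * R \<theta> assms(2)] .
  then have "abs_series l (\<theta> * R) e f" using N by (simp add: \<theta>_def)
  then have "abs_series l r e f" if "r > 0" "r \<le> \<theta> * R" for r
    using abs_series_antimono_radius that by blast
  then show ?thesis
    using \<theta> R by (auto simp: eventually_at_right_field intro!: exI[of _ "\<theta> * R"])
qed

text \<open>Deleting the coefficients of degree below 2 leaves a series to which
  \<open>has_abs_series_shrink\<close> applies with d = 2; C is its norm divided by R^2.\<close>

lemma power_series_at_first_order:
  assumes "power_series_at l f (0\<^sub>v l)"
  obtains a C R where "R > 0" "C \<ge> 0"
    "\<And>t z. 0 < t \<Longrightarrow> t \<le> R \<Longrightarrow> z \<in> closed_polydisc l t \<Longrightarrow>
       cmod (f z - f (0\<^sub>v l) - (\<Sum>j<l. a j * z $ j)) \<le> C * t ^ 2"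
proof -
  let ?I = "multi_indices l"
  obtain R c s where R: "R > 0" and hc: "has_abs_series l R c s f"
    using power_series_at_imp_has_abs_series[OF assms(1)] .
  define A where "A = insert (zero_index l) (unit_index l ` {..<l})"
  define c' where "c' \<alpha> = (if \<alpha> \<in> A then 0 else c \<alpha>)" for \<alpha>
  define g where "g z = f z - f (0\<^sub>v l) - (\<Sum>j<l. c (unit_index l j) * z $ j)" for z
  have A: "finite A" "A \<subseteq> ?I" by (auto simp: A_def)
  have c'_le: "cmod (c' \<alpha>) * monom_at l (\<lambda>_. R) \<alpha> \<le> cmod (c \<alpha>) * monom_at l (\<lambda>_. R) \<alpha>" for \<alpha>
    using R by (intro mult_right_mono prod_nonneg) (auto simp: c'_def)
  have "(\<lambda>\<alpha>. cmod (c' \<alpha>) * monom_at l (\<lambda>_. R) \<alpha>) summable_on ?I"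
    by (rule summable_on_comparison_test[OF has_sum_imp_summable[OF has_abs_seriesD(1)[OF hc]] c'_le])
      (use R in \<open>auto intro!: mult_nonneg_nonneg prod_nonneg\<close>)
  then obtain s' where s': "((\<lambda>\<alpha>. cmod (c' \<alpha>) * monom_at l (\<lambda>_. R) \<alpha>) has_sum s') ?I"
    by (auto simp: summable_on_def)
  have "s' \<ge> 0"
    by (rule has_sum_nonneg[OF s']) (use R in \<open>auto intro!: mult_nonneg_nonneg prod_nonneg\<close>)
  have "((\<lambda>\<alpha>. c' \<alpha> * monom_at l (($) z) \<alpha>) has_sum g z) ?I" if z: "z \<in> closed_polydisc l R" for z
  proof -
    have 1: "((\<lambda>\<alpha>. if \<alpha> \<in> A then c \<alpha> * monom_at l (($) z) \<alpha> else 0) has_sum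
        (\<Sum>\<alpha>\<in>A. c \<alpha> * monom_at l (($) z) \<alpha>)) ?I"
      using A by (intro has_sum_finite_neutralI[where B = A]) auto
    have 2: "(\<Sum>\<alpha>\<in>A. c \<alpha> * monom_at l (($) z) \<alpha>) = f (0\<^sub>v l) + (\<Sum>j<l. c (unit_index l j) * z $ j)"
      unfolding A_def using has_abs_series_zero[OF hc R]
      by (subst sum.insert) (auto simp: zero_index_not_unit sum.reindex[OF inj_unit_index])
    have "((\<lambda>\<alpha>. c \<alpha> * monom_at l (($) z) \<alpha> + - (if \<alpha> \<in> A then c \<alpha> * monom_at l (($) z) \<alpha> else 0))
        has_sum f z + - (f (0\<^sub>v l) + (\<Sum>j<l. c (unit_index l j) * z $ j))) ?I"
      by (rule has_sum_add[OF has_abs_seriesD(2)[OF hc z]])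
        (use 1 in \<open>simp only: 2 has_sum_uminus minus_minus\<close>)
    moreover have "f z + - (f (0\<^sub>v l) + (\<Sum>j<l. c (unit_index l j) * z $ j)) = g z" by (simp add: g_def)
    moreover have "c \<alpha> * monom_at l (($) z) \<alpha> + - (if \<alpha> \<in> A then c \<alpha> * monom_at l (($) z) \<alpha> else 0) =
        c' \<alpha> * monom_at l (($) z) \<alpha>" for \<alpha>
      by (simp add: c'_def)
    ultimately show ?thesis by (simp only:)
  qed
  then have hg: "has_abs_series l R c' s' g" using s' by (auto simp: has_abs_series_def)
  have "cmod (g z) \<le> s' / R ^ 2 * t ^ 2" if t: "0 < t" "t \<le> R" and z: "z \<in> closed_polydisc l t" for t z
  proof -
    have "abs_series l (t / R * R) ((t / R) ^ 2 * s') g"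
      using R t multi_index_degree_less_2
      by (intro has_abs_series_shrink[OF hg]) (auto simp: c'_def A_def)
    then have "cmod (g z) \<le> (t / R) ^ 2 * s'"
      using z R by (intro abs_series_norm_le) auto
    then show ?thesis by (simp add: power_divide mult_ac)
  qed
  then show ?thesis
    using that[of R "s' / R\<^sup>2" "\<lambda>j. c (unit_index l j)"] R \<open>s' \<ge> 0\<close> by (auto simp: g_def)
qed

text \<open>\<open>holomorphic_params\<close> asks for a power series about every point, while the
  constructions yield one about the origin only. It is recentred at \<open>w\<close> by the binomial
  theorem: the terms are indexed by pairs \<beta> \<le> \<alpha> and regrouped by \<beta>.\<close>

lemma abs_series_imp_power_series_at:
  assumes f: "abs_series l r N f" and r: "r > 0" and w: "w \<in> polydisc l (0\<^sub>v l) r"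
  shows "power_series_at l f w"
proof -
  let ?I = "multi_indices l"
  obtain c s where hc: "has_abs_series l r c s f"
    using f unfolding abs_series_def by blast
  have w': "w \<in> carrier_vec l" "\<And>i. i < l \<Longrightarrow> cmod (w $ i) < r"
    using w by (auto simp: polydisc_def)
  \<comment> \<open>The distance of \<open>w\<close> to the boundary in the worst coordinate;
    inserting \<open>r\<close> keeps the minimum defined for l = 0.\<close>
  define q where "q = Min (insert r ((\<lambda>i. r - cmod (w $ i)) ` {..<l}))"
  have q: "q > 0" "\<And>i. i < l \<Longrightarrow> cmod (w $ i) + q \<le> r"
  proof -
    show "q > 0" using r w' by (auto simp: q_def)
    have "q \<le> r - cmod (w $ i)" if "i < l" for i
      unfolding q_def using that by (intro Min_le) auto
    then show "\<And>i. i < l \<Longrightarrow> cmod (w $ i) + q \<le> r" by (simp add: add.commute le_diff_eq)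
  qed
  define J where "J \<alpha> = PiE {..<l} (\<lambda>i. {..\<alpha> i})" for \<alpha> :: "nat \<Rightarrow> nat"
  have J: "finite (J \<alpha>)" for \<alpha> unfolding J_def by (intro finite_PiE) auto
  have expand: "(\<Prod>i<l. (u i + h i) ^ \<alpha> i) =
      (\<Sum>\<beta>\<in>J \<alpha>. (\<Prod>i<l. of_nat (\<alpha> i choose \<beta> i) * u i ^ (\<alpha> i - \<beta> i)) * monom_at l h \<beta>)"
    for u h :: "nat \<Rightarrow> 'a::{comm_ring_1}" and \<alpha>
  proof -
    have "(\<Prod>i<l. (u i + h i) ^ \<alpha> i) =
      (\<Prod>i<l. \<Sum>k\<in>{..\<alpha> i}. of_nat (\<alpha> i choose k) * u i ^ (\<alpha> i - k) * h i ^ k)"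
    proof (intro prod.cong refl)
      fix i
      have "(h i + u i) ^ \<alpha> i = (\<Sum>k\<le>\<alpha> i. of_nat (\<alpha> i choose k) * h i ^ k * u i ^ (\<alpha> i - k))"
        by (rule binomial_ring)
      then show "(u i + h i) ^ \<alpha> i = (\<Sum>k\<in>{..\<alpha> i}. of_nat (\<alpha> i choose k) * u i ^ (\<alpha> i - k) * h i ^ k)"
        by (simp add: add.commute mult_ac)
    qed
    also have "\<dots> = (\<Sum>\<beta>\<in>J \<alpha>. \<Prod>i<l. of_nat (\<alpha> i choose \<beta> i) * u i ^ (\<alpha> i - \<beta> i) * h i ^ \<beta> i)"
      unfolding J_def
      by (rule prod_sum_PiE[where f = "\<lambda>i k. of_nat (\<alpha> i choose k) * u i ^ (\<alpha> i - k) * h i ^ k"]) auto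
    finally show ?thesis by (simp add: prod.distrib)
  qed
  define d where "d p = c (fst p) * (\<Prod>i<l. of_nat (fst p i choose snd p i) * (w $ i) ^ (fst p i - snd p i))"
    for p
  have dnorm: "cmod (d p) = cmod (c (fst p)) *
      (\<Prod>i<l. of_nat (fst p i choose snd p i) * (cmod (w $ i)) ^ (fst p i - snd p i))" for p
    unfolding d_def norm_mult prod_norm [symmetric] norm_power by simp
  \<comment> \<open>Summing the moduli over \<beta> rebuilds the powers of |w_i| + q, which are
    dominated by the powers of r. This is what makes the double family absolutely summable.\<close>
  have inner: "((\<lambda>\<beta>. cmod (d (\<alpha>, \<beta>)) * monom_at l (\<lambda>_. q) \<beta>) has_sum
      cmod (c \<alpha>) * (\<Prod>i<l. (cmod (w $ i) + q) ^ \<alpha> i)) (J \<alpha>)" for \<alpha>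
    unfolding expand dnorm sum_distrib_left by (rule has_sum_finiteI) (auto simp: J mult_ac)
  have le: "cmod (c \<alpha>) * (\<Prod>i<l. (cmod (w $ i) + q) ^ \<alpha> i) \<le> cmod (c \<alpha>) * monom_at l (\<lambda>_. r) \<alpha>" for \<alpha>
    using q by (intro mult_left_mono prod_mono) (auto intro!: power_mono)
  have su1: "(\<lambda>\<alpha>. cmod (c \<alpha>) * (\<Prod>i<l. (cmod (w $ i) + q) ^ \<alpha> i)) summable_on ?I"
    by (rule summable_on_comparison_test[OF has_sum_imp_summable[OF has_abs_seriesD(1)[OF hc]] le])
      (use q in \<open>auto intro!: mult_nonneg_nonneg prod_nonneg\<close>)
  have "(\<lambda>p. cmod (d p) * monom_at l (\<lambda>_. q) (snd p)) summable_on Sigma ?I J"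
    by (rule summable_on_SigmaI[where g = "\<lambda>\<alpha>. cmod (c \<alpha>) * (\<Prod>i<l. (cmod (w $ i) + q) ^ \<alpha> i)"])
      (use q inner su1 in \<open>auto intro!: mult_nonneg_nonneg prod_nonneg\<close>)
  note su = this
  have main: "((\<lambda>p. d p * monom_at l (($) h) (snd p)) has_sum f (w + h)) (Sigma ?I J)"
    if h: "h \<in> closed_polydisc l q" for h
  proof (rule has_sum_SigmaI)
    have hc': "h \<in> carrier_vec l" "\<And>i. i < l \<Longrightarrow> cmod (h $ i) \<le> q"
      using h by (auto simp: closed_polydisc_def)
    show "((\<lambda>\<beta>. d (\<alpha>, \<beta>) * monom_at l (($) h) (snd (\<alpha>, \<beta>))) has_sum
        c \<alpha> * (\<Prod>i<l. (w $ i + h $ i) ^ \<alpha> i)) (J \<alpha>)" for \<alpha>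
      unfolding expand d_def sum_distrib_left by (rule has_sum_finiteI) (auto simp: J mult_ac)
    have "w + h \<in> closed_polydisc l r"
      unfolding closed_polydisc_def
    proof (intro CollectI conjI allI impI)
      fix i assume i: "i < l"
      have "cmod ((w + h) $ i) \<le> cmod (w $ i) + cmod (h $ i)"
        using i hc' by (simp add: norm_triangle_ineq)
      also have "\<dots> \<le> r" using q(2)[OF i] hc'(2)[OF i] by linarith
      finally show "cmod ((w + h) $ i) \<le> r" .
    qed (use w' hc' in auto)
    from has_abs_seriesD(2)[OF hc this]
    show "((\<lambda>\<alpha>. c \<alpha> * (\<Prod>i<l. (w $ i + h $ i) ^ \<alpha> i)) has_sum f (w + h)) ?I"
      using hc' by simp
    have "(\<lambda>p. d p * monom_at l (($) h) (snd p)) abs_summable_on Sigma ?I J"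
    proof (rule abs_summable_on_comparison_test'[OF su])
      fix p
      show "cmod (d p * monom_at l (($) h) (snd p)) \<le> cmod (d p) * monom_at l (\<lambda>_. q) (snd p)"
        unfolding norm_mult[of "d p"] by (intro mult_left_mono norm_monom_at_le h) auto
    qed
    then show "(\<lambda>p. d p * monom_at l (($) h) (snd p)) summable_on Sigma ?I J"
      by (rule abs_summable_summable)
  qed
  have "abs_series l q (infsum (\<lambda>p. cmod (d p) * monom_at l (\<lambda>_. q) (snd p)) (Sigma ?I J)) (\<lambda>h. f (w + h))"
  proof (rule abs_series_regroup[where m = snd and c = d and X = "Sigma ?I J"])
    have "J \<alpha> \<subseteq> ?I" for \<alpha>
      unfolding J_def multi_indices_def by (rule PiE_mono) simp
    then show "snd p \<in> ?I" if "p \<in> Sigma ?I J" for p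
      using that by fastforce
  qed (fact q(1) has_sum_infsum[OF su] order_refl main)+
  then obtain e s' where he: "has_abs_series l q e s' (\<lambda>h. f (w + h))"
    unfolding abs_series_def by blast
  show ?thesis
    unfolding power_series_at_def
  proof (intro exI conjI ballI)
    show "q > 0" by fact
    fix z assume z: "z \<in> polydisc l w q"
    then have zc: "z \<in> carrier_vec l" by (simp add: polydisc_def)
    have "z - w \<in> closed_polydisc l q"
      using z w' by (auto simp: polydisc_def closed_polydisc_def intro: less_imp_le)
    from has_abs_seriesD(2)[OF he this] have "((\<lambda>\<alpha>. e \<alpha> * monom_at l (($) (z - w)) \<alpha>) has_sum f (w + (z - w))) ?I" .
    moreover have "w + (z - w) = z" using zc w' by auto
    ultimately show "((\<lambda>\<alpha>. e \<alpha> * (\<Prod>i<l. (z $ i - w $ i) ^ \<alpha> i)) has_sum f z) ?I"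
      using w' zc by simp
  qed
qed

lemma open_params_polydisc: "open_params l (polydisc l w r)"
  unfolding open_params_def
proof (intro conjI ballI)
  fix v assume v: "v \<in> polydisc l w r"
  define q where "q = Min (insert 1 ((\<lambda>i. r - cmod (v $ i - w $ i)) ` {..<l}))"
  have "q > 0" using v by (auto simp: q_def polydisc_def)
  moreover have "polydisc l v q \<subseteq> polydisc l w r"
  proof
    fix z assume z: "z \<in> polydisc l v q"
    have "cmod (z $ i - w $ i) < r" if i: "i < l" for i
    proof -
      have "q \<le> r - cmod (v $ i - w $ i)" unfolding q_def using i by (intro Min_le) auto
      moreover have "cmod (z $ i - v $ i) < q" using z i by (simp add: polydisc_def)
      moreover have "cmod (z $ i - w $ i) \<le> cmod (z $ i - v $ i) + cmod (v $ i - w $ i)"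
        using norm_triangle_ineq[of "z $ i - v $ i" "v $ i - w $ i"] by simp
      ultimately show ?thesis by linarith
    qed
    then show "z \<in> polydisc l w r" using z by (simp add: polydisc_def)
  qed
  ultimately show "\<exists>r'>0. polydisc l v r' \<subseteq> polydisc l w r" by blast
qed (auto simp: polydisc_def)

lemma open_nbhd0_polydisc: "r > 0 \<Longrightarrow> open_nbhd0 l (polydisc l (0\<^sub>v l) r)"
  using open_params_polydisc[of l "0\<^sub>v l" r] by (simp add: open_nbhd0_def) (simp add: polydisc_def)

lemma abs_series_imp_holomorphic:
  "abs_series l r N f \<Longrightarrow> r > 0 \<Longrightarrow> holomorphic_params l f (polydisc l (0\<^sub>v l) r)"
  using abs_series_imp_power_series_at open_params_polydisc by (auto simp: holomorphic_params_def)

lemma polydisc_subset_closed: "polydisc l (0\<^sub>v l) r \<subseteq> closed_polydisc l r"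
  by (auto simp: polydisc_def closed_polydisc_def intro: less_imp_le)

section \<open>Analytic solutions of fixed point equations\<close>

text \<open>Two tuples of series in the ball of radius \<epsilon>, at distance at most
  \<open>d\<close>. The two bounds are separate because the iteration keeps \<epsilon> fixed while
  \<open>d\<close> is halved; \<epsilon> \<le> 1 allows the order of vanishing to be
  lowered.\<close>

definition lip_data ::
    "'k set \<Rightarrow> nat \<Rightarrow> real \<Rightarrow> real \<Rightarrow> real \<Rightarrow> ('k \<Rightarrow> complex vec \<Rightarrow> complex) \<Rightarrow> ('k \<Rightarrow> complex vec \<Rightarrow> complex) \<Rightarrow> bool" where
  "lip_data K l r \<epsilon> d y y' \<longleftrightarrow> 0 < r \<and> 0 \<le> \<epsilon> \<and> \<epsilon> \<le> 1 \<and> 0 \<le> d \<and>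
     (\<forall>k\<in>K. abs_series l r \<epsilon> (y k) \<and> abs_series l r \<epsilon> (y' k) \<and> abs_series l r d (\<lambda>\<sigma>. y k \<sigma> - y' k \<sigma>))"

text \<open>A map vanishing to order \<open>m + 1\<close> at the origin, measured on substituted power series.\<close>

definition lip_map :: "'k set \<Rightarrow> nat \<Rightarrow> (('k \<Rightarrow> complex) \<Rightarrow> complex) \<Rightarrow> bool" where
  "lip_map K m q \<longleftrightarrow> q (\<lambda>_. 0) = 0 \<and>
     (\<exists>C\<ge>0. \<forall>l r \<epsilon> d y y'. lip_data K l r \<epsilon> d y y' \<longrightarrow>
        abs_series l r (C * \<epsilon> ^ m * d) (\<lambda>\<sigma>. q (\<lambda>k. y k \<sigma>) - q (\<lambda>k. y' k \<sigma>))) \<and>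
     (\<forall>u v. (\<forall>k\<in>K. (\<lambda>n. u n k) \<longlonglongrightarrow> v k) \<longrightarrow> (\<lambda>n. q (u n)) \<longlonglongrightarrow> q v)"

lemma lip_map_zero: "lip_map K m q \<Longrightarrow> q (\<lambda>_. 0) = 0"
  by (simp add: lip_map_def)

lemma lip_map_tendsto:
  "lip_map K m q \<Longrightarrow> (\<And>k. k \<in> K \<Longrightarrow> (\<lambda>n. u n k) \<longlonglongrightarrow> v k) \<Longrightarrow> (\<lambda>n. q (u n)) \<longlonglongrightarrow> q v"
  by (simp add: lip_map_def)

text \<open>Comparison with the zero tuple, at distance \<epsilon>, turns the Lipschitz bound into
  bounds for the values themselves.\<close>

lemma lip_mapE:
  assumes "lip_map K m q"
  obtains C where "C \<ge> 0"
    "\<And>l r \<epsilon> d y y'. lip_data K l r \<epsilon> d y y' \<Longrightarrow>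
       abs_series l r (C * \<epsilon> ^ m * d) (\<lambda>\<sigma>. q (\<lambda>k. y k \<sigma>) - q (\<lambda>k. y' k \<sigma>))"
    "\<And>l r \<epsilon> d y y'. lip_data K l r \<epsilon> d y y' \<Longrightarrow> abs_series l r (C * \<epsilon> ^ m * \<epsilon>) (\<lambda>\<sigma>. q (\<lambda>k. y k \<sigma>))"
    "\<And>l r \<epsilon> d y y'. lip_data K l r \<epsilon> d y y' \<Longrightarrow> abs_series l r (C * \<epsilon> ^ m * \<epsilon>) (\<lambda>\<sigma>. q (\<lambda>k. y' k \<sigma>))"
proof -
  obtain C where C: "C \<ge> 0" and
    *: "\<forall>l r \<epsilon> d y y'. lip_data K l r \<epsilon> d y y' \<longrightarrow>
        abs_series l r (C * \<epsilon> ^ m * d) (\<lambda>\<sigma>. q (\<lambda>k. y k \<sigma>) - q (\<lambda>k. y' k \<sigma>))"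
    using assms unfolding lip_map_def by (elim conjE exE) rule
  have val: "abs_series l r (C * \<epsilon> ^ m * \<epsilon>) (\<lambda>\<sigma>. q (\<lambda>k. y k \<sigma>))"
    if d: "0 < r" "0 \<le> \<epsilon>" "\<epsilon> \<le> 1" "\<forall>k\<in>K. abs_series l r \<epsilon> (y k)" for l r \<epsilon> y
  proof -
    have "abs_series l r \<epsilon> (\<lambda>_. 0)"
      using abs_series_mono[OF abs_series_const[OF d(1), of l 0], of \<epsilon>] d(2) by simp
    then have "lip_data K l r \<epsilon> \<epsilon> y (\<lambda>k \<sigma>. 0)" using d by (simp add: lip_data_def)
    from *[rule_format, OF this] show ?thesis using lip_map_zero[OF assms] by simp
  qed
  show ?thesis
    by (rule that[OF C *[rule_format]]) (auto intro!: val simp: lip_data_def)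
qed

lemma lip_mapI:
  assumes "q (\<lambda>_. 0) = 0" "C \<ge> 0"
    "\<And>l r \<epsilon> d y y'. lip_data K l r \<epsilon> d y y' \<Longrightarrow>
       abs_series l r (C * \<epsilon> ^ m * d) (\<lambda>\<sigma>. q (\<lambda>k. y k \<sigma>) - q (\<lambda>k. y' k \<sigma>))"
    "\<And>u v. (\<And>k. k \<in> K \<Longrightarrow> (\<lambda>n. u n k) \<longlonglongrightarrow> v k) \<Longrightarrow> (\<lambda>n. q (u n)) \<longlonglongrightarrow> q v"
  shows "lip_map K m q"
  unfolding lip_map_def by (intro conjI assms(1) exI[of _ C] assms(2-) allI impI) auto

lemma lip_map_coord: "k \<in> K \<Longrightarrow> lip_map K 0 (\<lambda>y. y k)"
  by (rule lip_mapI[where C = 1]) (auto simp: lip_data_def)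

lemma lip_map_cmult:
  assumes q: "lip_map K m q" shows "lip_map K m (\<lambda>y. a * q y)"
proof (rule lip_mapE[OF q])
  fix C
  assume C: "C \<ge> 0" "\<And>l r \<epsilon> d y y'. lip_data K l r \<epsilon> d y y' \<Longrightarrow>
       abs_series l r (C * \<epsilon> ^ m * d) (\<lambda>\<sigma>. q (\<lambda>k. y k \<sigma>) - q (\<lambda>k. y' k \<sigma>))"
  show ?thesis
  proof (rule lip_mapI[where C = "cmod a * C"])
    show "abs_series l r (cmod a * C * \<epsilon> ^ m * d) (\<lambda>\<sigma>. a * q (\<lambda>k. y k \<sigma>) - a * q (\<lambda>k. y' k \<sigma>))"
      if d: "lip_data K l r \<epsilon> d y y'" for l r \<epsilon> d y y'
      using abs_series_cmult[OF _ C(2)[OF d], where a = a] d by (simp add: algebra_simps lip_data_def)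
  qed (use C(1) lip_map_zero[OF q] in \<open>auto intro!: tendsto_intros lip_map_tendsto[OF q]\<close>)
qed

lemma lip_map_add:
  assumes p: "lip_map K m p" and q: "lip_map K m q" shows "lip_map K m (\<lambda>y. p y + q y)"
proof (rule lip_mapE[OF p], rule lip_mapE[OF q])
  fix C D
  assume C: "C \<ge> 0" "\<And>l r \<epsilon> d y y'. lip_data K l r \<epsilon> d y y' \<Longrightarrow>
       abs_series l r (C * \<epsilon> ^ m * d) (\<lambda>\<sigma>. p (\<lambda>k. y k \<sigma>) - p (\<lambda>k. y' k \<sigma>))"
    and D: "D \<ge> 0" "\<And>l r \<epsilon> d y y'. lip_data K l r \<epsilon> d y y' \<Longrightarrow>
       abs_series l r (D * \<epsilon> ^ m * d) (\<lambda>\<sigma>. q (\<lambda>k. y k \<sigma>) - q (\<lambda>k. y' k \<sigma>))"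
  show ?thesis
  proof (rule lip_mapI[where C = "C + D"])
    show "abs_series l r ((C + D) * \<epsilon> ^ m * d)
        (\<lambda>\<sigma>. p (\<lambda>k. y k \<sigma>) + q (\<lambda>k. y k \<sigma>) - (p (\<lambda>k. y' k \<sigma>) + q (\<lambda>k. y' k \<sigma>)))"
      if d: "lip_data K l r \<epsilon> d y y'" for l r \<epsilon> d y y'
      using abs_series_add[OF _ C(2)[OF d] D(2)[OF d]] d by (simp add: algebra_simps lip_data_def)
  qed (use C(1) D(1) lip_map_zero[OF p] lip_map_zero[OF q]
      in \<open>auto intro!: tendsto_intros lip_map_tendsto[OF p] lip_map_tendsto[OF q]\<close>)
qed

lemma lip_map_const0: "lip_map K m (\<lambda>_. 0)"
proof (rule lip_mapI[where C = 0])
  show "abs_series l r (0 * \<epsilon> ^ m * d) (\<lambda>\<sigma>. 0 - 0)" if "lip_data K l r \<epsilon> d y y'" for l r \<epsilon> d y y'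
    using abs_series_const[of r l 0] that by (simp add: lip_data_def)
qed auto

lemma lip_map_sum:
  "(\<And>a. a \<in> A \<Longrightarrow> lip_map K m (q a)) \<Longrightarrow> lip_map K m (\<lambda>y. \<Sum>a\<in>A. q a y)"
  by (induction A rule: infinite_finite_induct) (auto intro: lip_map_const0 lip_map_add)

text \<open>The two terms of pq - p'q' = (p - p')q + p'(q - q') contribute C D each, whence the
  constant 2 C D. The orders of vanishing m + 1 and m' + 1 add up to (m + m' + 1) + 1.\<close>

lemma lip_map_mult:
  assumes p: "lip_map K m p" and q: "lip_map K m' q" shows "lip_map K (Suc (m + m')) (\<lambda>y. p y * q y)"
proof (rule lip_mapE[OF p], rule lip_mapE[OF q])
  fix C D
  assume C: "C \<ge> 0" "\<And>l r \<epsilon> d y y'. lip_data K l r \<epsilon> d y y' \<Longrightarrow>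
       abs_series l r (C * \<epsilon> ^ m * d) (\<lambda>\<sigma>. p (\<lambda>k. y k \<sigma>) - p (\<lambda>k. y' k \<sigma>))"
    and C': "\<And>l r \<epsilon> d y y'. lip_data K l r \<epsilon> d y y' \<Longrightarrow> abs_series l r (C * \<epsilon> ^ m * \<epsilon>) (\<lambda>\<sigma>. p (\<lambda>k. y' k \<sigma>))"
    and D: "D \<ge> 0" "\<And>l r \<epsilon> d y y'. lip_data K l r \<epsilon> d y y' \<Longrightarrow>
       abs_series l r (D * \<epsilon> ^ m' * d) (\<lambda>\<sigma>. q (\<lambda>k. y k \<sigma>) - q (\<lambda>k. y' k \<sigma>))"
    and D': "\<And>l r \<epsilon> d y y'. lip_data K l r \<epsilon> d y y' \<Longrightarrow> abs_series l r (D * \<epsilon> ^ m' * \<epsilon>) (\<lambda>\<sigma>. q (\<lambda>k. y k \<sigma>))"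
  show ?thesis
  proof (rule lip_mapI[where C = "2 * C * D"])
    show "abs_series l r (2 * C * D * \<epsilon> ^ Suc (m + m') * d)
        (\<lambda>\<sigma>. p (\<lambda>k. y k \<sigma>) * q (\<lambda>k. y k \<sigma>) - (p (\<lambda>k. y' k \<sigma>) * q (\<lambda>k. y' k \<sigma>)))"
      if d: "lip_data K l r \<epsilon> d y y'" for l r \<epsilon> d y y'
    proof -
      have r: "r > 0" "\<epsilon> \<ge> 0" "d \<ge> 0" using d by (simp_all add: lip_data_def)
      have 1: "abs_series l r ((C * \<epsilon> ^ m * d) * (D * \<epsilon> ^ m' * \<epsilon>))
          (\<lambda>\<sigma>. (p (\<lambda>k. y k \<sigma>) - p (\<lambda>k. y' k \<sigma>)) * q (\<lambda>k. y k \<sigma>))"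
        using C(1) r by (intro abs_series_mult C(2)[OF d] D'[OF d]) auto
      have 2: "abs_series l r ((C * \<epsilon> ^ m * \<epsilon>) * (D * \<epsilon> ^ m' * d))
          (\<lambda>\<sigma>. p (\<lambda>k. y' k \<sigma>) * (q (\<lambda>k. y k \<sigma>) - q (\<lambda>k. y' k \<sigma>)))"
        using C(1) r by (intro abs_series_mult D(2)[OF d] C'[OF d]) auto
      have "(C * \<epsilon> ^ m * d) * (D * \<epsilon> ^ m' * \<epsilon>) + (C * \<epsilon> ^ m * \<epsilon>) * (D * \<epsilon> ^ m' * d) =
          2 * C * D * \<epsilon> ^ Suc (m + m') * d"
        by (simp add: power_add)
      moreover have "(p (\<lambda>k. y k \<sigma>) - p (\<lambda>k. y' k \<sigma>)) * q (\<lambda>k. y k \<sigma>) +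
          p (\<lambda>k. y' k \<sigma>) * (q (\<lambda>k. y k \<sigma>) - q (\<lambda>k. y' k \<sigma>)) =
          p (\<lambda>k. y k \<sigma>) * q (\<lambda>k. y k \<sigma>) - p (\<lambda>k. y' k \<sigma>) * q (\<lambda>k. y' k \<sigma>)" for \<sigma>
        by (simp add: algebra_simps)
      ultimately show ?thesis
        using abs_series_add[OF r(1) 1 2] by (simp only:)
    qed
  qed (use C(1) D(1) lip_map_zero[OF p]
      in \<open>auto intro!: tendsto_intros lip_map_tendsto[OF p] lip_map_tendsto[OF q]\<close>)
qed

lemma lip_map_mono:
  assumes q: "lip_map K m q" and "m' \<le> m" shows "lip_map K m' q"
proof (rule lip_mapE[OF q])
  fix C
  assume C: "C \<ge> 0" "\<And>l r \<epsilon> d y y'. lip_data K l r \<epsilon> d y y' \<Longrightarrow>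
       abs_series l r (C * \<epsilon> ^ m * d) (\<lambda>\<sigma>. q (\<lambda>k. y k \<sigma>) - q (\<lambda>k. y' k \<sigma>))"
  show ?thesis
  proof (rule lip_mapI[where C = C])
    show "abs_series l r (C * \<epsilon> ^ m' * d) (\<lambda>\<sigma>. q (\<lambda>k. y k \<sigma>) - q (\<lambda>k. y' k \<sigma>))"
      if d: "lip_data K l r \<epsilon> d y y'" for l r \<epsilon> d y y'
      using C(1) assms(2) d
      by (intro abs_series_mono[OF C(2)[OF d]] mult_right_mono mult_left_mono power_decreasing)
        (auto simp: lip_data_def)
  qed (use C(1) lip_map_zero[OF q] in \<open>auto intro!: lip_map_tendsto[OF q]\<close>)
qed

text \<open>The solution of \<open>y = z - q(y)\<close> is the limit of the contracting iteration started at \<open>0\<close>.\<close>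

lemma analytic_fixpoint:
  fixes z :: "'k \<Rightarrow> complex vec \<Rightarrow> complex" and q :: "'k \<Rightarrow> ('k \<Rightarrow> complex) \<Rightarrow> complex"
  assumes K: "finite K" and q: "\<And>k. k \<in> K \<Longrightarrow> lip_map K 1 (q k)"
    and z: "\<And>k. k \<in> K \<Longrightarrow> power_series_at l (z k) (0\<^sub>v l)" "\<And>k. k \<in> K \<Longrightarrow> z k (0\<^sub>v l) = 0"
  obtains r y where "r > 0" "\<And>k. k \<in> K \<Longrightarrow> abs_series l r 1 (y k)" "\<And>k. k \<in> K \<Longrightarrow> y k (0\<^sub>v l) = 0"
    "\<And>k \<sigma>. k \<in> K \<Longrightarrow> \<sigma> \<in> closed_polydisc l r \<Longrightarrow> y k \<sigma> = z k \<sigma> - q k (\<lambda>j. y j \<sigma>)"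
proof -
  define bound where "bound k C \<longleftrightarrow> C \<ge> 0 \<and> (\<forall>r \<epsilon> d y y'. lip_data K l r \<epsilon> d y y' \<longrightarrow>
      abs_series l r (C * \<epsilon> * d) (\<lambda>\<sigma>. q k (\<lambda>k. y k \<sigma>) - q k (\<lambda>k. y' k \<sigma>)) \<and>
      abs_series l r (C * \<epsilon> * \<epsilon>) (\<lambda>\<sigma>. q k (\<lambda>k. y k \<sigma>)))" for k C
  have "\<exists>C. bound k C" if "k \<in> K" for k
    unfolding bound_def by (rule lip_mapE[OF q[OF that], unfolded power_one_right], rule exI) blast
  then obtain C where C': "\<And>k. k \<in> K \<Longrightarrow> bound k (C k)" by metis
  have C: "C k \<ge> 0" if "k \<in> K" for k
    using C'[OF that] unfolding bound_def by (rule conjunct1)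
  have lip: "abs_series l r (C k * \<epsilon> * d) (\<lambda>\<sigma>. q k (\<lambda>k. y k \<sigma>) - q k (\<lambda>k. y' k \<sigma>))"
    "abs_series l r (C k * \<epsilon> * \<epsilon>) (\<lambda>\<sigma>. q k (\<lambda>k. y k \<sigma>))"
    if "k \<in> K" "lip_data K l r \<epsilon> d y y'" for k r \<epsilon> d y y'
    using C'[OF that(1)] that(2) unfolding bound_def by blast+
  define D where "D = (\<Sum>k\<in>K. C k)"
  have D: "C k \<le> D" if "k \<in> K" for k
    unfolding D_def using K C that by (intro member_le_sum) auto
  have D0: "D \<ge> 0" unfolding D_def using C by (intro sum_nonneg) auto
  \<comment> \<open>This choice makes every \<open>C k * \<epsilon>\<close> at most 1 / 2, so the
    iteration preserves the \<epsilon>-ball and halves distances; \<epsilon> \<le> 1 / 2 keeps the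
    limit, of norm at most 2 \<epsilon>, below 1.\<close>
  define \<epsilon> where "\<epsilon> = 1 / (2 * (D + 1))"
  have \<epsilon>: "\<epsilon> > 0" "\<epsilon> \<le> 1 / 2" and D\<epsilon>: "D * \<epsilon> \<le> 1 / 2"
    using D0 by (auto simp: \<epsilon>_def field_simps)
  have C\<epsilon>: "C k * \<epsilon> \<le> 1 / 2" if "k \<in> K" for k
    using mult_right_mono[OF D[OF that], of \<epsilon>] D\<epsilon> \<epsilon> by linarith
  have "\<forall>\<^sub>F r in at_right (0::real). (\<forall>k\<in>K. abs_series l r (\<epsilon> / 2) (z k)) \<and> r > 0"
    using K z \<epsilon> by (intro eventually_conj eventually_at_right_less eventually_ball_finite ballI
        eventually_abs_series_small) auto
  \<comment> \<open>On this radius \<open>z\<close> fills only half of the \<epsilon>-ball; the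
    nonlinear part, bounded by \<open>C k * \<epsilon> * \<epsilon>\<close>, takes at most the other
    half.\<close>
  then obtain r where r: "r > 0" and zr: "\<And>k. k \<in> K \<Longrightarrow> abs_series l r (\<epsilon> / 2) (z k)"
    using eventually_happens'[OF trivial_limit_at_right_real] by blast
  define Y where "Y = rec_nat (\<lambda>k \<sigma>. 0) (\<lambda>n Y k \<sigma>. if k \<in> K then z k \<sigma> - q k (\<lambda>j. Y j \<sigma>) else 0)"
  have Y0: "Y 0 k \<sigma> = 0" and YS: "Y (Suc n) k \<sigma> = (if k \<in> K then z k \<sigma> - q k (\<lambda>j. Y n j \<sigma>) else 0)" for n k \<sigma>
    by (simp_all add: Y_def)
  have Yb: "\<forall>k\<in>K. abs_series l r \<epsilon> (Y n k)" for n
  proof (induction n)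
    case 0
    then show ?case
      using abs_series_mono[OF abs_series_const[OF r, of l 0], of \<epsilon>] \<epsilon> by (simp add: Y0 [abs_def])
  next
    case (Suc n)
    show ?case
    proof
      fix k assume k: "k \<in> K"
      have "abs_series l r (\<epsilon> + \<epsilon>) (\<lambda>\<sigma>. Y n j \<sigma> - Y n j \<sigma>)" if "j \<in> K" for j
        using Suc that by (intro abs_series_diff r) auto
      then have "lip_data K l r \<epsilon> (\<epsilon> + \<epsilon>) (Y n) (Y n)"
        using Suc r \<epsilon> by (auto simp: lip_data_def)
      from abs_series_diff[OF r zr[OF k] lip(2)[OF k this]]
      have "abs_series l r (\<epsilon> / 2 + C k * \<epsilon> * \<epsilon>) (Y (Suc n) k)"
        using k by (simp add: YS [abs_def])
      moreover have "\<epsilon> / 2 + C k * \<epsilon> * \<epsilon> \<le> \<epsilon>"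
        using mult_right_mono[OF C\<epsilon>[OF k], of \<epsilon>] \<epsilon> by linarith
      ultimately show "abs_series l r \<epsilon> (Y (Suc n) k)" by (rule abs_series_mono)
    qed
  qed
  have Yd: "\<forall>k\<in>K. abs_series l r (\<epsilon> * (1 / 2) ^ n) (\<lambda>\<sigma>. Y (Suc n) k \<sigma> - Y n k \<sigma>)" for n
  proof (induction n)
    case 0
    then show ?case using Yb[of "Suc 0"] by (simp add: Y0)
  next
    case (Suc n)
    show ?case
    proof
      fix k assume k: "k \<in> K"
      have "lip_data K l r \<epsilon> (\<epsilon> * (1 / 2) ^ n) (Y (Suc n)) (Y n)"
        using Yb[of n] Yb[of "Suc n"] Suc r \<epsilon> by (simp add: lip_data_def)
      from abs_series_cmult[OF r lip(1)[OF k this], where a = "-1"]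
      have "abs_series l r (C k * \<epsilon> * (\<epsilon> * (1 / 2) ^ n)) (\<lambda>\<sigma>. Y (Suc (Suc n)) k \<sigma> - Y (Suc n) k \<sigma>)"
        using k by (simp add: YS[of "Suc n" k] YS[of n k])
      moreover have "C k * \<epsilon> * (\<epsilon> * (1 / 2) ^ n) \<le> \<epsilon> * (1 / 2) ^ Suc n"
        using mult_right_mono[OF C\<epsilon>[OF k], of "\<epsilon> * (1 / 2) ^ n"] \<epsilon> by simp
      ultimately show "abs_series l r (\<epsilon> * (1 / 2) ^ Suc n) (\<lambda>\<sigma>. Y (Suc (Suc n)) k \<sigma> - Y (Suc n) k \<sigma>)"
        by (rule abs_series_mono)
    qed
  qed
  \<comment> \<open>The limit is written as a telescoping series, the form to which
    \<open>abs_series_suminf\<close> applies.\<close>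
  define y where "y k \<sigma> = (\<Sum>n. Y (Suc n) k \<sigma> - Y n k \<sigma>)" for k \<sigma>
  have geo: "(\<lambda>n. \<epsilon> * (1 / 2) ^ n) sums (\<epsilon> * 2)"
    using sums_mult[OF geometric_sums[of "1 / 2 :: real"], of \<epsilon>] by simp
  have conv: "(\<lambda>n. Y n k \<sigma>) \<longlonglongrightarrow> y k \<sigma>" if k: "k \<in> K" and \<sigma>: "\<sigma> \<in> closed_polydisc l r" for k \<sigma>
  proof -
    have "cmod (Y (Suc n) k \<sigma> - Y n k \<sigma>) \<le> \<epsilon> * (1 / 2) ^ n" for n
      by (rule abs_series_norm_le[OF Yd[rule_format, OF k] \<sigma>])
    then have "summable (\<lambda>n. Y (Suc n) k \<sigma> - Y n k \<sigma>)"
      by (intro summable_comparison_test'[OF sums_summable[OF geo], of 0]) auto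
    from summable_LIMSEQ[OF this] show ?thesis
      unfolding sum_lessThan_telescope[of "\<lambda>n. Y n k \<sigma>"] y_def by (simp add: Y0)
  qed
  show ?thesis
  proof (rule that[OF r])
    fix k assume k: "k \<in> K"
    show "abs_series l r 1 (y k)"
      unfolding y_def [abs_def]
    proof (rule abs_series_suminf[OF r _ sums_summable[OF geo]])
      show "abs_series l r (\<epsilon> * (1 / 2) ^ n) (\<lambda>\<sigma>. Y (Suc n) k \<sigma> - Y n k \<sigma>)" for n
        using Yd k by blast
      show "(\<Sum>n. \<epsilon> * (1 / 2) ^ n) \<le> 1"
        unfolding sums_unique[OF geo, symmetric] using \<epsilon> by simp
    qed
    have "Y n j (0\<^sub>v l) = 0" for n j
      by (induction n arbitrary: j) (auto simp: Y0 YS z lip_map_zero[OF q])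
    then show "y k (0\<^sub>v l) = 0" by (simp add: y_def)
    fix \<sigma> assume \<sigma>: "\<sigma> \<in> closed_polydisc l r"
    have "(\<lambda>n. Y (Suc n) k \<sigma>) \<longlonglongrightarrow> z k \<sigma> - q k (\<lambda>j. y j \<sigma>)"
      using k by (simp add: YS) (intro tendsto_intros lip_map_tendsto[OF q[OF k]] conv \<sigma>)
    then show "y k \<sigma> = z k \<sigma> - q k (\<lambda>j. y j \<sigma>)"
      using LIMSEQ_unique LIMSEQ_Suc[OF conv[OF k \<sigma>]] by blast
  qed
qed

section \<open>Versality of linear complements\<close>

text \<open>For a linear space \<open>T\<close> of functions on \<open>I\<close>, this says that
  \<open>T\<close> and the functions supported on \<open>S\<close> are complementary: they span
  (first clause) and meet in 0 (second clause). Testing by restriction to \<open>I - S\<close>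
  involves neither bases nor dimensions.\<close>

definition complements :: "'i set \<Rightarrow> ('i \<Rightarrow> complex) set \<Rightarrow> 'i set \<Rightarrow> bool" where
  "complements I T S \<longleftrightarrow> (\<forall>u. \<exists>t\<in>T. \<forall>i\<in>I - S. t i = u i) \<and>
     (\<forall>t\<in>T. (\<forall>i\<in>I - S. t i = 0) \<longrightarrow> (\<forall>i\<in>I. t i = 0))"

definition pair_entry :: "'a mat \<times> 'a mat \<Rightarrow> bool \<Rightarrow> nat \<Rightarrow> nat \<Rightarrow> 'a" where
  "pair_entry P c i j = (if c then snd P else fst P) $$ (i, j)"

definition upper_positions :: "nat \<Rightarrow> (bool \<times> nat \<times> nat) set" where
  "upper_positions n = {(c, i, j). i < j \<and> j < n}"

definition congruence_action ::
    "nat \<Rightarrow> (bool \<Rightarrow> nat \<Rightarrow> nat \<Rightarrow> complex) \<Rightarrow> (nat \<Rightarrow> nat \<Rightarrow> complex) \<Rightarrow> bool \<times> nat \<times> nat \<Rightarrow> complex" where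
  "congruence_action n A S = (\<lambda>(c, i, j). (\<Sum>k<n. S k i * A c k j) + (\<Sum>k<n. A c i k * S k j))"

definition star_positions :: "nat \<Rightarrow> star_pair \<Rightarrow> (bool \<times> nat \<times> nat) set" where
  "star_positions n D = {(c, i, j). i < j \<and> j < n \<and> pair_entry D c i j}"

lemma finite_upper_positions [simp]: "finite (upper_positions n)"
  by (rule finite_subset[of _ "UNIV \<times> {..<n} \<times> {..<n}"]) (auto simp: upper_positions_def)

lemma star_positions_subset: "star_positions n D \<subseteq> upper_positions n"
  by (auto simp: star_positions_def upper_positions_def)

section \<open>Star parameters and congruences in coordinates\<close>

definition star_position :: "nat \<Rightarrow> star_pair \<Rightarrow> nat \<Rightarrow> bool \<times> nat \<times> nat" where
  "star_position n D s = (let k = length (Ind n (fst D)) in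
     if s < k then (False, Ind n (fst D) ! s) else (True, Ind n (snd D) ! (s - k)))"

definition star_basis :: "nat \<Rightarrow> star_pair \<Rightarrow> nat \<Rightarrow> bool \<Rightarrow> nat \<Rightarrow> nat \<Rightarrow> complex" where
  "star_basis n D s c i j =
     (if fst (star_position n D s) = c then E_mat n (snd (star_position n D s)) $$ (i, j) else 0)"

lemma set_Ind: "set (Ind n D) = {(i, j). i < j \<and> j < n \<and> D $$ (i, j)}"
  by (auto simp: Ind_def)

lemma distinct_Ind: "distinct (Ind n D)"
  by (simp add: Ind_def distinct_product)

lemma bij_betw_star_position:
  "bij_betw (star_position n D) {..<num_params n D} (star_positions n D)"
proof -
  let ?k = "length (Ind n (fst D))" and ?k' = "length (Ind n (snd D))"
  have 1: "bij_betw (star_position n D) {..<?k} (Pair False ` set (Ind n (fst D)))"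
  proof -
    have "bij_betw (\<lambda>s. (False, Ind n (fst D) ! s)) {..<?k} (Pair False ` set (Ind n (fst D)))"
      using bij_betw_nth[OF distinct_Ind refl refl, of n "fst D"]
      by (auto simp: bij_betw_def inj_on_def image_iff)
    then show ?thesis
      by (rule bij_betw_cong[THEN iffD1, rotated]) (simp add: star_position_def)
  qed
  have 2: "bij_betw (star_position n D) {?k..<?k + ?k'} (Pair True ` set (Ind n (snd D)))"
  proof -
    have "bij_betw (\<lambda>s. s - ?k) {?k..<?k + ?k'} {..<?k'}"
      by (rule bij_betw_byWitness[where f' = "\<lambda>s. s + ?k"]) auto
    moreover have "bij_betw (\<lambda>s. (True, Ind n (snd D) ! s)) {..<?k'} (Pair True ` set (Ind n (snd D)))"
      using bij_betw_nth[OF distinct_Ind refl refl, of n "snd D"]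
      by (auto simp: bij_betw_def inj_on_def image_iff)
    ultimately have "bij_betw ((\<lambda>s. (True, Ind n (snd D) ! s)) \<circ> (\<lambda>s. s - ?k)) {?k..<?k + ?k'}
        (Pair True ` set (Ind n (snd D)))"
      by (rule bij_betw_trans)
    then show ?thesis
      by (rule bij_betw_cong[THEN iffD1, rotated]) (simp add: star_position_def)
  qed
  have "bij_betw (star_position n D) ({..<?k} \<union> {?k..<?k + ?k'})
      (Pair False ` set (Ind n (fst D)) \<union> Pair True ` set (Ind n (snd D)))"
    by (rule bij_betw_combine[OF 1 2]) auto
  moreover have "{..<?k} \<union> {?k..<?k + ?k'} = {..<num_params n D}"
    by (auto simp: num_params_def)
  moreover have "Pair False ` set (Ind n (fst D)) \<union> Pair True ` set (Ind n (snd D)) = star_positions n D"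
    by (auto simp: set_Ind star_positions_def pair_entry_def split: if_splits)
  ultimately show ?thesis by simp
qed

lemma star_position_upper:
  "s < num_params n D \<Longrightarrow> star_position n D s \<in> upper_positions n"
  using bij_betw_star_position[of n D] star_positions_subset[of n D] by (auto simp: bij_betw_def)

lemma star_basis_upper:
  assumes "(c, i, j) \<in> upper_positions n" "s < num_params n D"
  shows "star_basis n D s c i j = (if star_position n D s = (c, i, j) then 1 else 0)"
  using assms star_position_upper[OF assms(2)]
  by (cases "star_position n D s") (auto simp: star_basis_def upper_positions_def E_mat_def)

lemma star_basis_skew:
  assumes "i < n" "j < n" "s < num_params n D"
  shows "star_basis n D s c j i = - star_basis n D s c i j"
  using assms star_position_upper[OF assms(3)]
  by (cases "star_position n D s") (auto simp: star_basis_def upper_positions_def E_mat_def)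

lemma star_pair_sum_carrier [simp]:
  "fst (star_pair_sum n D \<epsilon>) \<in> carrier_mat n n" "snd (star_pair_sum n D \<epsilon>) \<in> carrier_mat n n"
  by (simp_all add: star_pair_sum_def star_sum_def)

lemma pair_entry_star_pair_sum:
  assumes "\<epsilon> \<in> carrier_vec (num_params n D)" "i < n" "j < n"
  shows "pair_entry (star_pair_sum n D \<epsilon>) c i j = (\<Sum>s<num_params n D. \<epsilon> $ s * star_basis n D s c i j)"
proof -
  let ?k = "length (Ind n (fst D))" and ?k' = "length (Ind n (snd D))"
  have d: "dim_vec \<epsilon> = ?k + ?k'" using assms(1) by (simp add: num_params_def)
  have "(\<Sum>s<num_params n D. \<epsilon> $ s * star_basis n D s c i j) =
      (\<Sum>s<?k. \<epsilon> $ s * star_basis n D s c i j) + (\<Sum>s=?k..<?k + ?k'. \<epsilon> $ s * star_basis n D s c i j)"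
    unfolding num_params_def by (subst sum.union_disjoint[symmetric]) (auto intro: sum.cong)
  also have "(\<Sum>s=?k..<?k + ?k'. \<epsilon> $ s * star_basis n D s c i j) =
      (\<Sum>s<?k'. \<epsilon> $ (?k + s) * star_basis n D (?k + s) c i j)"
    by (rule sum.reindex_bij_witness[where i = "\<lambda>s. ?k + s" and j = "\<lambda>s. s - ?k"]) auto
  also have "(\<Sum>s<?k. \<epsilon> $ s * star_basis n D s c i j) =
      (if c then 0 else fst (star_pair_sum n D \<epsilon>) $$ (i, j))"
    using assms d by (simp add: star_pair_sum_def star_sum_def star_basis_def star_position_def vec_first_def)
  also have "(\<Sum>s<?k'. \<epsilon> $ (?k + s) * star_basis n D (?k + s) c i j) =
      (if c then snd (star_pair_sum n D \<epsilon>) $$ (i, j) else 0)"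
    using assms d by (simp add: star_pair_sum_def star_sum_def star_basis_def star_position_def vec_last_def)
  finally show ?thesis by (simp add: pair_entry_def)
qed

lemma skew_pair_iff_entries:
  "skew_pair n P \<longleftrightarrow> fst P \<in> carrier_mat n n \<and> snd P \<in> carrier_mat n n \<and>
     (\<forall>c. \<forall>i<n. \<forall>j<n. pair_entry P c j i = - pair_entry P c i j)"
proof -
  have skew_mat_iff: "skew_mat n M \<longleftrightarrow> M \<in> carrier_mat n n \<and> (\<forall>i<n. \<forall>j<n. M $$ (j, i) = - M $$ (i, j))" for M
  proof (cases "M \<in> carrier_mat n n")
    case True
    have entry: "transpose_mat M $$ (i, j) = M $$ (j, i)" "(- M) $$ (i, j) = - M $$ (i, j)"
      if "i < n" "j < n" for i j
      using True that by simp_all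
    have "transpose_mat M = - M \<longleftrightarrow> (\<forall>i<n. \<forall>j<n. M $$ (j, i) = - M $$ (i, j))"
    proof (intro iffI allI impI)
      assume eq: "\<forall>i<n. \<forall>j<n. M $$ (j, i) = - M $$ (i, j)"
      show "transpose_mat M = - M"
      proof (rule eq_matI)
        fix i j assume "i < dim_row (- M)" "j < dim_col (- M)"
        then have "i < n" "j < n" using True by simp_all
        then show "transpose_mat M $$ (i, j) = (- M) $$ (i, j)"
          unfolding entry[OF \<open>i < n\<close> \<open>j < n\<close>] using eq by blast
      qed (use True in simp_all)
    next
      fix i j assume "transpose_mat M = - M" "i < n" "j < n"
      then show "M $$ (j, i) = - M $$ (i, j)" using entry[of i j] by metis
    qed
    then show ?thesis using True unfolding skew_mat_def by blast
  qed (simp add: skew_mat_def)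
  show ?thesis
    unfolding skew_pair_def skew_mat_iff pair_entry_def all_bool_eq if_True if_False by blast
qed

lemma pair_eqI:
  assumes "fst P \<in> carrier_mat n n" "snd P \<in> carrier_mat n n" "fst Q \<in> carrier_mat n n" "snd Q \<in> carrier_mat n n"
    "\<And>c i j. i < n \<Longrightarrow> j < n \<Longrightarrow> pair_entry P c i j = pair_entry Q c i j"
  shows "P = Q"
proof (rule prod_eqI)
  show "fst P = fst Q" using assms(1-4) assms(5)[of _ _ False] by (intro eq_matI) (auto simp: pair_entry_def)
  show "snd P = snd Q" using assms(1-4) assms(5)[of _ _ True] by (intro eq_matI) (auto simp: pair_entry_def)
qed

lemma pair_entry_add_pair:
  assumes "fst Q \<in> carrier_mat n n" "snd Q \<in> carrier_mat n n" "i < n" "j < n"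
  shows "pair_entry (add_pair P Q) c i j = pair_entry P c i j + pair_entry Q c i j"
  using assms by (auto simp: pair_entry_def add_pair_def)

lemma pair_entry_mult_pair:
  assumes "M \<in> carrier_mat n n" "fst P \<in> carrier_mat n n" "snd P \<in> carrier_mat n n" "i < n" "j < n"
  shows "pair_entry (mult_pair (transpose_mat M) P M) c i j =
    (\<Sum>a<n. \<Sum>b<n. M $$ (a, i) * pair_entry P c a b * M $$ (b, j))"
proof -
  have "(transpose_mat M * B * M) $$ (i, j) = (\<Sum>a<n. \<Sum>b<n. M $$ (a, i) * B $$ (a, b) * M $$ (b, j))"
    if "B \<in> carrier_mat n n" for B
    using assms that
    by (simp add: scalar_prod_def sum_distrib_left mult.assoc atLeast0LessThan)
  then show ?thesis using assms by (simp add: pair_entry_def mult_pair_def)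
qed

text \<open>An entry of (I + X)^T A (I + X), sorted by degree in X so that the linear part, which
  gets inverted, is split from the remainder.\<close>

lemma congruence_expand:
  fixes X A :: "nat \<Rightarrow> nat \<Rightarrow> complex"
  assumes "i < n" "j < n"
  shows "(\<Sum>a<n. \<Sum>b<n. ((if a = i then 1 else 0) + X a i) * A a b * ((if b = j then 1 else 0) + X b j)) =
    A i j + (\<Sum>b<n. A i b * X b j) + (\<Sum>a<n. X a i * A a j) + (\<Sum>a<n. \<Sum>b<n. X a i * A a b * X b j)"
proof -
  have inner: "(\<Sum>b<n. ((if a = i then 1 else 0) + X a i) * A a b * ((if b = j then 1 else 0) + X b j)) =
      (if a = i then A a j else 0) + X a i * A a j + (if a = i then \<Sum>b<n. A a b * X b j else 0) +
      (\<Sum>b<n. X a i * A a b * X b j)" for a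
  proof -
    have "(\<Sum>b<n. ((if a = i then 1 else 0) + X a i) * A a b * ((if b = j then 1 else 0) + X b j)) =
      (\<Sum>b<n. (if b = j then (if a = i then A a j else 0) + X a i * A a j else 0) +
         (if a = i then A a b * X b j else 0) + X a i * A a b * X b j)"
      by (intro sum.cong refl) (simp add: algebra_simps)
    also have "\<dots> = (if a = i then A a j else 0) + X a i * A a j + (if a = i then \<Sum>b<n. A a b * X b j else 0) +
      (\<Sum>b<n. X a i * A a b * X b j)"
      using assms by (simp add: sum.distrib)
    finally show ?thesis .
  qed
  show ?thesis unfolding inner using assms by (simp add: sum.distrib)
qed

lemma skew_pairD:
  assumes "skew_pair n P"
  shows "fst P \<in> carrier_mat n n" "snd P \<in> carrier_mat n n"
    "i < n \<Longrightarrow> j < n \<Longrightarrow> pair_entry P c j i = - pair_entry P c i j"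
  using assms unfolding skew_pair_iff_entries by blast+

lemma skew_pair_star_pair_sum:
  assumes "\<epsilon> \<in> carrier_vec (num_params n D)"
  shows "skew_pair n (star_pair_sum n D \<epsilon>)"
proof -
  have "pair_entry (star_pair_sum n D \<epsilon>) c j i = - pair_entry (star_pair_sum n D \<epsilon>) c i j"
    if "i < n" "j < n" for c i j
    unfolding pair_entry_star_pair_sum[OF assms that] pair_entry_star_pair_sum[OF assms that(2,1)]
      sum_negf [symmetric]
  proof (rule sum.cong[OF refl])
    fix s assume "s \<in> {..<num_params n D}"
    then have "star_basis n D s c j i = - star_basis n D s c i j"
      by (intro star_basis_skew that) simp
    then show "\<epsilon> $ s * star_basis n D s c j i = - (\<epsilon> $ s * star_basis n D s c i j)"
      by (simp only: mult_minus_right)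
  qed
  then show ?thesis unfolding skew_pair_iff_entries using star_pair_sum_carrier by blast
qed

lemma skew_pair_add:
  assumes "skew_pair n P" "skew_pair n Q"
  shows "skew_pair n (add_pair P Q)"
proof -
  note P = skew_pairD[OF assms(1)] and Q = skew_pairD[OF assms(2)]
  have "pair_entry (add_pair P Q) c j i = - pair_entry (add_pair P Q) c i j"
    if "i < n" "j < n" for c i j
    unfolding pair_entry_add_pair[OF Q(1,2) that] pair_entry_add_pair[OF Q(1,2) that(2,1)]
      P(3)[OF that] Q(3)[OF that] by simp
  moreover have "fst (add_pair P Q) \<in> carrier_mat n n" "snd (add_pair P Q) \<in> carrier_mat n n"
    using P(1,2) Q(1,2) by (simp_all add: add_pair_def)
  ultimately show ?thesis unfolding skew_pair_iff_entries by blast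
qed

lemma skew_pair_mult:
  assumes "skew_pair n P" "M \<in> carrier_mat n n"
  shows "skew_pair n (mult_pair (transpose_mat M) P M)"
proof -
  note P = skew_pairD[OF assms(1)]
  have "pair_entry (mult_pair (transpose_mat M) P M) c j i = - pair_entry (mult_pair (transpose_mat M) P M) c i j"
    if "i < n" "j < n" for c i j
  proof -
    have "(\<Sum>a<n. \<Sum>b<n. M $$ (a, j) * pair_entry P c a b * M $$ (b, i)) =
        (\<Sum>b<n. \<Sum>a<n. M $$ (a, j) * pair_entry P c a b * M $$ (b, i))" by (rule sum.swap)
    also have "\<dots> = (\<Sum>a<n. \<Sum>b<n. - (M $$ (a, i) * pair_entry P c a b * M $$ (b, j)))"
    proof (intro sum.cong refl)
      fix a b assume "a \<in> {..<n}" "b \<in> {..<n}"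
      then have "pair_entry P c b a = - pair_entry P c a b" by (intro P(3)) simp_all
      then show "M $$ (b, j) * pair_entry P c b a * M $$ (a, i) = - (M $$ (a, i) * pair_entry P c a b * M $$ (b, j))"
        by simp
    qed
    finally show ?thesis using that assms P(1,2) by (simp add: pair_entry_mult_pair sum_negf)
  qed
  moreover have "fst (mult_pair (transpose_mat M) P M) \<in> carrier_mat n n"
    "snd (mult_pair (transpose_mat M) P M) \<in> carrier_mat n n"
    using P(1,2) assms(2) by (simp_all add: mult_pair_def)
  ultimately show ?thesis unfolding skew_pair_iff_entries by blast
qed

lemma skew_pair_eqI:
  assumes "skew_pair n P" "skew_pair n Q"
    "\<And>c i j. (c, i, j) \<in> upper_positions n \<Longrightarrow> pair_entry P c i j = pair_entry Q c i j"
  shows "P = Q"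
proof (rule pair_eqI[OF skew_pairD(1,2)[OF assms(1)] skew_pairD(1,2)[OF assms(2)]])
  fix c i j assume ij: "i < n" "j < n"
  consider "i < j" | "j < i" | "i = j" by linarith
  then show "pair_entry P c i j = pair_entry Q c i j"
  proof cases
    case 1
    then show ?thesis using assms(3) ij by (simp add: upper_positions_def)
  next
    case 2
    then have "pair_entry P c j i = pair_entry Q c j i" using assms(3) ij by (simp add: upper_positions_def)
    then show ?thesis
      using skew_pairD(3)[OF assms(1) ij(2,1), of c] skew_pairD(3)[OF assms(2) ij(2,1), of c] by simp
  next
    case 3
    then show ?thesis
      using skew_pairD(3)[OF assms(1) ij(1,1), of c] skew_pairD(3)[OF assms(2) ij(1,1), of c] by simp
  qed
qed

lemma zero_in_polydisc: "r > 0 \<Longrightarrow> 0\<^sub>v l \<in> polydisc l (0\<^sub>v l) r"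
  by (simp add: polydisc_def)

lemma open_nbhd0_contains_polydisc:
  assumes "open_nbhd0 l U"
  obtains r where "r > 0" "polydisc l (0\<^sub>v l) r \<subseteq> U"
  using assms unfolding open_nbhd0_def open_params_def by blast

lemma polydisc_mono: "r \<le> r' \<Longrightarrow> polydisc l w r \<subseteq> polydisc l w r'"
  by (force simp: polydisc_def)

lemma power_series_at_diff_const:
  assumes "power_series_at l f (0\<^sub>v l)"
  shows "power_series_at l (\<lambda>\<sigma>. f \<sigma> - a) (0\<^sub>v l)"
proof -
  obtain R c s where R: "R > 0" and "has_abs_series l R c s f"
    using power_series_at_imp_has_abs_series[OF assms] .
  then have "abs_series l R s f" unfolding abs_series_def by blast
  from abs_series_diff[OF R this abs_series_const[OF R, of l a]] R
  show ?thesis by (rule abs_series_imp_power_series_at) (simp add: zero_in_polydisc R)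
qed

lemma holomorphic_entry:
  assumes "holomorphic_mat n l (\<lambda>\<delta>. fst (F \<delta>)) U" "holomorphic_mat n l (\<lambda>\<delta>. snd (F \<delta>)) U"
    "i < n" "j < n"
  shows "holomorphic_params l (\<lambda>\<delta>. pair_entry (F \<delta>) c i j) U"
  using assms by (cases c) (auto simp: holomorphic_mat_def pair_entry_def)

lemma deformation_power_series:
  assumes "deformation n l P G" "i < n" "j < n"
  shows "power_series_at l (\<lambda>\<delta>. pair_entry (G \<delta>) c i j) (0\<^sub>v l)"
proof -
  obtain U where U: "open_nbhd0 l U" "holomorphic_mat n l (\<lambda>\<delta>. fst (G \<delta>)) U"
      "holomorphic_mat n l (\<lambda>\<delta>. snd (G \<delta>)) U"
    using assms(1) unfolding deformation_def by blast
  then show ?thesis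
    using holomorphic_entry[OF U(2,3) assms(2,3), of c] by (simp add: holomorphic_params_def open_nbhd0_def)
qed

lemma deformation_add_star_pair_sum:
  assumes "skew_pair n P"
  shows "deformation n (num_params n D) P (\<lambda>\<epsilon>. add_pair P (star_pair_sum n D \<epsilon>))"
proof -
  let ?N = "num_params n D" and ?F = "\<lambda>\<epsilon>. add_pair P (star_pair_sum n D \<epsilon>)"
  define U where "U = polydisc ?N (0\<^sub>v ?N) 1"
  have U: "\<epsilon> \<in> carrier_vec ?N" if "\<epsilon> \<in> U" for \<epsilon>
    using that by (simp add: U_def polydisc_def)
  have skew: "skew_pair n (?F \<epsilon>)" if "\<epsilon> \<in> carrier_vec ?N" for \<epsilon>
    by (intro skew_pair_add assms skew_pair_star_pair_sum that)
  have hol: "holomorphic_params ?N (\<lambda>\<epsilon>. pair_entry (?F \<epsilon>) c i j) U" if "i < n" "j < n" for c i j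
  proof -
    have "abs_series ?N 1 (cmod (pair_entry P c i j) + (\<Sum>s<?N. cmod (star_basis n D s c i j) * 1))
        (\<lambda>\<epsilon>. pair_entry P c i j + (\<Sum>s<?N. star_basis n D s c i j * \<epsilon> $ s))"
      by (intro abs_series_add abs_series_sum abs_series_const abs_series_cmult abs_series_coord) auto
    then have "abs_series ?N 1 (cmod (pair_entry P c i j) + (\<Sum>s<?N. cmod (star_basis n D s c i j) * 1))
        (\<lambda>\<epsilon>. pair_entry (?F \<epsilon>) c i j)"
      by (rule abs_series_cong)
        (use that in \<open>simp add: closed_polydisc_def pair_entry_add_pair[of _ n] pair_entry_star_pair_sum mult.commute\<close>)
    then show ?thesis unfolding U_def by (rule abs_series_imp_holomorphic) simp
  qed
  have "?F (0\<^sub>v ?N) = P"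
  proof (rule skew_pair_eqI[OF skew assms])
    show "pair_entry (?F (0\<^sub>v ?N)) c i j = pair_entry P c i j" if "(c, i, j) \<in> upper_positions n" for c i j
      using that by (auto simp: upper_positions_def pair_entry_add_pair[of _ n] pair_entry_star_pair_sum)
  qed simp
  moreover have "open_nbhd0 ?N U" unfolding U_def by (rule open_nbhd0_polydisc) simp
  moreover have "holomorphic_mat n ?N (\<lambda>\<epsilon>. fst (?F \<epsilon>)) U"
    using hol[of _ _ False] skew_pairD(1)[OF skew[OF U]] by (auto simp: holomorphic_mat_def pair_entry_def)
  moreover have "holomorphic_mat n ?N (\<lambda>\<epsilon>. snd (?F \<epsilon>)) U"
    using hol[of _ _ True] skew_pairD(2)[OF skew[OF U]] by (auto simp: holomorphic_mat_def pair_entry_def)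
  ultimately show ?thesis unfolding deformation_def using skew U by blast
qed

lemma sum_mult_swap:
  fixes b y :: "_ \<Rightarrow> complex"
  shows "(\<Sum>s\<in>A. b s * (\<Sum>k\<in>B. e k s * y k)) = (\<Sum>k\<in>B. y k * (\<Sum>s\<in>A. e k s * b s))"
proof -
  have "(\<Sum>s\<in>A. b s * (\<Sum>k\<in>B. e k s * y k)) = (\<Sum>s\<in>A. \<Sum>k\<in>B. y k * (e k s * b s))"
    by (simp add: sum_distrib_left mult.commute mult.left_commute)
  also have "\<dots> = (\<Sum>k\<in>B. \<Sum>s\<in>A. y k * (e k s * b s))" by (rule sum.swap)
  finally show ?thesis by (simp add: sum_distrib_left)
qed

section \<open>Versality\<close>

lemma versal_add_star_pair_sum:
  assumes P: "skew_pair n P"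
    and compl: "complements (upper_positions n) (range (congruence_action n (pair_entry P))) (star_positions n D)"
  shows "versal n (num_params n D) P (\<lambda>\<epsilon>. add_pair P (star_pair_sum n D \<epsilon>))"
  unfolding versal_def
proof (intro conjI deformation_add_star_pair_sum P allI impI)
  fix l G assume G: "deformation n l P G"
  let ?I = "upper_positions n" and ?N = "num_params n D" and ?A = "pair_entry P"
  \<comment> \<open>Surjectivity off the stars, applied to each unit vector \<open>k\<close>, gives
    a matrix \<open>S k\<close>; extended linearly, these form the transformation part of the right
    inverse.\<close>
  have "\<forall>k. \<exists>S. \<forall>i\<in>?I - star_positions n D. congruence_action n ?A S i = (if i = k then 1 else 0)"
  proof
    fix k
    from compl have "\<forall>u. \<exists>t\<in>range (congruence_action n ?A). \<forall>i\<in>?I - star_positions n D. t i = u i"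
      unfolding complements_def by (rule conjunct1)
    from spec[OF this, of "\<lambda>i. if i = k then 1 else 0"]
    show "\<exists>S. \<forall>i\<in>?I - star_positions n D. congruence_action n ?A S i = (if i = k then 1 else 0)"
      by (simp only: bex_simps)
  qed
  then have "\<exists>S. \<forall>k. \<forall>i\<in>?I - star_positions n D. congruence_action n ?A (S k) i = (if i = k then 1 else 0)"
    by (rule choice)
  then obtain S where S: "\<forall>k. \<forall>i\<in>?I - star_positions n D.
      congruence_action n ?A (S k) i = (if i = k then 1 else 0)"
    by (rule exE)
  \<comment> \<open>At the star positions the parameters correct what \<open>S k\<close> gets wrong,
    so that \<open>S k\<close> together with \<open>e k\<close> reproduces the unit vector
    exactly.\<close>
  define e where "e k s = (if star_position n D s = k then 1 else 0) - congruence_action n ?A (S k) (star_position n D s)"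
    for k s
  have surj: "star_position n D ` {..<?N} = star_positions n D" and inj: "inj_on (star_position n D) {..<?N}"
    using bij_betw_star_position[of n D] by (simp_all add: bij_betw_def)
  have split_unit: "congruence_action n ?A (S k) (c, i, j) + (\<Sum>s<?N. e k s * star_basis n D s c i j) =
      (if (c, i, j) = k then 1 else 0)" if I: "(c, i, j) \<in> ?I" for k c i j
  proof (cases "(c, i, j) \<in> star_positions n D")
    case True
    then obtain t where t: "t < ?N" "star_position n D t = (c, i, j)"
      unfolding surj [symmetric] by (metis imageE lessThan_iff)
    have "(\<Sum>s<?N. e k s * star_basis n D s c i j) = (\<Sum>s<?N. if s = t then e k t else 0)"
    proof (rule sum.cong[OF refl])
      fix s assume s: "s \<in> {..<?N}"
      have "star_position n D s = (c, i, j) \<longleftrightarrow> s = t"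
        using inj_onD[OF inj, of s t] s t by auto
      then show "e k s * star_basis n D s c i j = (if s = t then e k t else 0)"
        using star_basis_upper[OF I, of s D] s by simp
    qed
    then show ?thesis using t by (simp add: e_def)
  next
    case False
    have "(\<Sum>s<?N. e k s * star_basis n D s c i j) = 0"
    proof (rule sum.neutral, rule ballI)
      fix s assume s: "s \<in> {..<?N}"
      then have "star_position n D s \<noteq> (c, i, j)" using False surj by (metis imageI)
      then show "e k s * star_basis n D s c i j = 0" using star_basis_upper[OF I, of s D] s by simp
    qed
    moreover have "(c, i, j) \<in> ?I - star_positions n D" using False I by simp
    note S[rule_format, OF this, of k]
    ultimately show ?thesis by simp
  qed
  \<comment> \<open>Linear in \<open>y\<close> are \<open>X\<close>, the increment of the
    transformation, \<open>ph\<close>, the parameter values, and \<open>E\<close>, the resulting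
    matrices. The terms of higher degree of (I + X)^T (A + E) (I + X) go into
    \<open>q\<close>.\<close>
  define X where "X y i j = (\<Sum>k\<in>?I. S k i j * y k)" for y i j
  define ph where "ph s y = (\<Sum>k\<in>?I. e k s * y k)" for s y
  define E where "E y c i j = (\<Sum>s<?N. star_basis n D s c i j * ph s y)" for y c i j
  define q where "q p y = (case p of (c, i, j) \<Rightarrow>
      (\<Sum>b<n. E y c i b * X y b j) + (\<Sum>a<n. X y a i * E y c a j) +
      (\<Sum>a<n. \<Sum>b<n. ?A c a b * (X y a i * X y b j)) + (\<Sum>a<n. \<Sum>b<n. E y c a b * (X y a i * X y b j)))" for p y
  \<comment> \<open>By construction of the right inverse the linear terms add up to \<open>y\<close>
    itself, so the equation to be solved reads z = y + q(y).\<close>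
  have linear_part: "E y c i j + (\<Sum>b<n. ?A c i b * X y b j) + (\<Sum>a<n. X y a i * ?A c a j) = y (c, i, j)"
    if I: "(c, i, j) \<in> ?I" for y c i j
  proof -
    have "E y c i j = (\<Sum>k\<in>?I. y k * (\<Sum>s<?N. e k s * star_basis n D s c i j))"
      unfolding E_def ph_def by (rule sum_mult_swap)
    moreover have "(\<Sum>b<n. ?A c i b * X y b j) = (\<Sum>k\<in>?I. y k * (\<Sum>b<n. S k b j * ?A c i b))"
      unfolding X_def by (rule sum_mult_swap)
    moreover have "(\<Sum>a<n. X y a i * ?A c a j) = (\<Sum>k\<in>?I. y k * (\<Sum>a<n. S k a i * ?A c a j))"
      unfolding X_def mult.commute[of _ "?A c _ j"] sum_mult_swap by (simp only: mult.commute)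
    moreover have "congruence_action n ?A (S k) (c, i, j) =
        (\<Sum>a<n. S k a i * ?A c a j) + (\<Sum>b<n. S k b j * ?A c i b)" for k
      by (simp add: congruence_action_def mult.commute)
    ultimately have "E y c i j + (\<Sum>b<n. ?A c i b * X y b j) + (\<Sum>a<n. X y a i * ?A c a j) =
        (\<Sum>k\<in>?I. y k * (congruence_action n ?A (S k) (c, i, j) + (\<Sum>s<?N. e k s * star_basis n D s c i j)))"
      by (simp only: distrib_left sum.distrib ac_simps)
    also have "\<dots> = (\<Sum>k\<in>?I. if (c, i, j) = k then y k else 0)"
      using split_unit[OF I] by (intro sum.cong) auto
    also have "\<dots> = y (c, i, j)" using I by simp
    finally show ?thesis .
  qed
  have lipX: "lip_map ?I 0 (\<lambda>y. X y i j)" for i j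
    unfolding X_def by (intro lip_map_sum lip_map_cmult lip_map_coord)
  have lipE: "lip_map ?I 0 (\<lambda>y. E y c i j)" for c i j
    unfolding E_def ph_def by (intro lip_map_sum lip_map_cmult lip_map_coord)
  have lipXX: "lip_map ?I 1 (\<lambda>y. X y a i * X y b j)" for a i b j
    using lip_map_mult[OF lipX lipX, of a i b j] by simp
  have lipq: "lip_map ?I 1 (q p)" for p
  proof (cases p)
    case (fields c i j)
    have "lip_map ?I 1 (\<lambda>y. E y c i b * X y b j)" "lip_map ?I 1 (\<lambda>y. X y b i * E y c b j)"
      "lip_map ?I 1 (\<lambda>y. E y c a b * (X y a i * X y b j))" for a b
      using lip_map_mult[OF lipE lipX, of c i b b j] lip_map_mult[OF lipX lipE, of b i c b j]
        lip_map_mono[OF lip_map_mult[OF lipE lipXX], of 1 c a b a i b j] by simp_all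
    then show ?thesis
      unfolding q_def [abs_def] fields prod.case
      by (intro lip_map_add lip_map_sum lip_map_cmult lipXX)
  qed
  define z where "z p \<sigma> = (case p of (c, i, j) \<Rightarrow> pair_entry (G \<sigma>) c i j - ?A c i j)" for p \<sigma>
  have G0: "G (0\<^sub>v l) = P" using G by (simp add: deformation_def)
  have zps: "power_series_at l (z k) (0\<^sub>v l)" if k: "k \<in> ?I" for k
  proof (cases k)
    case (fields c i j)
    then have "i < n" "j < n" using k by (auto simp: upper_positions_def)
    then show ?thesis
      unfolding z_def fields prod.case
      by (intro power_series_at_diff_const deformation_power_series[OF G])
  qed
  have z0: "z k (0\<^sub>v l) = 0" for k by (cases k) (simp add: z_def G0)
  obtain r y where r: "r > 0" and y: "\<And>k. k \<in> ?I \<Longrightarrow> abs_series l r 1 (y k)"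
      "\<And>k. k \<in> ?I \<Longrightarrow> y k (0\<^sub>v l) = 0"
    and fixp: "\<And>k \<sigma>. k \<in> ?I \<Longrightarrow> \<sigma> \<in> closed_polydisc l r \<Longrightarrow> y k \<sigma> = z k \<sigma> - q k (\<lambda>j. y j \<sigma>)"
    using analytic_fixpoint[of ?I q l z] finite_upper_positions lipq zps z0 by metis
  define M where "M \<sigma> = mat n n (\<lambda>(i, j). (if i = j then 1 else 0) + X (\<lambda>k. y k \<sigma>) i j)" for \<sigma>
  define \<phi> where "\<phi> s \<sigma> = ph s (\<lambda>k. y k \<sigma>)" for s \<sigma>
  have Mc: "M \<sigma> \<in> carrier_mat n n" for \<sigma> by (simp add: M_def)
  have "identity_deformation n l M"
  proof -
    have "M (0\<^sub>v l) = 1\<^sub>m n"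
      unfolding M_def one_mat_def X_def using y by (intro cong_mat) auto
    moreover have "holomorphic_mat n l M (polydisc l (0\<^sub>v l) r)"
      unfolding holomorphic_mat_def
    proof (intro conjI ballI allI impI Mc)
      fix i j assume ij: "i < n" "j < n"
      have "abs_series l r (cmod (if i = j then 1 else 0) + (\<Sum>k\<in>?I. cmod (S k i j) * 1))
          (\<lambda>\<sigma>. (if i = j then 1 else 0) + (\<Sum>k\<in>?I. S k i j * y k \<sigma>))"
        using r y by (intro abs_series_add abs_series_sum abs_series_const abs_series_cmult) auto
      then have "abs_series l r (cmod (if i = j then 1 else 0) + (\<Sum>k\<in>?I. cmod (S k i j) * 1)) (\<lambda>\<sigma>. M \<sigma> $$ (i, j))"
        using ij by (simp add: M_def X_def)
      then show "holomorphic_params l (\<lambda>\<sigma>. M \<sigma> $$ (i, j)) (polydisc l (0\<^sub>v l) r)"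
        using r by (rule abs_series_imp_holomorphic)
    qed
    ultimately show ?thesis
      using open_nbhd0_polydisc[OF r] unfolding identity_deformation_def by blast
  qed
  moreover have "power_series_at l (\<phi> s) (0\<^sub>v l) \<and> \<phi> s (0\<^sub>v l) = 0" for s
  proof
    have "abs_series l r (\<Sum>k\<in>?I. cmod (e k s) * 1) (\<phi> s)"
      unfolding \<phi>_def [abs_def] ph_def using r y by (intro abs_series_sum abs_series_cmult) auto
    then show "power_series_at l (\<phi> s) (0\<^sub>v l)"
      by (rule abs_series_imp_power_series_at[OF _ r]) (simp add: zero_in_polydisc r)
    show "\<phi> s (0\<^sub>v l) = 0" using y by (simp add: \<phi>_def ph_def)
  qed
  moreover have "\<exists>V. open_nbhd0 l V \<and> (\<forall>\<sigma>\<in>V. G \<sigma> =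
      mult_pair (transpose_mat (M \<sigma>)) (add_pair P (star_pair_sum n D (vec ?N (\<lambda>i. \<phi> i \<sigma>)))) (M \<sigma>))"
  proof -
    obtain U where U: "open_nbhd0 l U" "\<And>\<sigma>. \<sigma> \<in> U \<Longrightarrow> skew_pair n (G \<sigma>)"
      using G unfolding deformation_def by blast
    obtain r' where r': "r' > 0" "polydisc l (0\<^sub>v l) r' \<subseteq> U"
      using open_nbhd0_contains_polydisc[OF U(1)] .
    \<comment> \<open>The fixed point equation holds on radius \<open>r\<close>; comparing only
      entries above the diagonal also requires \<open>G\<close> to be skew, whence the radius
      \<open>r'\<close>.\<close>
    define V where "V = polydisc l (0\<^sub>v l) (min r r')"
    have V: "\<sigma> \<in> closed_polydisc l r" "\<sigma> \<in> U" if "\<sigma> \<in> V" for \<sigma>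
      using that r' polydisc_subset_closed[of l r] polydisc_mono[of "min r r'" r l "0\<^sub>v l"]
        polydisc_mono[of "min r r'" r' l "0\<^sub>v l"] unfolding V_def by auto
    have "G \<sigma> = mult_pair (transpose_mat (M \<sigma>)) (add_pair P (star_pair_sum n D (vec ?N (\<lambda>i. \<phi> i \<sigma>)))) (M \<sigma>)"
      if \<sigma>: "\<sigma> \<in> V" for \<sigma>
    proof (rule skew_pair_eqI)
      let ?\<epsilon> = "vec ?N (\<lambda>i. \<phi> i \<sigma>)"
      let ?y = "\<lambda>k. y k \<sigma>"
      show "skew_pair n (G \<sigma>)" using V[OF \<sigma>] U by blast
      have skew: "skew_pair n (add_pair P (star_pair_sum n D ?\<epsilon>))"
        by (intro skew_pair_add P skew_pair_star_pair_sum) simp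
      then show "skew_pair n (mult_pair (transpose_mat (M \<sigma>)) (add_pair P (star_pair_sum n D ?\<epsilon>)) (M \<sigma>))"
        by (intro skew_pair_mult Mc)
      fix c i j assume I: "(c, i, j) \<in> ?I"
      then have ij: "i < n" "j < n" by (auto simp: upper_positions_def)
      have F: "pair_entry (add_pair P (star_pair_sum n D ?\<epsilon>)) c a b = ?A c a b + E ?y c a b"
        if "a < n" "b < n" for a b
        using that by (simp add: pair_entry_add_pair[of _ n] pair_entry_star_pair_sum E_def \<phi>_def mult.commute)
      have "pair_entry (mult_pair (transpose_mat (M \<sigma>)) (add_pair P (star_pair_sum n D ?\<epsilon>)) (M \<sigma>)) c i j =
          (\<Sum>a<n. \<Sum>b<n. ((if a = i then 1 else 0) + X ?y a i) * (?A c a b + E ?y c a b) *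
             ((if b = j then 1 else 0) + X ?y b j))"
        unfolding pair_entry_mult_pair[OF Mc skew_pairD(1,2)[OF skew] ij]
        using ij by (intro sum.cong refl) (simp add: M_def F)
      also have "\<dots> = ?A c i j + (E ?y c i j + (\<Sum>b<n. ?A c i b * X ?y b j) + (\<Sum>a<n. X ?y a i * ?A c a j)) +
          q (c, i, j) ?y"
        unfolding congruence_expand[OF ij, of "X ?y" "\<lambda>a b. ?A c a b + E ?y c a b"] q_def by (simp add: algebra_simps sum.distrib)
      also have "\<dots> = ?A c i j + y (c, i, j) \<sigma> + q (c, i, j) ?y"
        unfolding linear_part[OF I] by simp
      also have "\<dots> = pair_entry (G \<sigma>) c i j"
        unfolding fixp[OF I V(1)[OF \<sigma>]] by (simp add: z_def)
      finally show "pair_entry (G \<sigma>) c i j =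
          pair_entry (mult_pair (transpose_mat (M \<sigma>)) (add_pair P (star_pair_sum n D ?\<epsilon>)) (M \<sigma>)) c i j"
        by simp
    qed
    moreover have "open_nbhd0 l V" unfolding V_def using r r' by (intro open_nbhd0_polydisc) simp
    ultimately show ?thesis by blast
  qed
  ultimately show "\<exists>M \<phi>. identity_deformation n l M \<and>
      (\<forall>i<?N. power_series_at l (\<phi> i) (0\<^sub>v l) \<and> \<phi> i (0\<^sub>v l) = 0) \<and>
      (\<exists>V. open_nbhd0 l V \<and> (\<forall>\<sigma>\<in>V. G \<sigma> =
         mult_pair (transpose_mat (M \<sigma>)) (add_pair P (star_pair_sum n D (vec ?N (\<lambda>i. \<phi> i \<sigma>)))) (M \<sigma>)))"
    by blast
qed

section \<open>Minimality of the number of parameters\<close>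

lemma homogeneous_system_solution:
  fixes a :: "nat \<Rightarrow> nat \<Rightarrow> complex"
  assumes "m < N"
  obtains v where "v \<in> carrier_vec N" "v \<noteq> 0\<^sub>v N" "\<And>i. i < m \<Longrightarrow> (\<Sum>j<N. a i j * v $ j) = 0"
proof -
  \<comment> \<open>Padding with zero rows makes the system square; row \<open>m\<close> is zero
    because m < N, so the determinant vanishes.\<close>
  define B where "B = mat N N (\<lambda>(i, j). if i < m then a i j else 0)"
  have B: "B \<in> carrier_mat N N" by (simp add: B_def)
  have "B = mat\<^sub>r N N (\<lambda>i. if i = m then 0\<^sub>v N else row B i)"
    by (rule eq_matI) (auto simp: B_def)
  moreover have "det (mat\<^sub>r N N (\<lambda>i. if i = m then 0\<^sub>v N else row B i)) = 0"
    using assms B by (intro det_row_0) auto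
  ultimately have "det B = 0" by simp
  then obtain v where v: "v \<in> carrier_vec N" "v \<noteq> 0\<^sub>v N" "B *\<^sub>v v = 0\<^sub>v N"
    using det_0_iff_vec_prod_zero_field[OF B] by blast
  have "(\<Sum>j<N. a i j * v $ j) = 0" if i: "i < m" for i
  proof -
    have "(B *\<^sub>v v) $ i = (\<Sum>j<N. a i j * v $ j)"
      using i assms v(1) by (simp add: B_def scalar_prod_def atLeast0LessThan)
    then show ?thesis using v(3) i assms by simp
  qed
  then show ?thesis using v that by blast
qed

text \<open>The coefficient family \<open>a\<close> is the same for every direction
  \<open>v\<close>, so the directions in which several functions are stationary are the solutions of
  a linear system.\<close>

lemma power_series_at_line_derivative:
  assumes "power_series_at l f (0\<^sub>v l)"
  obtains a where "\<And>v. v \<in> carrier_vec l \<Longrightarrow>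
    ((\<lambda>t. f (t \<cdot>\<^sub>v v)) has_field_derivative (\<Sum>j<l. a j * v $ j)) (at 0)"
proof -
  obtain a C R where R: "R > 0" "C \<ge> 0" and
    *: "\<And>t z. 0 < t \<Longrightarrow> t \<le> R \<Longrightarrow> z \<in> closed_polydisc l t \<Longrightarrow>
       cmod (f z - f (0\<^sub>v l) - (\<Sum>j<l. a j * z $ j)) \<le> C * t ^ 2"
    using power_series_at_first_order[OF assms] by metis
  have "((\<lambda>t. f (t \<cdot>\<^sub>v v)) has_field_derivative (\<Sum>j<l. a j * v $ j)) (at 0)" if v: "v \<in> carrier_vec l" for v
  proof -
    \<comment> \<open>\<open>B\<close> dominates the coordinates of \<open>v\<close>, which puts h v
      into the polydisc of radius |h| B; the summand 1 keeps it positive.\<close>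
    define B where "B = 1 + (\<Sum>j<l. cmod (v $ j))"
    have B: "B > 0" "cmod (v $ j) \<le> B" if "j < l" for j
    proof -
      show "B > 0" by (simp add: B_def add_pos_nonneg sum_nonneg)
      have "cmod (v $ j) \<le> (\<Sum>j<l. cmod (v $ j))" using that by (intro member_le_sum) auto
      then show "cmod (v $ j) \<le> B" by (simp add: B_def)
    qed
    have B0: "B > 0" by (simp add: B_def add_pos_nonneg sum_nonneg)
    let ?D = "\<Sum>j<l. a j * v $ j"
    have zero: "(0::complex) \<cdot>\<^sub>v v = 0\<^sub>v l" using v by auto
    have bound: "cmod ((f (h \<cdot>\<^sub>v v) - f (0\<^sub>v l)) / h - ?D) \<le> C * B ^ 2 * cmod h"
      if h: "h \<noteq> 0" "cmod h * B \<le> R" for h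
    proof -
      have "h \<cdot>\<^sub>v v \<in> closed_polydisc l (cmod h * B)"
        using v B by (auto simp: closed_polydisc_def norm_mult intro: mult_left_mono)
      then have "cmod (f (h \<cdot>\<^sub>v v) - f (0\<^sub>v l) - (\<Sum>j<l. a j * (h \<cdot>\<^sub>v v) $ j)) \<le> C * (cmod h * B) ^ 2"
        using h B0 by (intro *) auto
      also have "(\<Sum>j<l. a j * (h \<cdot>\<^sub>v v) $ j) = h * ?D"
        using v by (simp add: sum_distrib_left mult_ac)
      finally have "cmod (f (h \<cdot>\<^sub>v v) - f (0\<^sub>v l) - h * ?D) / cmod h \<le> C * (cmod h * B) ^ 2 / cmod h"
        by (rule divide_right_mono) simp
      also have "C * (cmod h * B) ^ 2 / cmod h = C * B ^ 2 * cmod h"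
        using h by (simp add: power2_eq_square)
      also have "cmod (f (h \<cdot>\<^sub>v v) - f (0\<^sub>v l) - h * ?D) / cmod h = cmod ((f (h \<cdot>\<^sub>v v) - f (0\<^sub>v l)) / h - ?D)"
        using h by (simp add: norm_divide [symmetric] diff_divide_distrib)
      finally show ?thesis .
    qed
    have "((\<lambda>h. (f (h \<cdot>\<^sub>v v) - f (0\<^sub>v l)) / h - ?D) \<longlongrightarrow> 0) (at 0)"
    proof (rule tendsto_0_le[where K = 1])
      show "((\<lambda>h::complex. C * B ^ 2 * cmod h) \<longlongrightarrow> 0) (at 0)"
        by (intro tendsto_mult_right_zero tendsto_norm_zero tendsto_ident_at)
      have "\<forall>\<^sub>F h in at (0::complex). cmod h * B < R"
      proof (rule order_tendstoD(2)[OF _ \<open>R > 0\<close>])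
        show "((\<lambda>h::complex. cmod h * B) \<longlongrightarrow> 0) (at 0)"
          by (intro tendsto_mult_left_zero tendsto_norm_zero tendsto_ident_at)
      qed
      then have "\<forall>\<^sub>F h in at 0. cmod ((f (h \<cdot>\<^sub>v v) - f (0\<^sub>v l)) / h - ?D) \<le> C * B ^ 2 * cmod h"
        using eventually_neq_at_within[of 0] by eventually_elim (use bound in auto)
      then show "\<forall>\<^sub>F h in at 0. cmod ((f (h \<cdot>\<^sub>v v) - f (0\<^sub>v l)) / h - ?D) \<le> norm (C * B ^ 2 * cmod h) * 1"
        using R B0 by (simp add: abs_mult)
    qed
    then show ?thesis
      unfolding has_field_derivative_iff by (simp add: LIM_zero_iff zero)
  qed
  then show ?thesis by (rule that)
qed

lemma power_series_at_lipschitz: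
  assumes "power_series_at l f (0\<^sub>v l)"
  obtains C R where "R > 0" "C \<ge> 0"
    "\<And>t z. 0 < t \<Longrightarrow> t \<le> R \<Longrightarrow> z \<in> closed_polydisc l t \<Longrightarrow> cmod (f z - f (0\<^sub>v l)) \<le> C * t"
proof -
  obtain R c s where R: "R > 0" and h: "has_abs_series l R c s (\<lambda>z. f z - f (0\<^sub>v l))"
    using power_series_at_imp_has_abs_series[OF power_series_at_diff_const[OF assms]] .
  define N where "N = max s 0"
  have N: "abs_series l R N (\<lambda>z. f z - f (0\<^sub>v l))" "N \<ge> 0"
    using h unfolding abs_series_def N_def by (meson max.cobounded1, simp)
  have "cmod (f z - f (0\<^sub>v l)) \<le> N / R * t" if t: "0 < t" "t \<le> R" and z: "z \<in> closed_polydisc l t" for t z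
  proof -
    have "abs_series l (t / R * R) (t / R * N) (\<lambda>z. f z - f (0\<^sub>v l))"
      using R t by (intro abs_series_shrink[OF N(1)]) auto
    then show ?thesis
      using abs_series_norm_le[of l t "t / R * N" _ z] R z by (simp add: mult_ac)
  qed
  then show ?thesis using that[of R "N / R"] R N by auto
qed

text \<open>A chain rule resting on the Lipschitz bound of \<open>f\<close> at the origin: the inner
  functions are o(h), hence so is the increment of \<open>f\<close>.\<close>

lemma power_series_at_stationary:
  assumes f: "power_series_at m f (0\<^sub>v m)"
    and \<psi>: "\<And>i. i < m \<Longrightarrow> (\<psi> i has_field_derivative 0) (at 0)" "\<And>i. i < m \<Longrightarrow> \<psi> i 0 = 0"
  shows "((\<lambda>t::complex. f (vec m (\<lambda>i. \<psi> i t))) has_field_derivative 0) (at 0)"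
proof -
  obtain C R where R: "R > 0" "C \<ge> 0" and
    *: "\<And>t z. 0 < t \<Longrightarrow> t \<le> R \<Longrightarrow> z \<in> closed_polydisc m t \<Longrightarrow> cmod (f z - f (0\<^sub>v m)) \<le> C * t"
    using power_series_at_lipschitz[OF f] by metis
  have zero: "vec m (\<lambda>i. \<psi> i 0) = 0\<^sub>v m" using \<psi>(2) by (intro eq_vecI) auto
  have "\<forall>\<^sub>F h in at 0. cmod ((f (vec m (\<lambda>i. \<psi> i h)) - f (0\<^sub>v m)) / h) < e" if e: "e > 0" for e
  proof -
    \<comment> \<open>The denominator C + 1 excludes division by 0 and makes C d < e strict.\<close>
    define d where "d = e / (C + 1)"
    have d: "d > 0" "C * d < e" using R e by (auto simp: d_def field_simps)
    have "\<forall>\<^sub>F h in at 0. cmod (\<psi> i h) < d * cmod h" if i: "i < m" for i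
    proof -
      have "((\<lambda>h. \<psi> i h / h) \<longlongrightarrow> 0) (at 0)"
        using \<psi>(1)[OF i] \<psi>(2)[OF i] unfolding has_field_derivative_iff by simp
      then have "\<forall>\<^sub>F h in at 0. cmod (\<psi> i h / h) < d"
        using tendstoD[of "\<lambda>h. \<psi> i h / h" 0 "at 0" d] d by simp
      then show ?thesis
        using eventually_neq_at_within[of 0]
        by eventually_elim (simp add: norm_divide divide_less_eq)
    qed
    then have "\<forall>\<^sub>F h in at 0. \<forall>i\<in>{..<m}. cmod (\<psi> i h) < d * cmod h"
      by (intro eventually_ball_finite) auto
    moreover have "\<forall>\<^sub>F h in at (0::complex). d * cmod h < R"
    proof (rule order_tendstoD(2)[OF _ \<open>R > 0\<close>])
      show "((\<lambda>h::complex. d * cmod h) \<longlongrightarrow> 0) (at 0)"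
        by (intro tendsto_mult_right_zero tendsto_norm_zero tendsto_ident_at)
    qed
    moreover have "\<forall>\<^sub>F h in at (0::complex). h \<noteq> 0" by (rule eventually_neq_at_within)
    ultimately show ?thesis
    proof eventually_elim
      case (elim h)
      have "cmod (f (vec m (\<lambda>i. \<psi> i h)) - f (0\<^sub>v m)) \<le> C * (d * cmod h)"
        using elim d by (intro *) (auto simp: closed_polydisc_def intro: less_imp_le)
      then have "cmod ((f (vec m (\<lambda>i. \<psi> i h)) - f (0\<^sub>v m)) / h) \<le> C * d"
        using elim by (simp add: norm_divide divide_le_eq mult_ac)
      then show ?case using d by linarith
    qed
  qed
  then have "((\<lambda>h. (f (vec m (\<lambda>i. \<psi> i h)) - f (0\<^sub>v m)) / h) \<longlongrightarrow> 0) (at 0)"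
    by (intro tendstoI) simp
  then show ?thesis unfolding has_field_derivative_iff by (simp add: zero)
qed

lemma num_params_le_of_versal:
  assumes P: "skew_pair n P"
    and compl: "complements (upper_positions n) (range (congruence_action n (pair_entry P))) (star_positions n D)"
    and F: "versal n m P F"
  shows "num_params n D \<le> m"
proof (rule ccontr)
  let ?N = "num_params n D" and ?A = "pair_entry P"
  assume "\<not> ?N \<le> m"
  then have m: "m < ?N" by simp
  \<comment> \<open>Versality of \<open>F\<close> is tested on the linear star family itself, which
    has more parameters than \<open>F\<close>.\<close>
  have "deformation n ?N P (\<lambda>\<epsilon>. add_pair P (star_pair_sum n D \<epsilon>))"
    by (rule deformation_add_star_pair_sum[OF P])
  from F[unfolded versal_def, THEN conjunct2, rule_format, OF this] obtain M \<phi> V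
    where M: "identity_deformation n ?N M"
    and \<phi>': "\<forall>i<m. power_series_at ?N (\<phi> i) (0\<^sub>v ?N) \<and> \<phi> i (0\<^sub>v ?N) = 0"
    and V: "open_nbhd0 ?N V" and eq: "\<forall>\<sigma>\<in>V. add_pair P (star_pair_sum n D \<sigma>) =
       mult_pair (transpose_mat (M \<sigma>)) (F (vec m (\<lambda>i. \<phi> i \<sigma>))) (M \<sigma>)"
    by (elim exE conjE) (rule that)
  have \<phi>: "\<And>i. i < m \<Longrightarrow> power_series_at ?N (\<phi> i) (0\<^sub>v ?N)" "\<And>i. i < m \<Longrightarrow> \<phi> i (0\<^sub>v ?N) = 0"
    using \<phi>' by simp_all
  have F': "deformation n m P F" using F unfolding versal_def by blast
  have "\<exists>a. \<forall>v\<in>carrier_vec ?N. ((\<lambda>t. \<phi> i (t \<cdot>\<^sub>v v)) has_field_derivative (\<Sum>j<?N. a j * v $ j)) (at 0)"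
    if "i < m" for i
    using power_series_at_line_derivative[OF \<phi>(1)[OF that]] by metis
  then obtain a where a: "\<And>i v. i < m \<Longrightarrow> v \<in> carrier_vec ?N \<Longrightarrow>
      ((\<lambda>t. \<phi> i (t \<cdot>\<^sub>v v)) has_field_derivative (\<Sum>j<?N. a i j * v $ j)) (at 0)"
    by metis
  \<comment> \<open>The linear part of \<phi> is an m by N matrix with m < N, so it annihilates some
    direction \<open>v\<close>.\<close>
  obtain v where v: "v \<in> carrier_vec ?N" "v \<noteq> 0\<^sub>v ?N" "\<And>i. i < m \<Longrightarrow> (\<Sum>j<?N. a i j * v $ j) = 0"
    using homogeneous_system_solution[OF m, of a] by metis
  have tv: "t \<cdot>\<^sub>v v \<in> carrier_vec ?N" for t using v by simp
  have zero: "(0::complex) \<cdot>\<^sub>v v = 0\<^sub>v ?N" using v by auto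
  obtain U where U: "open_nbhd0 ?N U" "holomorphic_mat n ?N M U" and M0: "M (0\<^sub>v ?N) = 1\<^sub>m n"
    using M unfolding identity_deformation_def by blast
  have Mp: "power_series_at ?N (\<lambda>\<sigma>. M \<sigma> $$ (i, j)) (0\<^sub>v ?N)" if "i < n" "j < n" for i j
    using U that by (auto simp: holomorphic_mat_def holomorphic_params_def open_nbhd0_def)
  have "\<exists>x. ((\<lambda>t. M (t \<cdot>\<^sub>v v) $$ (i, j)) has_field_derivative x) (at 0)" if "i < n" "j < n" for i j
    using power_series_at_line_derivative[OF Mp[OF that]] v(1) by metis
  then obtain X where X: "\<And>i j. i < n \<Longrightarrow> j < n \<Longrightarrow>
      ((\<lambda>t. M (t \<cdot>\<^sub>v v) $$ (i, j)) has_field_derivative X i j) (at 0)"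
    by metis
  define Q where "Q t = F (vec m (\<lambda>i. \<phi> i (t \<cdot>\<^sub>v v)))" for t
  have Q0: "Q 0 = P"
  proof -
    have "vec m (\<lambda>i. \<phi> i (0 \<cdot>\<^sub>v v)) = 0\<^sub>v m" unfolding zero using \<phi>(2) by (intro eq_vecI) auto
    then show ?thesis using F' unfolding Q_def deformation_def by simp
  qed
  \<comment> \<open>Along this line \<open>F\<close> is stationary at t = 0, and only the factors
    \<open>M\<close> contribute to the derivative of the congruence.\<close>
  have Q: "((\<lambda>t. pair_entry (Q t) c i j) has_field_derivative 0) (at 0)" if ij: "i < n" "j < n" for c i j
    unfolding Q_def
  proof (rule power_series_at_stationary[OF deformation_power_series[OF F' ij]])
    show "((\<lambda>t. \<phi> k (t \<cdot>\<^sub>v v)) has_field_derivative 0) (at 0)" if "k < m" for k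
      using a[OF that v(1)] v(3)[OF that] by simp
    show "\<phi> k (0 \<cdot>\<^sub>v v) = 0" if "k < m" for k
      unfolding zero using \<phi>(2)[OF that] .
  qed
  obtain r where r: "r > 0" "polydisc ?N (0\<^sub>v ?N) r \<subseteq> V"
    using open_nbhd0_contains_polydisc[OF V] .
  obtain U' where U': "open_nbhd0 m U'" "\<And>\<delta>. \<delta> \<in> U' \<Longrightarrow> skew_pair n (F \<delta>)"
    using F' unfolding deformation_def by blast
  obtain r' where r': "r' > 0" "polydisc m (0\<^sub>v m) r' \<subseteq> U'"
    using open_nbhd0_contains_polydisc[OF U'(1)] .
  obtain r'' where r'': "r'' > 0" "polydisc ?N (0\<^sub>v ?N) r'' \<subseteq> U"
    using open_nbhd0_contains_polydisc[OF U(1)] .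
  have small: "\<forall>\<^sub>F t in nhds 0. t \<cdot>\<^sub>v v \<in> polydisc ?N (0\<^sub>v ?N) e" if "e > 0" for e
  proof -
    have "\<forall>\<^sub>F t in nhds 0. \<forall>i\<in>{..<?N}. cmod (t * v $ i) < e"
    proof (intro eventually_ball_finite ballI)
      fix i
      have "((\<lambda>t. cmod (t * v $ i)) \<longlongrightarrow> cmod (0 * v $ i)) (nhds 0)"
        by (intro tendsto_intros filterlim_ident)
      then show "\<forall>\<^sub>F t in nhds 0. cmod (t * v $ i) < e"
        using that by (intro order_tendstoD(2)) auto
    qed simp
    then show ?thesis by eventually_elim (use v(1) in \<open>auto simp: polydisc_def\<close>)
  qed
  have small': "\<forall>\<^sub>F t in nhds 0. vec m (\<lambda>i. \<phi> i (t \<cdot>\<^sub>v v)) \<in> polydisc m (0\<^sub>v m) r'"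
  proof -
    have "\<forall>\<^sub>F t in nhds 0. \<forall>i\<in>{..<m}. cmod (\<phi> i (t \<cdot>\<^sub>v v)) < r'"
    proof (intro eventually_ball_finite ballI)
      fix i assume i: "i \<in> {..<m}"
      have "isCont (\<lambda>t. \<phi> i (t \<cdot>\<^sub>v v)) 0" using a[OF _ v(1)] i by (auto intro: DERIV_isCont)
      then have "((\<lambda>t. \<phi> i (t \<cdot>\<^sub>v v)) \<longlongrightarrow> 0) (nhds 0)"
        using \<phi>(2) i by (simp add: isCont_def tendsto_nhds_iff zero)
      from tendsto_norm[OF this] show "\<forall>\<^sub>F t in nhds 0. cmod (\<phi> i (t \<cdot>\<^sub>v v)) < r'"
        using r'(1) by (intro order_tendstoD(2)) auto
    qed simp
    then show ?thesis by eventually_elim (auto simp: polydisc_def)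
  qed
  define B where "B c i j = (\<Sum>s<?N. v $ s * star_basis n D s c i j)" for c i j
  have B: "B c i j = congruence_action n ?A X (c, i, j)" if ij: "i < n" "j < n" for c i j
  proof -
    \<comment> \<open>The two deformations agree for small \<open>t\<close> only, so their
      derivatives are compared through an equality that holds eventually near 0.\<close>
    have ev: "\<forall>\<^sub>F t in nhds 0. (\<Sum>a<n. \<Sum>b<n. M (t \<cdot>\<^sub>v v) $$ (a, i) * pair_entry (Q t) c a b * M (t \<cdot>\<^sub>v v) $$ (b, j)) =
        ?A c i j + t * B c i j"
      using small[OF r(1)] small[OF r''(1)] small'
    proof eventually_elim
      case (elim t)
      have Qt: "skew_pair n (Q t)" using elim r' U' unfolding Q_def by blast
      have Mt: "M (t \<cdot>\<^sub>v v) \<in> carrier_mat n n" using elim r'' U(2) by (auto simp: holomorphic_mat_def)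
      have "pair_entry (add_pair P (star_pair_sum n D (t \<cdot>\<^sub>v v))) c i j =
          pair_entry (mult_pair (transpose_mat (M (t \<cdot>\<^sub>v v))) (Q t) (M (t \<cdot>\<^sub>v v))) c i j"
        using eq[rule_format, of "t \<cdot>\<^sub>v v"] subsetD[OF r(2) elim(1)] unfolding Q_def by simp
      moreover have "pair_entry (add_pair P (star_pair_sum n D (t \<cdot>\<^sub>v v))) c i j = ?A c i j + t * B c i j"
        using ij v(1) tv
        by (simp add: pair_entry_add_pair[of _ n] pair_entry_star_pair_sum B_def sum_distrib_left mult_ac)
      ultimately show ?case
        unfolding pair_entry_mult_pair[OF Mt skew_pairD(1,2)[OF Qt] ij] by simp
    qed
    have deriv: "((\<lambda>t. \<Sum>a<n. \<Sum>b<n. M (t \<cdot>\<^sub>v v) $$ (a, i) * pair_entry (Q t) c a b * M (t \<cdot>\<^sub>v v) $$ (b, j))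
        has_field_derivative (\<Sum>a<n. \<Sum>b<n. X a i * ?A c a b * (if b = j then 1 else 0) +
            (if a = i then 1 else 0) * ?A c a b * X b j)) (at 0)"
    proof (intro DERIV_sum)
      fix a b assume ab: "a \<in> {..<n}" "b \<in> {..<n}"
      have *: "M (0 \<cdot>\<^sub>v v) $$ (a, i) = (if a = i then 1 else 0)" "M (0 \<cdot>\<^sub>v v) $$ (b, j) = (if b = j then 1 else 0)"
        unfolding zero M0 using ab ij by auto
      have D: "((\<lambda>t. M (t \<cdot>\<^sub>v v) $$ (a, i) * pair_entry (Q t) c a b * M (t \<cdot>\<^sub>v v) $$ (b, j)) has_field_derivative
          (X a i * pair_entry (Q 0) c a b + 0 * M (0 \<cdot>\<^sub>v v) $$ (a, i)) * M (0 \<cdot>\<^sub>v v) $$ (b, j) +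
           X b j * (M (0 \<cdot>\<^sub>v v) $$ (a, i) * pair_entry (Q 0) c a b)) (at 0)"
        using ab ij by (intro DERIV_mult X Q) auto
      show "((\<lambda>t. M (t \<cdot>\<^sub>v v) $$ (a, i) * pair_entry (Q t) c a b * M (t \<cdot>\<^sub>v v) $$ (b, j)) has_field_derivative
          X a i * ?A c a b * (if b = j then 1 else 0) + (if a = i then 1 else 0) * ?A c a b * X b j) (at 0)"
        by (rule DERIV_cong[OF D]) (simp add: * Q0)
    qed
    have "((\<lambda>t. ?A c i j + t * B c i j) has_field_derivative
        (\<Sum>a<n. \<Sum>b<n. X a i * ?A c a b * (if b = j then 1 else 0) +
            (if a = i then 1 else 0) * ?A c a b * X b j)) (at 0)"
      using DERIV_cong_ev[OF refl ev refl] deriv by (rule iffD1)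
    moreover have "((\<lambda>t. ?A c i j + t * B c i j) has_field_derivative B c i j) (at 0)"
      by (auto intro!: derivative_eq_intros)
    ultimately have "B c i j = (\<Sum>a<n. \<Sum>b<n. X a i * ?A c a b * (if b = j then 1 else 0) +
            (if a = i then 1 else 0) * ?A c a b * X b j)"
      using DERIV_unique by blast
    also have "\<dots> = (\<Sum>a<n. \<Sum>b<n. (if b = j then X a i * ?A c a b else 0)) +
        (\<Sum>a<n. \<Sum>b<n. (if a = i then ?A c a b * X b j else 0))"
      unfolding sum.distrib [symmetric] by (intro sum.cong refl) auto
    also have "(\<Sum>a<n. \<Sum>b<n. (if a = i then ?A c a b * X b j else 0)) =
        (\<Sum>b<n. \<Sum>a<n. (if a = i then ?A c a b * X b j else 0))"
      by (rule sum.swap)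
    finally show ?thesis using ij by (simp add: congruence_action_def)
  qed
  \<comment> \<open>Covers both kinds of positions: at a star, \<open>s\<close> must be its number
    and \<open>v $ s\<close> is read off; elsewhere any \<open>s\<close> will do and the value is
    0.\<close>
  have Bpos: "B c i j = (if (c, i, j) = star_position n D s then v $ s else 0)"
    if "(c, i, j) \<in> upper_positions n" "s < ?N" "(c, i, j) \<in> star_positions n D \<longrightarrow> (c, i, j) = star_position n D s"
    for c i j s
  proof -
    have "B c i j = (\<Sum>s'<?N. if s' = s then (if (c, i, j) = star_position n D s then v $ s else 0) else 0)"
      unfolding B_def
    proof (rule sum.cong[OF refl])
      fix s' assume s': "s' \<in> {..<?N}"
      have "star_position n D s' = (c, i, j) \<longleftrightarrow> s' = s \<and> (c, i, j) = star_position n D s"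
        using that s' bij_betw_star_position[of n D] unfolding bij_betw_def inj_on_def
        by (metis imageI lessThan_iff)
      then show "v $ s' * star_basis n D s' c i j =
          (if s' = s then (if (c, i, j) = star_position n D s then v $ s else 0) else 0)"
        using star_basis_upper[OF that(1), of s' D] s' by auto
    qed
    then show ?thesis using that(2) by simp
  qed
  \<comment> \<open>The direction \<open>B\<close> is tangent to the orbit and vanishes off the
    stars. Trivial intersection makes it vanish everywhere, and its values at the stars are the
    coordinates of \<open>v\<close>.\<close>
  have "\<forall>p\<in>upper_positions n - star_positions n D. congruence_action n ?A X p = 0"
  proof
    fix p assume p: "p \<in> upper_positions n - star_positions n D"
    obtain c i j where cij: "p = (c, i, j)" by (cases p)
    have "i < n" "j < n" using p cij by (auto simp: upper_positions_def)
    moreover have "B c i j = 0"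
      using Bpos[of c i j 0] p cij m bij_betw_star_position[of n D] unfolding bij_betw_def by force
    ultimately show "congruence_action n ?A X p = 0" using B cij by metis
  qed
  then have X0: "\<And>p. p \<in> upper_positions n \<Longrightarrow> congruence_action n ?A X p = 0"
    using compl unfolding complements_def by blast
  have "v $ s = 0" if s: "s < ?N" for s
  proof -
    obtain c i j where cij: "star_position n D s = (c, i, j)" by (cases "star_position n D s")
    have up: "(c, i, j) \<in> upper_positions n" using star_position_upper[OF s] cij by simp
    then have "i < n" "j < n" by (auto simp: upper_positions_def)
    then have "B c i j = 0" using B X0[OF up] by metis
    then show ?thesis using Bpos[OF up s] cij by simp
  qed
  then have "v = 0\<^sub>v ?N" using v(1) by (intro eq_vecI) auto
  then show False using v(2) by simp
qed

lemma simplest_miniversal_of_complements: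
  assumes "skew_pair n P" "star_symmetric n (fst D)" "star_symmetric n (snd D)"
    and "complements (upper_positions n) (range (congruence_action n (pair_entry P))) (star_positions n D)"
  shows "simplest_miniversal n P D"
  unfolding simplest_miniversal_def miniversal_def
  using assms versal_add_star_pair_sum[OF assms(1,4)] num_params_le_of_versal[OF assms(1,4)] leD by blast

section \<open>Complements of block tangent spaces\<close>

lemma complementsI:
  assumes "\<And>u. \<exists>t\<in>T. \<forall>i\<in>I - S. t i = u i"
    and "\<And>t i. t \<in> T \<Longrightarrow> (\<And>i. i \<in> I \<Longrightarrow> i \<notin> S \<Longrightarrow> t i = 0) \<Longrightarrow> i \<in> I \<Longrightarrow> t i = 0"
  shows "complements I T S"
  unfolding complements_def using assms by (metis DiffI)

lemma complementsD1:
  assumes "complements I T S"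
  obtains t where "t \<in> T" "\<And>i. i \<in> I \<Longrightarrow> i \<notin> S \<Longrightarrow> t i = u i"
  using assms unfolding complements_def by (metis DiffI)

lemma complementsD2:
  assumes "complements I T S" "t \<in> T" "\<And>i. i \<in> I \<Longrightarrow> i \<notin> S \<Longrightarrow> t i = 0" "i \<in> I"
  shows "t i = 0"
  using assms unfolding complements_def by (metis DiffE)

lemma complements_cong:
  "complements I T S \<Longrightarrow> (\<And>i. i \<in> I \<Longrightarrow> i \<in> S \<longleftrightarrow> i \<in> S') \<Longrightarrow> complements I T S'"
  unfolding complements_def by (metis DiffE DiffI)

lemma complements_onto:
  assumes "\<And>u. \<exists>t\<in>T. \<forall>i\<in>I. t i = u i"
  shows "complements I T {}"
  by (rule complementsI) (use assms in auto)

lemma complements_glue: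
  assumes cover: "\<And>i. i \<in> I \<Longrightarrow> \<exists>k\<in>K. \<exists>j\<in>J k. i = \<iota> k j"
    and into: "\<And>k j. k \<in> K \<Longrightarrow> j \<in> J k \<Longrightarrow> \<iota> k j \<in> I"
    and stars: "\<And>k j. k \<in> K \<Longrightarrow> j \<in> J k \<Longrightarrow> \<iota> k j \<in> S \<longleftrightarrow> j \<in> S' k"
    and restrict: "\<And>t k. t \<in> T \<Longrightarrow> k \<in> K \<Longrightarrow> \<exists>t'\<in>T' k. \<forall>j\<in>J k. t (\<iota> k j) = t' j"
    and glue: "\<And>t'. (\<And>k. k \<in> K \<Longrightarrow> t' k \<in> T' k) \<Longrightarrow> \<exists>t\<in>T. \<forall>k\<in>K. \<forall>j\<in>J k. t (\<iota> k j) = t' k j"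
    and sub: "\<And>k. k \<in> K \<Longrightarrow> complements (J k) (T' k) (S' k)"
  shows "complements I T S"
proof (rule complementsI)
  fix u
  have "\<exists>t. t \<in> T' k \<and> (\<forall>j\<in>J k - S' k. t j = u (\<iota> k j))" if "k \<in> K" for k
    using complementsD1[OF sub[OF that], of "\<lambda>j. u (\<iota> k j)"] by (metis DiffE)
  then obtain t' where t': "\<And>k. k \<in> K \<Longrightarrow> t' k \<in> T' k"
      "\<And>k. k \<in> K \<Longrightarrow> \<forall>j\<in>J k - S' k. t' k j = u (\<iota> k j)"
    by metis
  obtain t where t: "t \<in> T" "\<forall>k\<in>K. \<forall>j\<in>J k. t (\<iota> k j) = t' k j"
    using glue[of t'] t'(1) by blast
  have "t i = u i" if i: "i \<in> I - S" for i
  proof -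
    obtain k j where kj: "k \<in> K" "j \<in> J k" "i = \<iota> k j" using cover i by blast
    then have "j \<notin> S' k" using stars[OF kj(1,2)] i by simp
    then show ?thesis using t(2) t'(2) kj by simp
  qed
  then show "\<exists>t\<in>T. \<forall>i\<in>I - S. t i = u i" using t(1) by blast
next
  fix t i assume t: "t \<in> T" "\<And>i. i \<in> I \<Longrightarrow> i \<notin> S \<Longrightarrow> t i = 0" and i: "i \<in> I"
  obtain k j where kj: "k \<in> K" "j \<in> J k" "i = \<iota> k j" using cover[OF i] by blast
  obtain t' where t': "t' \<in> T' k" "\<forall>j\<in>J k. t (\<iota> k j) = t' j" using restrict[OF t(1) kj(1)] by blast
  have "t' j = 0"
    by (rule complementsD2[OF sub[OF kj(1)] t'(1) _ kj(2)]) (use t t' stars[OF kj(1)] into[OF kj(1)] in metis)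
  then show "t i = 0" using t' kj by simp
qed

lemma complements_reindex:
  assumes bij: "bij_betw \<iota> J I"
    and stars: "\<And>j. j \<in> J \<Longrightarrow> \<iota> j \<in> S \<longleftrightarrow> j \<in> S'"
    and T: "\<And>t. t \<in> T \<Longrightarrow> \<exists>t'\<in>T'. \<forall>j\<in>J. t (\<iota> j) = t' j"
    and T': "\<And>t'. t' \<in> T' \<Longrightarrow> \<exists>t\<in>T. \<forall>j\<in>J. t (\<iota> j) = t' j"
    and sub: "complements J T' S'"
  shows "complements I T S"
proof (rule complements_glue[where K = "{()}" and J = "\<lambda>_. J" and \<iota> = "\<lambda>_. \<iota>" and T' = "\<lambda>_. T'" and S' = "\<lambda>_. S'"])
  show "\<exists>k\<in>{()}. \<exists>j\<in>J. i = \<iota> j" if "i \<in> I" for i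
    using bij that unfolding bij_betw_def by blast
  show "\<iota> j \<in> I" if "j \<in> J" for j using bij that unfolding bij_betw_def by blast
  show "\<exists>t\<in>T. \<forall>k\<in>{()}. \<forall>j\<in>J. t (\<iota> j) = t' k j" if "\<And>k. k \<in> {()} \<Longrightarrow> t' k \<in> T'" for t'
    using T'[OF that] by simp
qed (use stars T sub in auto)

text \<open>The linear systems for the blocks are triangular, so a solution is a function defined by
  recursion on its entries. It is obtained on all indices, also outside the block, and each use
  fixes the direction of solving by its measure \<mu>.\<close>

lemma recursion_solvable:
  fixes \<mu> :: "'a \<Rightarrow> nat" and G :: "('a \<Rightarrow> 'b) \<Rightarrow> 'a \<Rightarrow> 'b"
  assumes "\<And>f g x. (\<And>y. \<mu> y < \<mu> x \<Longrightarrow> f y = g y) \<Longrightarrow> G f x = G g x"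
  obtains f where "\<And>x. f x = G f x"
proof -
  define f where "f = wfrec (measure \<mu>) G"
  have "f x = G f x" for x
  proof -
    have "f x = G (cut f (measure \<mu>) x) x"
      unfolding f_def by (rule wfrec) simp
    also have "\<dots> = G f x" by (rule assms) (simp add: cut_apply)
    finally show ?thesis .
  qed
  then show ?thesis by (rule that)
qed

lemma recursion_solvable2:
  fixes \<mu> :: "nat \<Rightarrow> nat \<Rightarrow> nat" and G :: "(nat \<Rightarrow> nat \<Rightarrow> 'b) \<Rightarrow> nat \<Rightarrow> nat \<Rightarrow> 'b"
  assumes "\<And>f g i j. (\<And>i' j'. \<mu> i' j' < \<mu> i j \<Longrightarrow> f i' j' = g i' j') \<Longrightarrow> G f i j = G g i j"
  obtains f where "\<And>i j. f i j = G f i j"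
proof (rule recursion_solvable[of "\<lambda>(i, j). \<mu> i j" "\<lambda>f (i, j). G (\<lambda>i j. f (i, j)) i j"])
  fix f g :: "nat \<times> nat \<Rightarrow> 'b" and x
  assume *: "\<And>y. (case y of (i, j) \<Rightarrow> \<mu> i j) < (case x of (i, j) \<Rightarrow> \<mu> i j) \<Longrightarrow> f y = g y"
  show "(case x of (i, j) \<Rightarrow> G (\<lambda>i j. f (i, j)) i j) = (case x of (i, j) \<Rightarrow> G (\<lambda>i j. g (i, j)) i j)"
    by (cases x) (use * in \<open>auto intro!: assms\<close>)
next
  fix f assume *: "\<And>x. f x = (case x of (i, j) \<Rightarrow> G (\<lambda>i j. f (i, j)) i j)"
  show thesis
    by (rule that[of "\<lambda>i j. f (i, j)"]) (rule *[of "(_, _)", unfolded prod.case])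
qed

section \<open>Shift matrices, pencils and elimination of one unknown\<close>

definition idm :: "nat \<Rightarrow> nat \<Rightarrow> complex" where
  "idm i j = (if i = j then 1 else 0)"

text \<open>Like \<open>idm\<close> an infinite matrix; sizes enter through ranges of summation and
  index sets. Thus \<open>idm\<close> serves for I_n and F_n, and \<open>upm\<close> for J_n(0) and
  G_n.\<close>

definition upm :: "nat \<Rightarrow> nat \<Rightarrow> complex" where
  "upm i j = (if j = Suc i then 1 else 0)"

lemma sum_idm [simp]:
  "(\<Sum>k<a. f k * idm k j) = (if j < a then f j else 0)"
  "(\<Sum>k<a. f k * idm j k) = (if j < a then f j else 0)"
  "(\<Sum>k<a. idm k j * f k) = (if j < a then f j else 0)"
  "(\<Sum>k<a. idm j k * f k) = (if j < a then f j else 0)"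
  by (simp_all add: idm_def if_distrib[of "\<lambda>x. _ * x"] if_distrib[of "\<lambda>x. x * _"] cong: if_cong)

lemma sum_upm [simp]:
  "(\<Sum>k<a. f k * upm j k) = (if Suc j < a then f (Suc j) else 0)"
  "(\<Sum>k<a. upm j k * f k) = (if Suc j < a then f (Suc j) else 0)"
  "(\<Sum>k<a. f k * upm k j) = (if 0 < j \<and> j \<le> a then f (j - 1) else 0)"
  "(\<Sum>k<a. upm k j * f k) = (if 0 < j \<and> j \<le> a then f (j - 1) else 0)"
proof -
  show "(\<Sum>k<a. f k * upm j k) = (if Suc j < a then f (Suc j) else 0)" for f
    by (simp add: upm_def if_distrib[of "\<lambda>x. _ * x"] cong: if_cong)
  then show "(\<Sum>k<a. upm j k * f k) = (if Suc j < a then f (Suc j) else 0)"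
    by (simp add: mult.commute)
  show "(\<Sum>k<a. f k * upm k j) = (if 0 < j \<and> j \<le> a then f (j - 1) else 0)" for f
    by (cases j) (simp_all add: upm_def if_distrib[of "\<lambda>x. _ * x"] less_eq_Suc_le cong: if_cong)
  then show "(\<Sum>k<a. upm k j * f k) = (if 0 < j \<and> j \<le> a then f (j - 1) else 0)"
    by (simp add: mult.commute)
qed

text \<open>The matrices of a summand have the form \<open>[0, N; - N\<^sup>T, 0]\<close>. A Boolean selects one of the two
  halves of its index range, \<open>False\<close> the rows and \<open>True\<close> the columns of \<open>N\<close>; the nonzero block in the
  rows of a half is, up to sign, the pencil \<open>N\<close> or \<open>N\<^sup>T\<close> oriented accordingly.\<close>

fun part :: "summand \<Rightarrow> bool \<Rightarrow> nat" where
  "part (Hpair n \<mu>) o' = n"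
| "part (Kpair n) o' = n"
| "part (Lpair n) o' = (if o' then Suc n else n)"

fun pencil :: "summand \<Rightarrow> bool \<Rightarrow> nat \<Rightarrow> nat \<Rightarrow> complex" where
  "pencil (Hpair n \<mu>) c i j = (if c then \<mu> * idm i j + upm i j else idm i j)"
| "pencil (Kpair n) c i j = (if c then idm i j else upm i j)"
| "pencil (Lpair n) c i j = (if c then upm i j else idm i j)"

definition opencil :: "summand \<Rightarrow> bool \<Rightarrow> bool \<Rightarrow> nat \<Rightarrow> nat \<Rightarrow> complex" where
  "opencil x o' c i j = (if o' then pencil x c j i else pencil x c i j)"

definition rect_positions :: "nat \<Rightarrow> nat \<Rightarrow> (bool \<times> nat \<times> nat) set" where
  "rect_positions p q = {(c, i, j). i < p \<and> j < q}"

definition rect_action :: "nat \<Rightarrow> nat \<Rightarrow> (bool \<Rightarrow> nat \<Rightarrow> nat \<Rightarrow> complex) \<Rightarrow> (bool \<Rightarrow> nat \<Rightarrow> nat \<Rightarrow> complex) \<Rightarrow>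
    (nat \<Rightarrow> nat \<Rightarrow> complex) \<Rightarrow> (nat \<Rightarrow> nat \<Rightarrow> complex) \<Rightarrow> bool \<times> nat \<times> nat \<Rightarrow> complex" where
  "rect_action a b N M X Y = (\<lambda>(c, i, j).
     (\<Sum>k<a. X i k * M c k j) + (\<Sum>k<b. N c i k * Y k j))"

definition rect_tangent :: "nat \<Rightarrow> nat \<Rightarrow> (bool \<Rightarrow> nat \<Rightarrow> nat \<Rightarrow> complex) \<Rightarrow> (bool \<Rightarrow> nat \<Rightarrow> nat \<Rightarrow> complex) \<Rightarrow>
    (bool \<times> nat \<times> nat \<Rightarrow> complex) set" where
  "rect_tangent a b N M = {rect_action a b N M X Y | X Y. True}"

text \<open>For rows in half \<open>r\<close> of \<open>x\<close> and columns in half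
  \<open>s\<close> of \<open>y\<close>, the pencil of \<open>x\<close> has its columns in the
  opposite half of \<open>x\<close>, and the pencil of \<open>y\<close>, with columns in
  \<open>s\<close>, has its rows in the opposite half of \<open>y\<close>. Hence the negations;
  signs are absorbed in X and Y.\<close>

definition block_tangent :: "summand \<Rightarrow> bool \<Rightarrow> summand \<Rightarrow> bool \<Rightarrow> (bool \<times> nat \<times> nat \<Rightarrow> complex) set" where
  "block_tangent x r y s = rect_tangent (part y (\<not> s)) (part x (\<not> r)) (opencil x r) (opencil y (\<not> s))"

definition block_positions :: "summand \<Rightarrow> bool \<Rightarrow> summand \<Rightarrow> bool \<Rightarrow> (bool \<times> nat \<times> nat) set" where
  "block_positions x r y s = rect_positions (part x r) (part y s)"

definition grid :: "nat \<Rightarrow> nat \<Rightarrow> (nat \<times> nat) set" where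
  "grid p q = {..<p} \<times> {..<q}"

text \<open>The operator X M_1 - B X M_0 of Sylvester type that remains of the second equation once
  Y has been eliminated by the first.\<close>

definition eliminated_action :: "nat \<Rightarrow> nat \<Rightarrow> (nat \<Rightarrow> nat \<Rightarrow> complex) \<Rightarrow> (bool \<Rightarrow> nat \<Rightarrow> nat \<Rightarrow> complex) \<Rightarrow>
    (nat \<Rightarrow> nat \<Rightarrow> complex) \<Rightarrow> nat \<times> nat \<Rightarrow> complex" where
  "eliminated_action a b B M X = (\<lambda>(i, j).
     (\<Sum>k<a. X i k * M True k j) - (\<Sum>l<b. B i l * (\<Sum>k<a. X l k * M False k j)))"

text \<open>When the first left matrix is the identity, the first equation is solved for \<open>Y\<close>.\<close>

lemma complements_eliminate:
  assumes N: "\<And>i k. i < p \<Longrightarrow> k < p \<Longrightarrow> N False i k = idm i k"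
    and sub: "complements (grid p q) (range (eliminated_action a p (N True) M)) S"
  shows "complements (rect_positions p q) (rect_tangent a p N M) {(c, z). c \<and> z \<in> S}"
proof (rule complementsI)
  have F: "rect_action a p N M X Y (False, i, j) = (\<Sum>k<a. X i k * M False k j) + Y i j" if "i < p" for X Y i j
  proof -
    have "(\<Sum>k<p. N False i k * Y k j) = (\<Sum>k<p. idm i k * Y k j)"
      using N that by (intro sum.cong) auto
    then show ?thesis using that by (simp add: rect_action_def)
  qed
  have T: "rect_action a p N M X Y (True, i, j) = eliminated_action a p (N True) M X (i, j) +
      (\<Sum>k<p. N True i k * ((\<Sum>l<a. X k l * M False l j) + Y k j))" for X Y i j
    by (simp add: rect_action_def eliminated_action_def distrib_left sum.distrib)
  {
    fix u :: "bool \<times> nat \<times> nat \<Rightarrow> complex"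
    \<comment> \<open>The right side u_1 - N_1 u_0 of the second equation after substituting Y = u_0
      - X M_0.\<close>
    define w where "w = (\<lambda>(i, j). u (True, i, j) - (\<Sum>k<p. N True i k * u (False, k, j)))"
    obtain t where "t \<in> range (eliminated_action a p (N True) M)"
      and t: "\<And>z. z \<in> grid p q \<Longrightarrow> z \<notin> S \<Longrightarrow> t z = w z"
      using complementsD1[OF sub, of w] by blast
    then obtain X where X: "\<And>z. z \<in> grid p q \<Longrightarrow> z \<notin> S \<Longrightarrow> eliminated_action a p (N True) M X z = w z"
      by blast
    define Y where "Y i j = u (False, i, j) - (\<Sum>k<a. X i k * M False k j)" for i j
    have "rect_action a p N M X Y (c, i, j) = u (c, i, j)" if "i < p" "j < q" "c \<Longrightarrow> (i, j) \<notin> S" for c i j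
    proof (cases c)
      case True
      then have "eliminated_action a p (N True) M X (i, j) = w (i, j)"
        using that by (intro X) (auto simp: grid_def)
      then show ?thesis using True by (simp add: T Y_def w_def)
    next
      case False
      then show ?thesis using F[OF that(1)] by (simp add: Y_def)
    qed
    then show "\<exists>t\<in>rect_tangent a p N M. \<forall>z\<in>rect_positions p q - {(c, z). c \<and> z \<in> S}. t z = u z"
      unfolding rect_tangent_def rect_positions_def by (intro bexI[of _ "rect_action a p N M X Y"]) auto
  }
  fix t z assume t: "t \<in> rect_tangent a p N M"
    and t0: "\<And>z. z \<in> rect_positions p q \<Longrightarrow> z \<notin> {(c, z). c \<and> z \<in> S} \<Longrightarrow> t z = 0"
    and z: "z \<in> rect_positions p q"
  obtain X Y where XY: "t = rect_action a p N M X Y" using t unfolding rect_tangent_def by blast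
  have F0: "(\<Sum>k<a. X i k * M False k j) + Y i j = 0" if "i < p" "j < q" for i j
    using t0[of "(False, i, j)"] that F[OF that(1)] by (simp add: XY rect_positions_def)
  have T0: "t (True, i, j) = eliminated_action a p (N True) M X (i, j)" if "i < p" "j < q" for i j
    using that by (simp add: XY T F0)
  have "eliminated_action a p (N True) M X (i, j) = 0" if "i < p" "j < q" for i j
  proof (rule complementsD2[OF sub])
    fix z assume "z \<in> grid p q" "z \<notin> S"
    then show "eliminated_action a p (N True) M X z = 0"
      using T0[of "fst z" "snd z"] t0[of "(True, z)"] by (auto simp: grid_def rect_positions_def)
  qed (use that in \<open>auto simp: grid_def\<close>)
  then show "t z = 0"
    using z T0 t0[of z] by (cases z; cases "fst z") (auto simp: rect_positions_def)
qed

text \<open>Elimination wants the identity in the first matrix, but K has it in the second.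
  Exchanging the matrices turns K into H with eigenvalue 0.\<close>

lemma complements_swap:
  assumes "complements (rect_positions p q) (rect_tangent a b (\<lambda>c. N (\<not> c)) (\<lambda>c. M (\<not> c))) S"
  shows "complements (rect_positions p q) (rect_tangent a b N M) {(c, z). (\<not> c, z) \<in> S}"
proof (rule complements_reindex[OF _ _ _ _ assms, where \<iota> = "\<lambda>(c, z). (\<not> c, z)"])
  show "bij_betw (\<lambda>(c, z). (\<not> c, z)) (rect_positions p q) (rect_positions p q)"
    by (rule bij_betw_byWitness[where f' = "\<lambda>(c, z). (\<not> c, z)"]) (auto simp: rect_positions_def)
  have *: "rect_action a b N M X Y ((\<lambda>(c, z). (\<not> c, z)) v) =
      rect_action a b (\<lambda>c. N (\<not> c)) (\<lambda>c. M (\<not> c)) X Y v" for X Y v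
    by (cases v) (simp add: rect_action_def)
  show "\<exists>t'\<in>rect_tangent a b (\<lambda>c. N (\<not> c)) (\<lambda>c. M (\<not> c)).
      \<forall>v\<in>rect_positions p q. t ((\<lambda>(c, z). (\<not> c, z)) v) = t' v" if "t \<in> rect_tangent a b N M" for t
    using that * unfolding rect_tangent_def by blast
  show "\<exists>t\<in>rect_tangent a b N M. \<forall>v\<in>rect_positions p q. t ((\<lambda>(c, z). (\<not> c, z)) v) = t' v"
    if "t' \<in> rect_tangent a b (\<lambda>c. N (\<not> c)) (\<lambda>c. M (\<not> c))" for t'
    using that * unfolding rect_tangent_def by blast
qed auto

section \<open>Sylvester operators and the blocks between two H summands\<close>

lemma sum_idm_scaled [simp]:
  "(\<Sum>k<a. f k * (x * idm k j)) = (if j < a then f j * x else 0)"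
  "(\<Sum>k<a. f k * (x * idm j k)) = (if j < a then f j * x else 0)"
  "(\<Sum>k<a. x * idm k j * f k) = (if j < a then x * f j else 0)"
  "(\<Sum>k<a. x * idm j k * f k) = (if j < a then x * f j else 0)"
proof -
  have "(\<Sum>k<a. f k * (x * idm k j)) = (\<Sum>k<a. (f k * x) * idm k j)"
    "(\<Sum>k<a. f k * (x * idm j k)) = (\<Sum>k<a. (f k * x) * idm j k)"
    "(\<Sum>k<a. x * idm k j * f k) = (\<Sum>k<a. idm k j * (x * f k))"
    "(\<Sum>k<a. x * idm j k * f k) = (\<Sum>k<a. idm j k * (x * f k))"
    by (simp_all only: mult_ac)
  then show "(\<Sum>k<a. f k * (x * idm k j)) = (if j < a then f j * x else 0)"
    "(\<Sum>k<a. f k * (x * idm j k)) = (if j < a then f j * x else 0)"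
    "(\<Sum>k<a. x * idm k j * f k) = (if j < a then x * f j else 0)"
    "(\<Sum>k<a. x * idm j k * f k) = (if j < a then x * f j else 0)"
    by (simp_all only: sum_idm)
qed

text \<open>X J_m(0) - J_n(0) X; the width \<open>m\<close> enters only through the grid on which it
  is read.\<close>

definition sylvester :: "nat \<Rightarrow> (nat \<Rightarrow> nat \<Rightarrow> complex) \<Rightarrow> nat \<times> nat \<Rightarrow> complex" where
  "sylvester n X = (\<lambda>(i, j). (if 0 < j then X i (j - 1) else 0) - (if Suc i < n then X (Suc i) j else 0))"

text \<open>The equation at (i, j + 1) links X(i, j) with X(i + 1, j + 1) and is solved from the
  last column backwards. For uniqueness, a diagonal starting in the first column below the top row
  reaches the bottom row before the last column, since n \<le> m; there the second term is missing,
  which forces all its entries to be 0.\<close>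

lemma sylvester_first_column:
  assumes "n \<le> m"
  shows "complements (grid n m) (range (sylvester n)) {(i, j). j = 0}"
proof (rule complementsI)
  fix u :: "nat \<times> nat \<Rightarrow> complex"
  obtain X where X: "\<And>i j. X i j = (if Suc j < m then
      u (i, Suc j) + (if Suc i < n then X (Suc i) (Suc j) else 0) else 0)"
    by (rule recursion_solvable2[where \<mu> = "\<lambda>i j. m - j" and G = "\<lambda>X i j. if Suc j < m then
      u (i, Suc j) + (if Suc i < n then X (Suc i) (Suc j) else 0) else 0"]) ((auto)[1], rule that)
  have "sylvester n X (i, j) = u (i, j)" if "j < m" "j \<noteq> 0" for i j
    using that X[of i "j - 1"] by (simp add: sylvester_def)
  then show "\<exists>t\<in>range (sylvester n). \<forall>z\<in>grid n m - {(i, j). j = 0}. t z = u z"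
    by (intro bexI[of _ "sylvester n X"]) (auto simp: grid_def)
next
  fix t z assume t: "t \<in> range (sylvester n)" and z: "z \<in> grid n m"
    and zero: "\<And>z. z \<in> grid n m \<Longrightarrow> z \<notin> {(i, j). j = 0} \<Longrightarrow> t z = 0"
  obtain X where X: "t = sylvester n X" using t by blast
  have step: "X i j = (if Suc i < n then X (Suc i) (Suc j) else 0)" if "i < n" "Suc j < m" for i j
    using zero[of "(i, Suc j)"] that by (auto simp: X sylvester_def grid_def)
  have X0: "X i j = 0" if "i < n" "j + (n - i) < m" for i j
    using that
  proof (induction "n - i" arbitrary: i j)
    case (Suc d)
    then show ?case using step[of i j] by auto
  qed simp
  obtain i j where ij: "z = (i, j)" "i < n" "j < m" using z by (auto simp: grid_def)
  show "t z = 0"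
  proof (cases "j = 0")
    case True
    then show ?thesis using X0[of "Suc i" 0] ij assms by (auto simp: X sylvester_def)
  qed (use zero z ij in auto)
qed

text \<open>The same diagonals are followed from the top row downwards. Entries strictly below the
  main diagonal lie on diagonals starting in the first column, where the first term is missing, so
  they vanish in the homogeneous system; since m \<le> n, the last row of the image reads only such
  entries.\<close>

lemma sylvester_last_row:
  assumes "m \<le> n"
  shows "complements (grid n m) (range (sylvester n)) {(i, j). Suc i = n}"
proof (rule complementsI)
  fix u :: "nat \<times> nat \<Rightarrow> complex"
  obtain X where X: "\<And>i j. X i j = (if 0 < i then
      (if 0 < j then X (i - 1) (j - 1) else 0) - u (i - 1, j) else 0)"
    by (rule recursion_solvable2[where \<mu> = "\<lambda>i j. i" and G = "\<lambda>X i j. if 0 < i then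
      (if 0 < j then X (i - 1) (j - 1) else 0) - u (i - 1, j) else 0"]) ((auto)[1], rule that)
  have "sylvester n X (i, j) = u (i, j)" if "i < n" "Suc i \<noteq> n" for i j
    using that X[of "Suc i" j] by (simp add: sylvester_def)
  then show "\<exists>t\<in>range (sylvester n). \<forall>z\<in>grid n m - {(i, j). Suc i = n}. t z = u z"
    by (intro bexI[of _ "sylvester n X"]) (auto simp: grid_def)
next
  fix t z assume t: "t \<in> range (sylvester n)" and z: "z \<in> grid n m"
    and zero: "\<And>z. z \<in> grid n m \<Longrightarrow> z \<notin> {(i, j). Suc i = n} \<Longrightarrow> t z = 0"
  obtain X where X: "t = sylvester n X" using t by blast
  have step: "X (Suc i) j = (if 0 < j then X i (j - 1) else 0)" if "Suc i < n" "j < m" for i j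
    using zero[of "(i, j)"] that by (auto simp: X sylvester_def grid_def)
  have X0: "X i j = 0" if "j < i" "i < n" "j < m" for i j
    using that
  proof (induction j arbitrary: i)
    case 0
    then show ?case using step[of "i - 1" 0] by simp
  next
    case (Suc j)
    then show ?case using step[of "i - 1" "Suc j"] by auto
  qed
  obtain i j where ij: "z = (i, j)" "i < n" "j < m" using z by (auto simp: grid_def)
  show "t z = 0"
  proof (cases "Suc i = n")
    case True
    then show ?thesis using X0[of "j - 1" i] ij assms by (auto simp: X sylvester_def)
  qed (use zero z ij in auto)
qed

text \<open>Reversing the order of an index range conjugates the shift into its transpose.\<close>

definition mirror :: "bool \<Rightarrow> nat \<Rightarrow> nat \<Rightarrow> nat" where
  "mirror r n i = (if r then n - Suc i else i)"

definition rshift :: "bool \<Rightarrow> nat \<Rightarrow> (nat \<Rightarrow> complex) \<Rightarrow> nat \<Rightarrow> complex" where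
  "rshift s m f j = (if s then if 0 < j then f (j - 1) else 0 else if Suc j < m then f (Suc j) else 0)"

lemma rshift_mirror:
  "j < m \<Longrightarrow> rshift s m f (mirror (\<not> s) m j) = rshift True m (\<lambda>j. f (mirror (\<not> s) m j)) j"
  "i < n \<Longrightarrow> rshift r n f (mirror r n i) = rshift False n (\<lambda>i. f (mirror r n i)) i"
  by (auto simp: rshift_def mirror_def Suc_diff_Suc)

text \<open>The eigenvalues combine into the scalar \<nu> - \<mu>, the nilpotent parts into two
  one-step shifts. Distinct eigenvalues thus give a triangular system with nonzero diagonal, equal
  ones a difference of two shifts.\<close>

lemma eliminated_action_HH:
  assumes "i < n" "j < m"
  shows "eliminated_action m n (opencil (Hpair n \<mu>) r True) (opencil (Hpair m \<nu>) (\<not> s)) X (i, j) =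
    (\<nu> - \<mu>) * X i j + rshift s m (X i) j - rshift r n (\<lambda>i. X i j) i"
  using assms
  by (cases r; cases s)
    (simp_all add: eliminated_action_def opencil_def rshift_def distrib_left distrib_right sum.distrib,
     simp_all add: algebra_simps)

lemma block_eliminate:
  assumes "\<And>i k. opencil x r False i k = idm i k" "part x (\<not> r) = part x r"
    and "complements (grid (part x r) (part y s))
       (range (eliminated_action (part y (\<not> s)) (part x r) (opencil x r True) (opencil y (\<not> s)))) S"
  shows "complements (block_positions x r y s) (block_tangent x r y s) {(c, z). c \<and> z \<in> S}"
  unfolding block_positions_def block_tangent_def assms(2)
  by (rule complements_eliminate) (use assms in auto)

lemma opencil_H_False: "opencil (Hpair n \<mu>) r False i k = idm i k"
  by (simp add: opencil_def idm_def)

text \<open>Reversing the order of rows or columns reduces all four orientations to one Sylvester operator.\<close>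

lemma block_HH_same:
  assumes "S = {(i, j). mirror (\<not> s) m j = 0} \<and> n \<le> m \<or> S = {(i, j). Suc (mirror r n i) = n} \<and> m \<le> n"
  shows "complements (block_positions (Hpair n \<mu>) r (Hpair m \<mu>) s) (block_tangent (Hpair n \<mu>) r (Hpair m \<mu>) s)
    {(c, z). c \<and> z \<in> S}"
proof (rule block_eliminate)
  let ?\<iota> = "\<lambda>(i, j). (mirror r n i, mirror (\<not> s) m j)"
  let ?T = "range (eliminated_action m n (opencil (Hpair n \<mu>) r True) (opencil (Hpair m \<mu>) (\<not> s)))"
  have mm: "mirror r n (mirror r n i) = i" "mirror r n i < n" if "i < n" for r n i
    using that by (auto simp: mirror_def)
  have W: "eliminated_action m n (opencil (Hpair n \<mu>) r True) (opencil (Hpair m \<mu>) (\<not> s)) X (?\<iota> z) =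
      sylvester n (\<lambda>i j. X (mirror r n i) (mirror (\<not> s) m j)) z" if z: "z \<in> grid n m" for X z
  proof -
    obtain i j where ij: "z = (i, j)" "i < n" "j < m" using z by (auto simp: grid_def)
    show ?thesis
      unfolding ij prod.case eliminated_action_HH[OF mm(2)[OF ij(2)] mm(2)[OF ij(3)]]
        rshift_mirror(1)[OF ij(3)] rshift_mirror(2)[OF ij(2)]
      by (simp add: rshift_def sylvester_def)
  qed
  have "complements (grid n m) ?T S"
  proof (rule complements_reindex[where \<iota> = ?\<iota>])
    show "bij_betw ?\<iota> (grid n m) (grid n m)"
      by (rule bij_betw_byWitness[where f' = ?\<iota>]) (auto simp: grid_def mm)
    show "\<exists>t'\<in>range (sylvester n). \<forall>z\<in>grid n m. t (?\<iota> z) = t' z" if "t \<in> ?T" for t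
      using that W by blast
    show "\<exists>t\<in>?T. \<forall>z\<in>grid n m. t (?\<iota> z) = t' z" if t': "t' \<in> range (sylvester n)" for t'
    proof -
      obtain X where X: "t' = sylvester n X" using t' by blast
      \<comment> \<open>Mirroring is an involution, so the mirrored solution of the standard problem
        is the required preimage.\<close>
      have "sylvester n X z = sylvester n (\<lambda>i j. X (mirror r n (mirror r n i)) (mirror (\<not> s) m (mirror (\<not> s) m j))) z"
        if "z \<in> grid n m" for z
        using that by (auto simp: sylvester_def grid_def mm)
      then have "\<forall>z\<in>grid n m. eliminated_action m n (opencil (Hpair n \<mu>) r True) (opencil (Hpair m \<mu>) (\<not> s))
          (\<lambda>i j. X (mirror r n i) (mirror (\<not> s) m j)) (?\<iota> z) = t' z"
        using W X by simp
      then show ?thesis by blast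
    qed
    show "complements (grid n m) (range (sylvester n)) {z. ?\<iota> z \<in> S}"
      using assms
    proof (elim disjE conjE)
      assume "S = {(i, j). mirror (\<not> s) m j = 0}" "n \<le> m"
      then show ?thesis
        by (intro complements_cong[OF sylvester_first_column]) (auto simp: grid_def mm)
    next
      assume "S = {(i, j). Suc (mirror r n i) = n}" "m \<le> n"
      then show ?thesis
        by (intro complements_cong[OF sylvester_last_row]) (auto simp: grid_def mm)
    qed
  qed auto
  then show "complements (grid (part (Hpair n \<mu>) r) (part (Hpair m \<mu>) s))
     (range (eliminated_action (part (Hpair m \<mu>) (\<not> s)) (part (Hpair n \<mu>) r)
       (opencil (Hpair n \<mu>) r True) (opencil (Hpair m \<mu>) (\<not> s)))) S"
    by simp
qed (simp_all add: opencil_H_False)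

lemma rshift_cong:
  assumes "\<And>j'. (if s then j' < j else j < j' \<and> j' < m) \<Longrightarrow> f j' = g j'"
  shows "rshift s m f j = rshift s m g j"
  using assms by (auto simp: rshift_def)

lemma block_eliminate_onto:
  assumes "\<And>i k. opencil x r False i k = idm i k" "part x (\<not> r) = part x r"
    and "\<And>u. \<exists>X. \<forall>i<part x r. \<forall>j<part y s.
      eliminated_action (part y (\<not> s)) (part x r) (opencil x r True) (opencil y (\<not> s)) X (i, j) = u i j"
  shows "complements (block_positions x r y s) (block_tangent x r y s) {}"
proof -
  have "complements (grid (part x r) (part y s))
       (range (eliminated_action (part y (\<not> s)) (part x r) (opencil x r True) (opencil y (\<not> s)))) {}"
  proof (rule complements_onto)
    fix u :: "nat \<times> nat \<Rightarrow> complex"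
    show "\<exists>t\<in>range (eliminated_action (part y (\<not> s)) (part x r) (opencil x r True) (opencil y (\<not> s))).
        \<forall>i\<in>grid (part x r) (part y s). t i = u i"
      using assms(3)[of "\<lambda>i j. u (i, j)"] by (auto simp: grid_def)
  qed
  from block_eliminate[OF assms(1,2) this] show ?thesis by simp
qed

text \<open>After division by \<nu> - \<mu> each entry of X depends on its neighbours in the
  directions of the two shifts. The measure adds the distances to the two edges at which these
  shifts stop.\<close>

lemma block_HH_different:
  assumes "\<mu> \<noteq> \<nu>"
  shows "complements (block_positions (Hpair n \<mu>) r (Hpair m \<nu>) s) (block_tangent (Hpair n \<mu>) r (Hpair m \<nu>) s) {}"
proof (rule block_eliminate_onto)
  fix u :: "nat \<Rightarrow> nat \<Rightarrow> complex"
  obtain X where X: "\<And>i j. X i j = (u i j - rshift s m (X i) j + rshift r n (\<lambda>i. X i j) i) / (\<nu> - \<mu>)"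
  proof (rule recursion_solvable2[where \<mu> = "\<lambda>i j. (if s then j else m - j) + (if r then i else n - i)"
      and G = "\<lambda>X i j. (u i j - rshift s m (X i) j + rshift r n (\<lambda>i. X i j) i) / (\<nu> - \<mu>)"])
    fix f g :: "nat \<Rightarrow> nat \<Rightarrow> complex" and i j
    assume *: "\<And>i' j'. (if s then j' else m - j') + (if r then i' else n - i') <
        (if s then j else m - j) + (if r then i else n - i) \<Longrightarrow> f i' j' = g i' j'"
    have "rshift s m (f i) j = rshift s m (g i) j"
      by (rule rshift_cong, rule *) (auto split: if_splits)
    moreover have "rshift r n (\<lambda>i. f i j) i = rshift r n (\<lambda>i. g i j) i"
      by (rule rshift_cong, rule *) (auto split: if_splits)
    ultimately show "(u i j - rshift s m (f i) j + rshift r n (\<lambda>i. f i j) i) / (\<nu> - \<mu>) =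
        (u i j - rshift s m (g i) j + rshift r n (\<lambda>i. g i j) i) / (\<nu> - \<mu>)" by simp
  qed (rule that)
  have "(\<nu> - \<mu>) * X i j + rshift s m (X i) j - rshift r n (\<lambda>i. X i j) i = u i j" for i j
    by (subst (1) X) (use assms in simp)
  then show "\<exists>X. \<forall>i<part (Hpair n \<mu>) r. \<forall>j<part (Hpair m \<nu>) s.
      eliminated_action (part (Hpair m \<nu>) (\<not> s)) (part (Hpair n \<mu>) r) (opencil (Hpair n \<mu>) r True)
        (opencil (Hpair m \<nu>) (\<not> s)) X (i, j) = u i j"
    by (intro exI[of _ X]) (simp add: eliminated_action_HH)
qed (simp_all add: opencil_H_False)

section \<open>Blocks between summands of different types, and between two K summands\<close>

lemma block_HK:
  "complements (block_positions (Hpair n \<mu>) r (Kpair m) s) (block_tangent (Hpair n \<mu>) r (Kpair m) s) {}"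
proof (rule block_eliminate_onto)
  fix u :: "nat \<Rightarrow> nat \<Rightarrow> complex"
  let ?B = "opencil (Hpair n \<mu>) r True"
  \<comment> \<open>The first matrix of K is nilpotent, so the eliminated operator is X - B X J with
    J (or its transpose) moving columns: it is unipotent and is inverted column by column.\<close>
  obtain X where X: "\<And>i j. X i j = u i j + (\<Sum>l<n. ?B i l * rshift s m (X l) j)"
  proof (rule recursion_solvable2[where \<mu> = "\<lambda>i j. if s then j else m - j"
      and G = "\<lambda>X i j. u i j + (\<Sum>l<n. ?B i l * rshift s m (X l) j)"])
    fix f g :: "nat \<Rightarrow> nat \<Rightarrow> complex" and i j
    assume *: "\<And>i' j'. (if s then j' else m - j') < (if s then j else m - j) \<Longrightarrow> f i' j' = g i' j'"
    have "rshift s m (f l) j = rshift s m (g l) j" for l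
      by (rule rshift_cong, rule *) (auto split: if_splits)
    then show "u i j + (\<Sum>l<n. ?B i l * rshift s m (f l) j) = u i j + (\<Sum>l<n. ?B i l * rshift s m (g l) j)"
      by simp
  qed (rule that)
  have "eliminated_action m n ?B (opencil (Kpair m) (\<not> s)) X (i, j) =
      X i j - (\<Sum>l<n. ?B i l * rshift s m (X l) j)" if "j < m" for i j
    using that by (cases s) (simp_all add: eliminated_action_def opencil_def[of "Kpair m"] rshift_def)
  moreover have "X i j - (\<Sum>l<n. ?B i l * rshift s m (X l) j) = u i j" for i j
    by (subst (1) X) simp
  ultimately show "\<exists>X. \<forall>i<part (Hpair n \<mu>) r. \<forall>j<part (Kpair m) s.
      eliminated_action (part (Kpair m) (\<not> s)) (part (Hpair n \<mu>) r) ?B (opencil (Kpair m) (\<not> s)) X (i, j) = u i j"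
    by (intro exI[of _ X]) simp
qed (simp_all add: opencil_H_False)

text \<open>Column j of the eliminated operator X G - B X F is X_(j-1) - B X_j, the term X_m being
  absent. Columns 1 to m determine X from the last one backwards; column 0, left with -B X_0,
  carries the stars.\<close>

lemma block_HL_first_column:
  "complements (block_positions (Hpair n \<mu>) r (Lpair m) True) (block_tangent (Hpair n \<mu>) r (Lpair m) True)
     {(c, z). c \<and> z \<in> {(i, j). j = 0}}"
proof (rule block_eliminate)
  let ?B = "opencil (Hpair n \<mu>) r True"
  have W: "eliminated_action m n ?B (opencil (Lpair m) False) X (i, j) =
      (if 0 < j then X i (j - 1) else 0) - (\<Sum>l<n. ?B i l * (if j < m then X l j else 0))" if "j \<le> m" for X i j
    using that by (simp add: eliminated_action_def opencil_def[of "Lpair m"] del: sum.lessThan_Suc)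
  have "complements (grid n (Suc m)) (range (eliminated_action m n ?B (opencil (Lpair m) False))) {(i, j). j = 0}"
  proof (rule complementsI)
    fix u :: "nat \<times> nat \<Rightarrow> complex"
    obtain X where X: "\<And>i j. X i j = u (i, Suc j) + (\<Sum>l<n. ?B i l * (if Suc j < m then X l (Suc j) else 0))"
      by (rule recursion_solvable2[where \<mu> = "\<lambda>i j. m - j" and
        G = "\<lambda>X i j. u (i, Suc j) + (\<Sum>l<n. ?B i l * (if Suc j < m then X l (Suc j) else 0))"])
        ((auto cong: if_cong)[1], rule that)
    have *: "eliminated_action m n ?B (opencil (Lpair m) False) X (i, j) = u (i, j)" if "j \<le> m" "j \<noteq> 0" for i j
      using that X[of i "j - 1"] by (cases j) (simp_all add: W cong: if_cong)
    show "\<exists>t\<in>range (eliminated_action m n ?B (opencil (Lpair m) False)).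
        \<forall>z\<in>grid n (Suc m) - {(i, j). j = 0}. t z = u z"
    proof (intro bexI[of _ "eliminated_action m n ?B (opencil (Lpair m) False) X"] ballI)
      fix z assume "z \<in> grid n (Suc m) - {(i, j). j = 0}"
      then have "snd z \<le> m" "snd z \<noteq> 0" by (auto simp: grid_def)
      then show "eliminated_action m n ?B (opencil (Lpair m) False) X z = u z" using *[of "snd z" "fst z"] by simp
    qed simp
  next
    fix t z assume t: "t \<in> range (eliminated_action m n ?B (opencil (Lpair m) False))"
      and z: "z \<in> grid n (Suc m)" and zero: "\<And>z. z \<in> grid n (Suc m) \<Longrightarrow> z \<notin> {(i, j). j = 0} \<Longrightarrow> t z = 0"
    obtain X where X: "t = eliminated_action m n ?B (opencil (Lpair m) False) X" using t by blast
    have step: "X i j = (\<Sum>l<n. ?B i l * (if Suc j < m then X l (Suc j) else 0))" if "i < n" "j < m" for i j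
      using zero[of "(i, Suc j)"] that by (simp add: X W grid_def)
    have X0: "\<forall>i<n. X i j = 0" if "j < m" for j
      using that
    proof (induction "m - j" arbitrary: j)
      case (Suc d)
      show ?case
      proof (intro allI impI)
        fix i assume i: "i < n"
        have "(if Suc j < m then X l (Suc j) else 0) = 0" if "l < n" for l
          using Suc that by auto
        then have "(\<Sum>l<n. ?B i l * (if Suc j < m then X l (Suc j) else 0)) = 0"
          by (intro sum.neutral) simp
        then show "X i j = 0" using step[OF i \<open>j < m\<close>] by (rule trans[rotated])
      qed
    qed simp
    obtain i j where ij: "z = (i, j)" "i < n" "j \<le> m" using z by (auto simp: grid_def)
    show "t z = 0"
    proof (cases "j = 0")
      case True
      have "?B i l * (if 0 < m then X l 0 else 0) = 0" if "l < n" for l using X0[of 0] that by simp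
      then show ?thesis unfolding X ij W[OF ij(3)] unfolding True by (simp add: sum.neutral)
    qed (use zero z ij in auto)
  qed
  then show "complements (grid (part (Hpair n \<mu>) r) (part (Lpair m) True))
     (range (eliminated_action (part (Lpair m) (\<not> True)) (part (Hpair n \<mu>) r) ?B
        (opencil (Lpair m) (\<not> True)))) {(i, j). j = 0}" by simp
qed (simp_all add: opencil_H_False)

text \<open>Here X has one column more than the block: column j of the operator is X_(j+1) - B X_j,
  solved forwards from X_0 = 0.\<close>

lemma block_HL_onto:
  "complements (block_positions (Hpair n \<mu>) r (Lpair m) False) (block_tangent (Hpair n \<mu>) r (Lpair m) False) {}"
proof (rule block_eliminate_onto)
  fix u :: "nat \<Rightarrow> nat \<Rightarrow> complex"
  let ?B = "opencil (Hpair n \<mu>) r True"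
  obtain X where X: "\<And>i j. X i j = (if 0 < j then u i (j - 1) + (\<Sum>l<n. ?B i l * X l (j - 1)) else 0)"
    by (rule recursion_solvable2[where \<mu> = "\<lambda>i j. j" and
      G = "\<lambda>X i j. if 0 < j then u i (j - 1) + (\<Sum>l<n. ?B i l * X l (j - 1)) else 0"])
      ((auto cong: if_cong)[1], rule that)
  have "eliminated_action (Suc m) n ?B (opencil (Lpair m) True) X (i, j) = X i (Suc j) - (\<Sum>l<n. ?B i l * X l j)"
    if "j < m" for i j
    using that by (simp add: eliminated_action_def opencil_def[of "Lpair m"] del: sum.lessThan_Suc)
  moreover have "X i (Suc j) - (\<Sum>l<n. ?B i l * X l j) = u i j" for i j
    using X[of i "Suc j"] by simp
  ultimately show "\<exists>X. \<forall>i<part (Hpair n \<mu>) r. \<forall>j<part (Lpair m) False.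
      eliminated_action (part (Lpair m) (\<not> False)) (part (Hpair n \<mu>) r) ?B (opencil (Lpair m) (\<not> False)) X (i, j) = u i j"
    by (intro exI[of _ X]) simp
qed (simp_all add: opencil_H_False)

lemma opencil_K: "opencil (Kpair n) r (\<not> c) = opencil (Hpair n 0) r c"
  by (auto simp: opencil_def fun_eq_iff)

lemmas opencil_K_cases = opencil_K[where c = True, simplified] opencil_K[where c = False, simplified]

lemma block_KK:
  assumes "S = {(i, j). mirror (\<not> s) m j = 0} \<and> n \<le> m \<or> S = {(i, j). Suc (mirror r n i) = n} \<and> m \<le> n"
  shows "complements (block_positions (Kpair n) r (Kpair m) s) (block_tangent (Kpair n) r (Kpair m) s)
    {(c, z). \<not> c \<and> z \<in> S}"
proof -
  have "complements (rect_positions n m) (rect_tangent m n (opencil (Kpair n) r) (opencil (Kpair m) (\<not> s)))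
    {(c, z). (\<not> c, z) \<in> {(c, z). c \<and> z \<in> S}}"
    by (rule complements_swap)
      (use block_HH_same[OF assms, where \<mu> = 0] in \<open>simp add: opencil_K block_positions_def block_tangent_def\<close>)
  then show ?thesis by (simp add: block_positions_def block_tangent_def)
qed

text \<open>After exchanging the matrices, column j of the eliminated operator is X_j - B X_(j-1),
  solved forwards. In column m the term X_m is absent, hence the stars there.\<close>

lemma block_KL_last_column:
  "complements (block_positions (Kpair n) r (Lpair m) True) (block_tangent (Kpair n) r (Lpair m) True)
     {(c, z). \<not> c \<and> z \<in> {(i, j). j = m}}"
proof -
  let ?B = "opencil (Hpair n 0) r True" and ?M = "\<lambda>c. opencil (Lpair m) False (\<not> c)"
  have W: "eliminated_action m n ?B ?M X (i, j) =
      (if j < m then X i j else 0) - (\<Sum>l<n. ?B i l * (if 0 < j then X l (j - 1) else 0))" if "j \<le> m" for X i j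
    using that by (simp add: eliminated_action_def opencil_def[of "Lpair m"] del: sum.lessThan_Suc)
  have "complements (grid n (Suc m)) (range (eliminated_action m n ?B ?M)) {(i, j). j = m}"
  proof (rule complementsI)
    fix u :: "nat \<times> nat \<Rightarrow> complex"
    obtain X where X: "\<And>i j. X i j = u (i, j) + (\<Sum>l<n. ?B i l * (if 0 < j then X l (j - 1) else 0))"
      by (rule recursion_solvable2[where \<mu> = "\<lambda>i j. j" and
        G = "\<lambda>X i j. u (i, j) + (\<Sum>l<n. ?B i l * (if 0 < j then X l (j - 1) else 0))"])
        ((auto cong: if_cong)[1], rule that)
    have *: "eliminated_action m n ?B ?M X (i, j) = u (i, j)" if "j \<le> m" "j \<noteq> m" for i j
      using that X[of i j] by (simp add: W)
    show "\<exists>t\<in>range (eliminated_action m n ?B ?M). \<forall>z\<in>grid n (Suc m) - {(i, j). j = m}. t z = u z"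
    proof (intro bexI[of _ "eliminated_action m n ?B ?M X"] ballI)
      fix z assume "z \<in> grid n (Suc m) - {(i, j). j = m}"
      then have "snd z \<le> m" "snd z \<noteq> m" by (auto simp: grid_def)
      then show "eliminated_action m n ?B ?M X z = u z" using *[of "snd z" "fst z"] by simp
    qed simp
  next
    fix t z assume t: "t \<in> range (eliminated_action m n ?B ?M)"
      and z: "z \<in> grid n (Suc m)" and zero: "\<And>z. z \<in> grid n (Suc m) \<Longrightarrow> z \<notin> {(i, j). j = m} \<Longrightarrow> t z = 0"
    obtain X where X: "t = eliminated_action m n ?B ?M X" using t by blast
    have step: "X i j = (\<Sum>l<n. ?B i l * (if 0 < j then X l (j - 1) else 0))" if "i < n" "j < m" for i j
      using zero[of "(i, j)"] that by (simp add: X W grid_def)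
    have X0: "\<forall>i<n. X i j = 0" if "j < m" for j
      using that
    proof (induction j)
      case 0
      then show ?case using step[of _ 0] by simp
    next
      case (Suc j)
      then show ?case using step[of _ "Suc j"] by simp
    qed
    obtain i j where ij: "z = (i, j)" "i < n" "j \<le> m" using z by (auto simp: grid_def)
    show "t z = 0"
    proof (cases "j = m")
      case True
      have "?B i l * (if 0 < m then X l (m - 1) else 0) = 0" if "l < n" for l
        using X0[of "m - 1"] that by simp
      then show ?thesis unfolding X ij W[OF ij(3)] unfolding True by (simp add: sum.neutral)
    qed (use zero z ij in auto)
  qed
  then have "complements (rect_positions n (Suc m)) (rect_tangent m n (\<lambda>c. opencil (Kpair n) r (\<not> c)) ?M)
      {(c, z). c \<and> z \<in> {(i, j). j = m}}"
    by (intro complements_eliminate) (simp_all add: opencil_K_cases opencil_H_False)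
  from complements_swap[OF this] show ?thesis by (simp add: block_positions_def block_tangent_def)
qed

text \<open>With the matrices exchanged, column j is X_j - B X_(j+1); X has an additional column
  X_m, which is set to 0, and the system is solved backwards.\<close>

lemma block_KL_onto:
  "complements (block_positions (Kpair n) r (Lpair m) False) (block_tangent (Kpair n) r (Lpair m) False) {}"
proof -
  let ?B = "opencil (Hpair n 0) r True" and ?M = "\<lambda>c. opencil (Lpair m) True (\<not> c)"
  have "complements (grid n m) (range (eliminated_action (Suc m) n ?B ?M)) {}"
  proof (rule complements_onto)
    fix u :: "nat \<times> nat \<Rightarrow> complex"
    obtain X where X: "\<And>i j. X i j = (if j < m then u (i, j) + (\<Sum>l<n. ?B i l * X l (Suc j)) else 0)"
      by (rule recursion_solvable2[where \<mu> = "\<lambda>i j. m - j" and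
        G = "\<lambda>X i j. if j < m then u (i, j) + (\<Sum>l<n. ?B i l * X l (Suc j)) else 0"])
        ((auto cong: if_cong)[1], rule that)
    have "eliminated_action (Suc m) n ?B ?M X (i, j) = X i j - (\<Sum>l<n. ?B i l * X l (Suc j))" if "j < m" for i j
      using that by (simp add: eliminated_action_def opencil_def[of "Lpair m"] del: sum.lessThan_Suc)
    moreover have "X i j - (\<Sum>l<n. ?B i l * X l (Suc j)) = u (i, j)" if "j < m" for i j
      by (subst (1) X) (use that in simp)
    ultimately show "\<exists>t\<in>range (eliminated_action (Suc m) n ?B ?M). \<forall>z\<in>grid n m. t z = u z"
      by (intro bexI[of _ "eliminated_action (Suc m) n ?B ?M X"]) (auto simp: grid_def)
  qed
  then have "complements (rect_positions n m) (rect_tangent (Suc m) n (\<lambda>c. opencil (Kpair n) r (\<not> c)) ?M)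
      {(c, z). c \<and> z \<in> {}}"
    by (intro complements_eliminate) (simp_all add: opencil_K_cases opencil_H_False)
  from complements_swap[OF this] show ?thesis by (simp add: block_positions_def block_tangent_def)
qed

text \<open>Transposing X M + N Y exchanges the roles of X and Y and those of the two
  summands.\<close>

lemma block_transpose:
  assumes "complements (block_positions y s x r) (block_tangent y s x r) S"
  shows "complements (block_positions x r y s) (block_tangent x r y s) {(c, i, j). (c, j, i) \<in> S}"
proof (rule complements_reindex[OF _ _ _ _ assms, where \<iota> = "\<lambda>(c, i, j). (c, j, i)"])
  show "bij_betw (\<lambda>(c, i, j). (c, j, i)) (block_positions y s x r) (block_positions x r y s)"
    by (rule bij_betw_byWitness[where f' = "\<lambda>(c, i, j). (c, j, i)"])
      (auto simp: block_positions_def rect_positions_def)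
  have *: "rect_action (part y (\<not> s)) (part x (\<not> r)) (opencil x r) (opencil y (\<not> s)) X Y ((\<lambda>(c, i, j). (c, j, i)) v) =
      rect_action (part x (\<not> r)) (part y (\<not> s)) (opencil y s) (opencil x (\<not> r)) (\<lambda>i j. Y j i) (\<lambda>i j. X j i) v"
    for X Y v
    by (cases v; cases r; cases s) (simp_all add: rect_action_def opencil_def mult.commute add.commute)
  show "\<exists>t'\<in>block_tangent y s x r. \<forall>v\<in>block_positions y s x r. t ((\<lambda>(c, i, j). (c, j, i)) v) = t' v"
    if t: "t \<in> block_tangent x r y s" for t
  proof -
    obtain X Y where "t = rect_action (part y (\<not> s)) (part x (\<not> r)) (opencil x r) (opencil y (\<not> s)) X Y"
      using t unfolding block_tangent_def rect_tangent_def by blast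
    then show ?thesis using * unfolding block_tangent_def rect_tangent_def by blast
  qed
  show "\<exists>t\<in>block_tangent x r y s. \<forall>v\<in>block_positions y s x r. t ((\<lambda>(c, i, j). (c, j, i)) v) = t' v"
    if t: "t' \<in> block_tangent y s x r" for t'
  proof -
    obtain X Y where X: "t' = rect_action (part x (\<not> r)) (part y (\<not> s)) (opencil y s) (opencil x (\<not> r)) X Y"
      using t unfolding block_tangent_def rect_tangent_def by blast
    have "rect_action (part y (\<not> s)) (part x (\<not> r)) (opencil x r) (opencil y (\<not> s)) (\<lambda>i j. Y j i) (\<lambda>i j. X j i)
        \<in> block_tangent x r y s"
      unfolding block_tangent_def rect_tangent_def by blast
    then show ?thesis using *[of "\<lambda>i j. Y j i" "\<lambda>i j. X j i"] X by metis
  qed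
qed auto

section \<open>Blocks between two L summands\<close>

lemma block_LL_False_False:
  "complements (block_positions (Lpair n) False (Lpair m) False) (block_tangent (Lpair n) False (Lpair m) False) {}"
proof (rule complements_onto)
  fix u :: "bool \<times> nat \<times> nat \<Rightarrow> complex"
  \<comment> \<open>The first equation prescribes X(i, j) + Y(i, j) and gives Y for i < n, its last
    row being set to 0. The second prescribes X(i, j + 1) + Y(i + 1, j) and becomes a recursion on
    the columns of X, starting from 0.\<close>
  obtain X where X: "\<And>i j. X i j = (if 0 < j then u (True, i, j - 1) -
      (if Suc i < n then u (False, Suc i, j - 1) - X (Suc i) (j - 1) else 0) else 0)"
    by (rule recursion_solvable2[where \<mu> = "\<lambda>i j. j" and
      G = "\<lambda>X i j. if 0 < j then u (True, i, j - 1) -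
        (if Suc i < n then u (False, Suc i, j - 1) - X (Suc i) (j - 1) else 0) else 0"])
      ((auto cong: if_cong)[1], rule that)
  define Y where "Y i j = (if i < n then u (False, i, j) - X i j else 0)" for i j
  let ?act = "rect_action (Suc m) (Suc n) (opencil (Lpair n) False) (opencil (Lpair m) True)"
  have "?act X Y (c, i, j) = u (c, i, j)" if "i < n" "j < m" for c i j
    using that X[of i "Suc j"]
    by (cases c) (simp_all add: rect_action_def opencil_def Y_def del: sum.lessThan_Suc)
  then have "\<forall>z\<in>block_positions (Lpair n) False (Lpair m) False. ?act X Y z = u z"
    by (auto simp: block_positions_def rect_positions_def)
  then show "\<exists>t\<in>block_tangent (Lpair n) False (Lpair m) False.
      \<forall>z\<in>block_positions (Lpair n) False (Lpair m) False. t z = u z"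
    unfolding block_tangent_def rect_tangent_def by auto
qed

text \<open>Eliminating Y leaves X(i, j - 1) - X(i + 1, j) = w(i, j) for i + 1 < n, where entries
  outside the m columns of X count as 0. A diagonal that runs from the first column to the last has
  one equation more than unknowns; the surplus one, at (i, m) with m \<le> i, is left to a
  star.\<close>

lemma block_LL_False_True:
  "complements (block_positions (Lpair n) False (Lpair m) True) (block_tangent (Lpair n) False (Lpair m) True)
     {(c, i, j). c \<and> j = m \<and> m \<le> i \<and> Suc i < n}"
proof (rule complementsI)
  let ?I = "block_positions (Lpair n) False (Lpair m) True" and ?T = "block_tangent (Lpair n) False (Lpair m) True"
    and ?S = "{(c, i, j). c \<and> j = m \<and> m \<le> i \<and> Suc i < n}"
  let ?act = "rect_action m (Suc n) (opencil (Lpair n) False) (opencil (Lpair m) False)"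
  have F: "?act X Y (False, i, j) = (if j < m then X i j else 0) + Y i j"
    and T: "?act X Y (True, i, j) = (if 0 < j then X i (j - 1) else 0) + Y (Suc i) j"
    if "i < n" "j \<le> m" for X Y i j
    using that by (simp_all add: rect_action_def opencil_def del: sum.lessThan_Suc)
  {
    fix u :: "bool \<times> nat \<times> nat \<Rightarrow> complex"
    define w where "w i j = u (True, i, j) - u (False, Suc i, j)" for i j
    \<comment> \<open>Diagonals below the main one are solved rightwards from the left edge, the
      others backwards from the right edge.\<close>
    obtain X where X: "\<And>a b. X a b = (if b < a then (if 0 < b then X (a - 1) (b - 1) else 0) - w (a - 1) b
        else w a (Suc b) + (if Suc b < m then X (Suc a) (Suc b) else 0))"
    proof (rule recursion_solvable2[where \<mu> = "\<lambda>a b. if b < a then b else m - b" and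
        G = "\<lambda>X a b. if b < a then (if 0 < b then X (a - 1) (b - 1) else 0) - w (a - 1) b
          else w a (Suc b) + (if Suc b < m then X (Suc a) (Suc b) else 0)"])
      fix f g :: "nat \<Rightarrow> nat \<Rightarrow> complex" and a b
      assume *: "\<And>a' b'. (if b' < a' then b' else m - b') < (if b < a then b else m - b) \<Longrightarrow> f a' b' = g a' b'"
      have "f (a - 1) (b - 1) = g (a - 1) (b - 1)" if "b < a" "0 < b"
        using that by (intro *) auto
      moreover have "f (Suc a) (Suc b) = g (Suc a) (Suc b)" if "\<not> b < a" "Suc b < m"
        using that by (intro *) auto
      ultimately show "(if b < a then (if 0 < b then f (a - 1) (b - 1) else 0) - w (a - 1) b
          else w a (Suc b) + (if Suc b < m then f (Suc a) (Suc b) else 0)) =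
        (if b < a then (if 0 < b then g (a - 1) (b - 1) else 0) - w (a - 1) b
          else w a (Suc b) + (if Suc b < m then g (Suc a) (Suc b) else 0))"
        by simp
    qed (rule that)
    \<comment> \<open>Row n of Y occurs only in the second equation at i = n - 1 and is chosen to
      satisfy it.\<close>
    define Y where "Y i j = (if i < n then u (False, i, j) - (if j < m then X i j else 0)
      else u (True, n - 1, j) - (if 0 < j then X (n - 1) (j - 1) else 0))" for i j
    have eq: "(if 0 < j then X i (j - 1) else 0) - (if j < m then X (Suc i) j else 0) = w i j"
      if "j \<le> m" "j = m \<Longrightarrow> i < m" for i j
    proof (cases "j < Suc i")
      case True
      then have "j < m" using that by (cases "j = m") auto
      then show ?thesis using X[of "Suc i" j] True by simp
    next
      case False
      then show ?thesis using X[of i "j - 1"] that by (cases j) (auto cong: if_cong)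
    qed
    have "?act X Y (c, i, j) = u (c, i, j)" if "i < n" "j \<le> m" "(c, i, j) \<notin> ?S" for c i j
    proof (cases c)
      case True
      show ?thesis
      proof (cases "Suc i < n")
        case Suc: True
        then show ?thesis using eq[of j i] that True by (auto simp: T Y_def w_def algebra_simps)
      next
        case False
        then have "i = n - 1" using that by simp
        then show ?thesis using that True by (simp add: T Y_def)
      qed
    qed (use that in \<open>simp add: F Y_def\<close>)
    then have "\<forall>z\<in>?I - ?S. ?act X Y z = u z"
      unfolding block_positions_def rect_positions_def part.simps if_True by (metis (no_types, lifting) DiffE case_prodE less_Suc_eq_le mem_Collect_eq)
    moreover have "?act X Y \<in> ?T" by (auto simp: block_tangent_def rect_tangent_def)
    ultimately show "\<exists>t\<in>?T. \<forall>z\<in>?I - ?S. t z = u z" by blast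
  }
  fix t z assume t: "t \<in> ?T" and z: "z \<in> ?I" and zero: "\<And>z. z \<in> ?I \<Longrightarrow> z \<notin> ?S \<Longrightarrow> t z = 0"
  obtain X Y where XY: "t = ?act X Y" using t by (auto simp: block_tangent_def rect_tangent_def)
  have inI: "(c, i, j) \<in> ?I \<longleftrightarrow> i < n \<and> j \<le> m" for c i j
    by (auto simp: block_positions_def rect_positions_def)
  have Y: "Y i j = - (if j < m then X i j else 0)" if "i < n" "j \<le> m" for i j
    using zero[of "(False, i, j)"] that F[OF that, of X Y] by (simp add: inI XY eq_neg_iff_add_eq_0 add.commute)
  have X: "X a b = 0" if "b < a" "a < n" "b < m" for a b
    using that
  proof (induction b arbitrary: a)
    case 0
    then show ?case using zero[of "(True, a - 1, 0)"] T[of "a - 1" 0 X Y] Y[of a 0] by (simp add: inI XY)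
  next
    case (Suc b)
    then show ?case
      using zero[of "(True, a - 1, Suc b)"] T[of "a - 1" "Suc b" X Y] Y[of a "Suc b"] by (simp add: inI XY)
  qed
  show "t z = 0"
  proof (cases "z \<in> ?S")
    case True
    then obtain i where i: "z = (True, i, m)" "m \<le> i" "Suc i < n" by auto
    then show ?thesis using T[of i m X Y] Y[of "Suc i" m] X[of "m - 1" i] by (simp add: XY)
  qed (use zero z in blast)
qed

lemma block_LL_True_False:
  "complements (block_positions (Lpair n) True (Lpair m) False) (block_tangent (Lpair n) True (Lpair m) False)
     {(c, i, j). c \<and> i = n \<and> n \<le> j \<and> Suc j < m}"
  by (rule complements_cong[OF block_transpose[OF block_LL_False_True]]) auto

text \<open>There are n + m + 2 equations more than unknowns, which is the number of stars. The
  first equation gives Y and the last row of X, and contains no unknown at all at the corner (n, m);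
  off the stars, the second one then determines the remaining rows of X from the top.\<close>

lemma block_LL_True_True:
  "complements (block_positions (Lpair n) True (Lpair m) True) (block_tangent (Lpair n) True (Lpair m) True)
     {(c, i, j). if c then j = 0 \<or> i = n else i = n \<and> j = m}"
proof (rule complementsI)
  let ?I = "block_positions (Lpair n) True (Lpair m) True" and ?T = "block_tangent (Lpair n) True (Lpair m) True"
    and ?S = "{(c, i, j). if c then j = 0 \<or> i = n else i = n \<and> j = m}"
  let ?act = "rect_action m n (opencil (Lpair n) True) (opencil (Lpair m) False)"
  have F: "?act X Y (False, i, j) = (if j < m then X i j else 0) + (if i < n then Y i j else 0)"
    and T: "?act X Y (True, i, j) = (if 0 < j then X i (j - 1) else 0) + (if 0 < i then Y (i - 1) j else 0)"
    if "i \<le> n" "j \<le> m" for X Y i j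
    using that by (simp_all add: rect_action_def opencil_def del: sum.lessThan_Suc)
  have inI: "(c, i, j) \<in> ?I \<longleftrightarrow> i \<le> n \<and> j \<le> m" for c i j
    by (auto simp: block_positions_def rect_positions_def)
  {
    fix u :: "bool \<times> nat \<times> nat \<Rightarrow> complex"
    obtain X where X: "\<And>i b. X i b = (if i < n then u (True, i, Suc b) -
        (if 0 < i then u (False, i - 1, Suc b) - (if Suc b < m then X (i - 1) (Suc b) else 0) else 0)
        else u (False, n, b))"
      by (rule recursion_solvable2[where \<mu> = "\<lambda>i b. i" and
        G = "\<lambda>X i b. if i < n then u (True, i, Suc b) -
          (if 0 < i then u (False, i - 1, Suc b) - (if Suc b < m then X (i - 1) (Suc b) else 0) else 0)
          else u (False, n, b)"])
        ((auto cong: if_cong)[1], rule that)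
    define Y where "Y i j = u (False, i, j) - (if j < m then X i j else 0)" for i j
    have "?act X Y (c, i, j) = u (c, i, j)" if "i \<le> n" "j \<le> m" "(c, i, j) \<notin> ?S" for c i j
    proof (cases c)
      case True
      then show ?thesis using that X[of i "j - 1"] by (cases j) (auto simp: T Y_def cong: if_cong)
    next
      case False
      then show ?thesis using that X[of i j] by (auto simp: F Y_def)
    qed
    then have "\<forall>z\<in>?I - ?S. ?act X Y z = u z" using inI by (metis (no_types, lifting) DiffE prod.collapse)
    moreover have "?act X Y \<in> ?T" by (auto simp: block_tangent_def rect_tangent_def)
    ultimately show "\<exists>t\<in>?T. \<forall>z\<in>?I - ?S. t z = u z" by blast
  }
  fix t z assume t: "t \<in> ?T" and z: "z \<in> ?I" and zero: "\<And>z. z \<in> ?I \<Longrightarrow> z \<notin> ?S \<Longrightarrow> t z = 0"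
  obtain X Y where XY: "t = ?act X Y" using t by (auto simp: block_tangent_def rect_tangent_def)
  have Y: "Y i j = - (if j < m then X i j else 0)" if "i < n" "j \<le> m" for i j
    using zero[of "(False, i, j)"] that F[of i j X Y] by (simp add: inI XY eq_neg_iff_add_eq_0 add.commute)
  have Xn: "X n j = 0" if "j < m" for j
    using zero[of "(False, n, j)"] that F[of n j X Y] by (simp add: inI XY)
  have X: "X i j = 0" if "i < n" "j < m" for i j
    using that
  proof (induction i arbitrary: j)
    case 0
    then show ?case using zero[of "(True, 0, Suc j)"] T[of 0 "Suc j" X Y] by (simp add: inI XY)
  next
    case (Suc i)
    then show ?case
      using zero[of "(True, Suc i, Suc j)"] T[of "Suc i" "Suc j" X Y] Y[of i "Suc j"] by (auto simp: inI XY)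
  qed
  obtain c i j where cij: "z = (c, i, j)" "i \<le> n" "j \<le> m" using z inI by (cases z) auto
  have X': "X i j = 0" if "i \<le> n" "j < m" for i j
    using X[of i j] Xn[of j] that by (cases "i = n") auto
  then have Y': "Y i j = 0" if "i < n" "j \<le> m" for i j using Y[OF that] that by simp
  show "t z = 0"
    using cij X' Y' by (cases c) (auto simp: XY F T)
qed

section \<open>Blocks joining a half of a summand to itself\<close>

definition skew_action :: "nat \<Rightarrow> (bool \<Rightarrow> nat \<Rightarrow> nat \<Rightarrow> complex) \<Rightarrow> (nat \<Rightarrow> nat \<Rightarrow> complex) \<Rightarrow> bool \<times> nat \<times> nat \<Rightarrow> complex" where
  "skew_action b N Z = (\<lambda>(c, i, j). (\<Sum>k<b. N c i k * Z k j) - (\<Sum>k<b. N c j k * Z k i))"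

text \<open>\<open>U\<close> prescribes the skew part of Z, so only the upper triangle
  \<open>R\<close> is free. The shifted condition relates R(i + 1, j) to R(i, j + 1) and is solved
  along antidiagonals from the top row. The zero row Z(n, j) stands for what the shift reads beyond
  the edge.\<close>

lemma skew_solve_up:
  fixes U V :: "nat \<Rightarrow> nat \<Rightarrow> complex"
  obtains Z where "\<And>j. Z n j = 0" "\<And>i j. i < j \<Longrightarrow> j < n \<Longrightarrow> Z i j - Z j i = U i j"
    "\<And>i j. i < j \<Longrightarrow> j < n \<Longrightarrow> Z (Suc i) j - Z (Suc j) i = V i j"
proof -
  obtain R where R: "\<And>a b. R a b = (if 0 < a then V (a - 1) b +
      (if Suc b < n then R (a - 1) (Suc b) - U (a - 1) (Suc b) else 0) else 0)"
    by (rule recursion_solvable2[where \<mu> = "\<lambda>a b. a" and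
      G = "\<lambda>R a b. if 0 < a then V (a - 1) b +
        (if Suc b < n then R (a - 1) (Suc b) - U (a - 1) (Suc b) else 0) else 0"])
      ((auto cong: if_cong)[1], rule that)
  define Z where "Z i j = (if n \<le> i then 0 else if i \<le> j then R i j else R j i - U j i)" for i j
  show ?thesis
  proof (rule that[of Z])
    show "Z (Suc i) j - Z (Suc j) i = V i j" if "i < j" "j < n" for i j
      using that R[of "Suc i" j] by (auto simp: Z_def)
  qed (auto simp: Z_def)
qed

text \<open>For the transposed shift the lower triangle \<open>L\<close> is taken as free: L(j - 1,
  i) is determined by L(j, i - 1), again along antidiagonals, starting from the first
  column.\<close>

lemma skew_solve_down:
  fixes U V :: "nat \<Rightarrow> nat \<Rightarrow> complex"
  obtains Z where "\<And>j. j \<le> n \<Longrightarrow> Z n j = 0" "\<And>i j. i < j \<Longrightarrow> j \<le> n \<Longrightarrow> Z i j - Z j i = U i j"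
    "\<And>i j. i < j \<Longrightarrow> j \<le> n \<Longrightarrow> (if 0 < i then Z (i - 1) j else 0) - Z (j - 1) i = V i j"
proof -
  obtain L where L: "\<And>a b. L a b = (if a < n then
      (if 0 < b then U (b - 1) (Suc a) + L (Suc a) (b - 1) else 0) - V b (Suc a) else 0)"
    by (rule recursion_solvable2[where \<mu> = "\<lambda>a b. b" and
      G = "\<lambda>L a b. if a < n then
        (if 0 < b then U (b - 1) (Suc a) + L (Suc a) (b - 1) else 0) - V b (Suc a) else 0"])
      ((auto cong: if_cong)[1], rule that)
  define Z where "Z i j = (if j \<le> i then L i j else U i j + L j i)" for i j
  show ?thesis
  proof (rule that[of Z])
    show "(if 0 < i then Z (i - 1) j else 0) - Z (j - 1) i = V i j" if "i < j" "j \<le> n" for i j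
      using that L[of "j - 1" i] by (auto simp: Z_def)
    show "Z n j = 0" if "j \<le> n" for j using that L[of n j] by (simp add: Z_def)
  qed (auto simp: Z_def)
qed

text \<open>These blocks carry no stars because only entries above the diagonal are prescribed: two
  equations for each pair i < j, against a full matrix Z of unknowns.\<close>

lemma skew_action_onto:
  "complements (upper_positions (part x r)) (range (skew_action (part x (\<not> r)) (opencil x r))) {}"
proof (rule complements_onto)
  fix u :: "bool \<times> nat \<times> nat \<Rightarrow> complex"
  have "\<exists>Z. \<forall>c i j. i < j \<longrightarrow> j < part x r \<longrightarrow> skew_action (part x (\<not> r)) (opencil x r) Z (c, i, j) = u (c, i, j)"
  proof (cases x)
    case (Hpair n \<mu>)
    \<comment> \<open>Subtracting \<mu> times the first equation from the second leaves a pure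
      shift.\<close>
    define V where "V i j = u (True, i, j) - \<mu> * u (False, i, j)" for i j
    show ?thesis
    proof (cases r)
      case True
      \<comment> \<open>The bound in \<open>skew_solve_down\<close> is inclusive, hence n - 1 for a
        block of size n.\<close>
      obtain Z where Z: "\<And>i j. i < j \<Longrightarrow> j \<le> n - 1 \<Longrightarrow> Z i j - Z j i = u (False, i, j)"
        "\<And>i j. i < j \<Longrightarrow> j \<le> n - 1 \<Longrightarrow> (if 0 < i then Z (i - 1) j else 0) - Z (j - 1) i = V i j"
        using skew_solve_down[of "n - 1" "\<lambda>i j. u (False, i, j)" V] by metis
      have "skew_action n (opencil (Hpair n \<mu>) True) Z (c, i, j) = u (c, i, j)" if ij: "i < j" "j < n" for c i j
      proof (cases c)
        case True
        have "skew_action n (opencil (Hpair n \<mu>) True) Z (True, i, j) =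
            \<mu> * (Z i j - Z j i) + ((if 0 < i then Z (i - 1) j else 0) - Z (j - 1) i)"
          using ij by (simp add: skew_action_def opencil_def distrib_right sum.distrib) (simp add: algebra_simps)
        then show ?thesis using Z(1)[of i j] Z(2)[of i j] ij True by (simp add: V_def)
      next
        case False
        then show ?thesis using Z(1)[of i j] ij by (simp add: skew_action_def opencil_def)
      qed
      then show ?thesis using True Hpair by (intro exI[of _ Z]) simp
    next
      case False
      obtain Z where Z: "\<And>j. Z n j = 0" "\<And>i j. i < j \<Longrightarrow> j < n \<Longrightarrow> Z i j - Z j i = u (False, i, j)"
        "\<And>i j. i < j \<Longrightarrow> j < n \<Longrightarrow> Z (Suc i) j - Z (Suc j) i = V i j"
        using skew_solve_up[of n "\<lambda>i j. u (False, i, j)" V] by metis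
      have "skew_action n (opencil (Hpair n \<mu>) False) Z (c, i, j) = u (c, i, j)" if ij: "i < j" "j < n" for c i j
      proof (cases c)
        case True
        \<comment> \<open>Row n of Z vanishes, so the truncated sum agrees with Z(j + 1, i) even at
          j + 1 = n.\<close>
        have "(if Suc j < n then Z (Suc j) i else 0) = Z (Suc j) i"
          using Z(1)[of i] ij by (cases "Suc j = n") auto
        then have "skew_action n (opencil (Hpair n \<mu>) False) Z (True, i, j) =
            \<mu> * (Z i j - Z j i) + (Z (Suc i) j - Z (Suc j) i)"
          using ij by (simp add: skew_action_def opencil_def distrib_right sum.distrib) (simp add: algebra_simps)
        then show ?thesis using Z(2)[of i j] Z(3)[of i j] ij True by (simp add: V_def)
      next
        case False
        then show ?thesis using Z(2)[of i j] ij by (simp add: skew_action_def opencil_def)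
      qed
      then show ?thesis using False Hpair by (intro exI[of _ Z]) simp
    qed
  next
    case (Kpair n)
    show ?thesis
    proof (cases r)
      case True
      obtain Z where Z: "\<And>i j. i < j \<Longrightarrow> j \<le> n - 1 \<Longrightarrow> Z i j - Z j i = u (True, i, j)"
        "\<And>i j. i < j \<Longrightarrow> j \<le> n - 1 \<Longrightarrow> (if 0 < i then Z (i - 1) j else 0) - Z (j - 1) i = u (False, i, j)"
        using skew_solve_down[of "n - 1" "\<lambda>i j. u (True, i, j)" "\<lambda>i j. u (False, i, j)"] by metis
      have "skew_action n (opencil (Kpair n) True) Z (c, i, j) = u (c, i, j)" if ij: "i < j" "j < n" for c i j
        using Z(1)[of i j] Z(2)[of i j] ij by (cases c) (simp_all add: skew_action_def opencil_def del: sum.lessThan_Suc)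
      then show ?thesis using True Kpair by (intro exI[of _ Z]) simp
    next
      case False
      obtain Z where Z: "\<And>j. Z n j = 0" "\<And>i j. i < j \<Longrightarrow> j < n \<Longrightarrow> Z i j - Z j i = u (True, i, j)"
        "\<And>i j. i < j \<Longrightarrow> j < n \<Longrightarrow> Z (Suc i) j - Z (Suc j) i = u (False, i, j)"
        using skew_solve_up[of n "\<lambda>i j. u (True, i, j)" "\<lambda>i j. u (False, i, j)"] by metis
      have "skew_action n (opencil (Kpair n) False) Z (c, i, j) = u (c, i, j)" if ij: "i < j" "j < n" for c i j
      proof -
        have "(if Suc j < n then Z (Suc j) i else 0) = Z (Suc j) i"
          using Z(1)[of i] ij by (cases "Suc j = n") auto
        then show ?thesis using Z(2)[of i j] Z(3)[of i j] ij by (cases c) (simp_all add: skew_action_def opencil_def del: sum.lessThan_Suc)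
      qed
      then show ?thesis using False Kpair by (intro exI[of _ Z]) simp
    qed
  next
    case (Lpair n)
    show ?thesis
    proof (cases r)
      case True
      obtain Z where Z: "\<And>j. j \<le> n \<Longrightarrow> Z n j = 0" "\<And>i j. i < j \<Longrightarrow> j \<le> n \<Longrightarrow> Z i j - Z j i = u (False, i, j)"
        "\<And>i j. i < j \<Longrightarrow> j \<le> n \<Longrightarrow> (if 0 < i then Z (i - 1) j else 0) - Z (j - 1) i = u (True, i, j)"
        using skew_solve_down[of n "\<lambda>i j. u (False, i, j)" "\<lambda>i j. u (True, i, j)"] by metis
      have "skew_action n (opencil (Lpair n) True) Z (c, i, j) = u (c, i, j)" if ij: "i < j" "j \<le> n" for c i j
      proof -
        have "(if j < n then Z j i else 0) = Z j i"
          using Z(1)[of i] ij by (cases "j = n") auto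
        then show ?thesis using Z(2)[of i j] Z(3)[of i j] ij by (cases c) (simp_all add: skew_action_def opencil_def del: sum.lessThan_Suc)
      qed
      then show ?thesis using True Lpair by (intro exI[of _ Z]) simp
    next
      case False
      obtain Z where Z: "\<And>i j. i < j \<Longrightarrow> j < n \<Longrightarrow> Z i j - Z j i = u (False, i, j)"
        "\<And>i j. i < j \<Longrightarrow> j < n \<Longrightarrow> Z (Suc i) j - Z (Suc j) i = u (True, i, j)"
        using skew_solve_up[of n "\<lambda>i j. u (False, i, j)" "\<lambda>i j. u (True, i, j)"] by metis
      have "skew_action (Suc n) (opencil (Lpair n) False) Z (c, i, j) = u (c, i, j)" if ij: "i < j" "j < n" for c i j
        using Z(1)[of i j] Z(2)[of i j] ij by (cases c) (simp_all add: skew_action_def opencil_def del: sum.lessThan_Suc)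
      then show ?thesis using False Lpair by (intro exI[of _ Z]) simp
    qed
  qed
  then obtain Z where "\<forall>c i j. i < j \<longrightarrow> j < part x r \<longrightarrow>
      skew_action (part x (\<not> r)) (opencil x r) Z (c, i, j) = u (c, i, j)"
    by (rule exE)
  then have *: "\<forall>z\<in>upper_positions (part x r). skew_action (part x (\<not> r)) (opencil x r) Z z = u z"
    by (simp add: upper_positions_def)
  show "\<exists>t\<in>range (skew_action (part x (\<not> r)) (opencil x r)). \<forall>z\<in>upper_positions (part x r). t z = u z"
    by (rule bexI[where x = "skew_action (part x (\<not> r)) (opencil x r) Z"]) (rule *, simp)
qed

section \<open>The direct sum\<close>

lemma offset_0 [simp]: "offset Xs 0 = 0"
  by (simp add: offset_def total_size_def)

lemma offset_Cons_Suc [simp]: "offset (x # xs) (Suc i) = summand_size x + offset xs i"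
  by (simp add: offset_def total_size_def)

lemma total_size_Cons [simp]: "total_size (x # xs) = summand_size x + total_size xs"
  by (simp add: total_size_def)

lemma total_size_Nil [simp]: "total_size [] = 0"
  by (simp add: total_size_def)

lemma offset_less_total:
  "i < length Xs \<Longrightarrow> r < summand_size (Xs ! i) \<Longrightarrow> offset Xs i + r < total_size Xs"
proof (induction Xs arbitrary: i)
  case (Cons x xs)
  then show ?case by (cases i) auto
qed simp

lemma offset_mono:
  "i < j \<Longrightarrow> j < length Xs \<Longrightarrow> offset Xs i + summand_size (Xs ! i) \<le> offset Xs j"
proof (induction Xs arbitrary: i j)
  case (Cons x xs)
  then obtain j' where "j = Suc j'" by (cases j) auto
  then show ?case using Cons by (cases i) auto
qed simp

lemma offset_surj:
  "a < total_size Xs \<Longrightarrow> \<exists>i<length Xs. \<exists>r<summand_size (Xs ! i). a = offset Xs i + r"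
proof (induction Xs arbitrary: a)
  case (Cons x xs)
  show ?case
  proof (cases "a < summand_size x")
    case True
    then show ?thesis by (intro exI[of _ 0]) auto
  next
    case False
    then have "a - summand_size x < total_size xs" using Cons.prems by auto
    from Cons.IH[OF this] obtain i r
      where "i < length xs" "r < summand_size (xs ! i)" "a - summand_size x = offset xs i + r" by auto
    then show ?thesis using False by (intro exI[of _ "Suc i"]) auto
  qed
qed simp

lemma offset_eq_iff:
  assumes "i < length Xs" "r < summand_size (Xs ! i)" "j < length Xs" "s < summand_size (Xs ! j)"
  shows "offset Xs i + r = offset Xs j + s \<longleftrightarrow> i = j \<and> r = s"
  using offset_mono[of i j Xs] offset_mono[of j i Xs] assms by (cases i j rule: linorder_cases) auto

lemma diag_block_mat_offset:
  assumes "\<And>x. f x \<in> carrier_mat (summand_size x) (summand_size x)"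
    and "i < length Xs" "r < summand_size (Xs ! i)" "j < length Xs" "s < summand_size (Xs ! j)"
  shows "diag_block_mat (map f Xs) $$ (offset Xs i + r, offset Xs j + s) =
    (if i = j then f (Xs ! i) $$ (r, s) else (0::complex))"
  using assms(2-)
proof (induction Xs arbitrary: i j)
  case (Cons x xs)
  have dims: "dim_row (f y) = summand_size y" "dim_col (f y) = summand_size y" for y
    using assms(1)[of y] by auto
  have dim: "dim_row (diag_block_mat (map f xs)) = total_size xs" "dim_col (diag_block_mat (map f xs)) = total_size xs"
    by (simp_all add: dim_diag_block_mat total_size_def dims comp_def)
  have lt: "offset xs i + r < total_size xs" if "i < length xs" "r < summand_size (xs ! i)" for i r
    using that by (rule offset_less_total)
  show ?case
    using Cons lt by (cases i; cases j) (auto simp: Let_def dims dim)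
qed simp

lemma diag_block_mat_carrier:
  assumes "\<And>x. f x \<in> carrier_mat (summand_size x) (summand_size x)"
  shows "diag_block_mat (map f Xs) \<in> carrier_mat (total_size Xs) (total_size Xs)"
proof -
  have "dim_row (f y) = summand_size y" "dim_col (f y) = summand_size y" for y
    using assms[of y] by auto
  then show ?thesis by (intro carrier_matI) (simp_all add: dim_diag_block_mat total_size_def comp_def)
qed

section \<open>Global indices of the halves and the action on their blocks\<close>

definition pos :: "summand \<Rightarrow> bool \<Rightarrow> nat \<Rightarrow> nat" where
  "pos x p r = (if p then part x False + r else r)"

lemma summand_size_part: "summand_size x = part x False + part x True"
  by (cases x) auto

lemma pos_less: "r < part x p \<Longrightarrow> pos x p r < summand_size x"
  by (cases p) (auto simp: pos_def summand_size_part)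

lemma pos_surj:
  assumes "r < summand_size x"
  shows "\<exists>p. \<exists>q<part x p. r = pos x p q"
proof (cases "r < part x False")
  case True
  then show ?thesis by (intro exI[of _ False] exI[of _ r]) (simp add: pos_def)
next
  case False
  then show ?thesis
    using assms by (intro exI[of _ True] exI[of _ "r - part x False"]) (auto simp: pos_def summand_size_part)
qed

lemma pos_eq_iff:
  "r < part x p \<Longrightarrow> s < part x q \<Longrightarrow> pos x p r = pos x q s \<longleftrightarrow> p = q \<and> r = s"
  by (auto simp: pos_def)

text \<open>The lower left block of a summand is -N^T, so the pencil read from half True enters with
  a minus sign.\<close>

definition orient_sign :: "bool \<Rightarrow> complex" where
  "orient_sign p = (if p then - 1 else 1)"

lemma skew_block_index:
  assumes "M \<in> carrier_mat p q" "i < p + q" "j < p + q"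
  shows "skew_block M $$ (i, j) =
    (if i < p then if j < p then 0 else M $$ (i, j - p) else if j < p then - M $$ (j, i - p) else 0)"
  using assms by (simp add: skew_block_def)

lemma summand_pair_skew_block:
  obtains M where "\<And>c. (if c then snd (summand_pair x) else fst (summand_pair x)) = skew_block (M c)"
    "\<And>c. M c \<in> carrier_mat (part x False) (part x True)"
    "\<And>c i j. i < part x False \<Longrightarrow> j < part x True \<Longrightarrow> M c $$ (i, j) = pencil x c i j"
proof (cases x)
  case (Hpair n \<mu>)
  show ?thesis
    by (rule that[of "\<lambda>c. if c then jordan_block n \<mu> else 1\<^sub>m n"])
      (simp_all add: Hpair jordan_block_def idm_def upm_def)
next
  case (Kpair n)
  show ?thesis
    by (rule that[of "\<lambda>c. if c then 1\<^sub>m n else jordan_block n 0"])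
      (simp_all add: Kpair jordan_block_def idm_def upm_def)
next
  case (Lpair n)
  show ?thesis
    by (rule that[of "\<lambda>c. if c then G_mat n else F_mat n"])
      (auto simp: Lpair F_mat_def G_mat_def idm_def upm_def)
qed

lemma summand_pair_carrier:
  "fst (summand_pair x) \<in> carrier_mat (summand_size x) (summand_size x)"
  "snd (summand_pair x) \<in> carrier_mat (summand_size x) (summand_size x)"
proof -
  obtain M where M: "\<And>c. (if c then snd (summand_pair x) else fst (summand_pair x)) = skew_block (M c)"
    "\<And>c. M c \<in> carrier_mat (part x False) (part x True)"
    using summand_pair_skew_block[of x] by metis
  have "skew_block (M c) \<in> carrier_mat (summand_size x) (summand_size x)" for c
    using carrier_matD[OF M(2)[of c]] by (intro carrier_matI) (simp_all add: skew_block_def summand_size_part)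
  then show "fst (summand_pair x) \<in> carrier_mat (summand_size x) (summand_size x)"
    "snd (summand_pair x) \<in> carrier_mat (summand_size x) (summand_size x)"
    using M(1)[of False] M(1)[of True] by simp_all
qed

lemma summand_pair_entry:
  assumes "r < part x p" "s < part x q"
  shows "pair_entry (summand_pair x) c (pos x p r) (pos x q s) =
    (if p = q then 0 else orient_sign p * opencil x p c r s)"
proof -
  obtain M where M: "\<And>c. (if c then snd (summand_pair x) else fst (summand_pair x)) = skew_block (M c)"
    "\<And>c. M c \<in> carrier_mat (part x False) (part x True)"
    "\<And>c i j. i < part x False \<Longrightarrow> j < part x True \<Longrightarrow> M c $$ (i, j) = pencil x c i j"
    using summand_pair_skew_block[of x] by metis
  have "pos x p r < part x False + part x True" "pos x q s < part x False + part x True"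
    using assms[THEN pos_less] by (simp_all add: summand_size_part)
  from skew_block_index[OF M(2) this, of c] show ?thesis
    using assms unfolding pair_entry_def M(1)
    by (cases p; cases q) (simp_all add: pos_def opencil_def orient_sign_def M(3))
qed

definition glob :: "summand list \<Rightarrow> nat \<Rightarrow> bool \<Rightarrow> nat \<Rightarrow> nat" where
  "glob Xs i p r = offset Xs i + pos (Xs ! i) p r"

lemma glob_less: "i < length Xs \<Longrightarrow> r < part (Xs ! i) p \<Longrightarrow> glob Xs i p r < total_size Xs"
  unfolding glob_def by (intro offset_less_total pos_less)

lemma glob_surj:
  assumes "a < total_size Xs"
  obtains i p r where "i < length Xs" "r < part (Xs ! i) p" "a = glob Xs i p r"
  using offset_surj[OF assms] pos_surj unfolding glob_def by metis

lemma glob_eq_iff: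
  assumes "i < length Xs" "r < part (Xs ! i) p" "j < length Xs" "s < part (Xs ! j) q"
  shows "glob Xs i p r = glob Xs j q s \<longleftrightarrow> i = j \<and> p = q \<and> r = s"
  using offset_eq_iff[of i Xs "pos (Xs ! i) p r" j "pos (Xs ! j) q s"] pos_eq_iff[of r "Xs ! i" p s q] assms
    pos_less[of r "Xs ! i" p] pos_less[of s "Xs ! j" q]
  unfolding glob_def by auto

lemma glob_less_iff:
  assumes "i < length Xs" "r < part (Xs ! i) p" "j < length Xs" "s < part (Xs ! j) q"
  shows "glob Xs i p r < glob Xs j q s \<longleftrightarrow> i < j \<or> i = j \<and> (\<not> p \<and> q \<or> p = q \<and> r < s)"
proof (cases i j rule: linorder_cases)
  case less
  then show ?thesis
    using offset_mono[OF less assms(3)] pos_less[OF assms(2)] by (auto simp: glob_def)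
next
  case equal
  then show ?thesis using assms by (auto simp: glob_def pos_def)
next
  case greater
  then show ?thesis
    using offset_mono[OF greater assms(1)] pos_less[OF assms(4)] by (auto simp: glob_def)
qed

lemma direct_sum_entry:
  assumes "i < length Xs" "r < part (Xs ! i) p" "j < length Xs" "s < part (Xs ! j) q"
  shows "pair_entry (direct_sum_pair Xs) c (glob Xs i p r) (glob Xs j q s) =
    (if i = j \<and> p \<noteq> q then orient_sign p * opencil (Xs ! i) p c r s else 0)"
proof -
  have "pair_entry (direct_sum_pair Xs) c (glob Xs i p r) (glob Xs j q s) =
      (if i = j then pair_entry (summand_pair (Xs ! i)) c (pos (Xs ! i) p r) (pos (Xs ! j) q s) else 0)"
    unfolding pair_entry_def direct_sum_pair_def glob_def
    using diag_block_mat_offset[of "fst \<circ> summand_pair" i Xs "pos (Xs ! i) p r" j "pos (Xs ! j) q s"]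
      diag_block_mat_offset[of "snd \<circ> summand_pair" i Xs "pos (Xs ! i) p r" j "pos (Xs ! j) q s"]
      pos_less[OF assms(2)] pos_less[OF assms(4)] assms summand_pair_carrier
    by auto
  then show ?thesis using assms summand_pair_entry[of r "Xs ! i" p s q c] by auto
qed

lemma direct_sum_carrier:
  "fst (direct_sum_pair Xs) \<in> carrier_mat (total_size Xs) (total_size Xs)"
  "snd (direct_sum_pair Xs) \<in> carrier_mat (total_size Xs) (total_size Xs)"
  unfolding direct_sum_pair_def fst_conv snd_conv
  using summand_pair_carrier by (auto intro!: diag_block_mat_carrier)

lemma opencil_not: "opencil x (\<not> p) c r s = opencil x p c s r"
  by (simp add: opencil_def)

lemma orient_sign_not [simp]: "orient_sign (\<not> p) = - orient_sign p"
  by (simp add: orient_sign_def)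

lemma orient_sign_square [simp]: "orient_sign p * (orient_sign p * z) = z" "orient_sign p * orient_sign p = 1"
  by (simp_all add: orient_sign_def)

lemma direct_sum_skew:
  assumes "a < total_size Xs" "b < total_size Xs"
  shows "pair_entry (direct_sum_pair Xs) c b a = - pair_entry (direct_sum_pair Xs) c a b"
proof -
  obtain i p r where ipr: "i < length Xs" "r < part (Xs ! i) p" "a = glob Xs i p r"
    using glob_surj[OF assms(1)] by blast
  obtain j q s where jqs: "j < length Xs" "s < part (Xs ! j) q" "b = glob Xs j q s"
    using glob_surj[OF assms(2)] by blast
  show ?thesis
    unfolding ipr(3) jqs(3) direct_sum_entry[OF ipr(1,2) jqs(1,2)] direct_sum_entry[OF jqs(1,2) ipr(1,2)]
    by (cases p; cases q) (auto simp: orient_sign_def opencil_def)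
qed

lemma skew_pair_direct_sum: "skew_pair (total_size Xs) (direct_sum_pair Xs)"
  unfolding skew_pair_iff_entries using direct_sum_carrier direct_sum_skew by blast

text \<open>Only the opposite half of the same summand meets the rows of a given half, so the sum
  over all indices collapses to one block.\<close>

lemma direct_sum_row_sum:
  assumes "i < length Xs" "r < part (Xs ! i) p"
  shows "(\<Sum>k<total_size Xs. pair_entry (direct_sum_pair Xs) c (glob Xs i p r) k * f k) =
    orient_sign p * (\<Sum>q<part (Xs ! i) (\<not> p). opencil (Xs ! i) p c r q * f (glob Xs i (\<not> p) q))"
proof -
  let ?g = "glob Xs i (\<not> p)" and ?A = "pair_entry (direct_sum_pair Xs) c (glob Xs i p r)"
  have sub: "?g ` {..<part (Xs ! i) (\<not> p)} \<subseteq> {..<total_size Xs}"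
    using glob_less[OF assms(1)] by auto
  have inj: "inj_on ?g {..<part (Xs ! i) (\<not> p)}"
    using assms(1) by (auto simp: inj_on_def glob_eq_iff)
  have "(\<Sum>k<total_size Xs. ?A k * f k) = (\<Sum>k\<in>?g ` {..<part (Xs ! i) (\<not> p)}. ?A k * f k)"
  proof (rule sum.mono_neutral_right[OF _ sub], simp, rule ballI)
    fix k assume k: "k \<in> {..<total_size Xs} - ?g ` {..<part (Xs ! i) (\<not> p)}"
    then have "k < total_size Xs" by simp
    then obtain j q s where jqs: "j < length Xs" "s < part (Xs ! j) q" "k = glob Xs j q s"
      by (rule glob_surj)
    then have "\<not> (i = j \<and> p \<noteq> q)" using k by auto
    then show "?A k * f k = 0" unfolding jqs(3) direct_sum_entry[OF assms jqs(1,2)]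
      by (simp only: if_False mult_zero_left)
  qed
  also have "\<dots> = (\<Sum>q<part (Xs ! i) (\<not> p). ?A (?g q) * f (?g q))"
    using inj by (simp add: sum.reindex)
  also have "\<dots> = (\<Sum>q<part (Xs ! i) (\<not> p). orient_sign p * (opencil (Xs ! i) p c r q * f (?g q)))"
    by (intro sum.cong refl) (use assms in \<open>auto simp: direct_sum_entry\<close>)
  finally show ?thesis by (simp add: sum_distrib_left)
qed

lemma direct_sum_congruence:
  assumes "i < length Xs" "r < part (Xs ! i) p" "j < length Xs" "s < part (Xs ! j) q"
  shows "congruence_action (total_size Xs) (pair_entry (direct_sum_pair Xs)) S (c, glob Xs i p r, glob Xs j q s) =
    orient_sign p * (\<Sum>k<part (Xs ! i) (\<not> p). opencil (Xs ! i) p c r k * S (glob Xs i (\<not> p) k) (glob Xs j q s)) -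
    orient_sign q * (\<Sum>k<part (Xs ! j) (\<not> q). opencil (Xs ! j) q c s k * S (glob Xs j (\<not> q) k) (glob Xs i p r))"
proof -
  let ?A = "pair_entry (direct_sum_pair Xs) c" and ?n = "total_size Xs"
  have "(\<Sum>k<?n. S k (glob Xs i p r) * ?A k (glob Xs j q s)) =
      - (\<Sum>k<?n. ?A (glob Xs j q s) k * S k (glob Xs i p r))"
    unfolding sum_negf [symmetric]
  proof (rule sum.cong[OF refl])
    fix k assume "k \<in> {..<?n}"
    then have "?A k (glob Xs j q s) = - ?A (glob Xs j q s) k"
      by (intro direct_sum_skew glob_less assms) simp
    then show "S k (glob Xs i p r) * ?A k (glob Xs j q s) = - (?A (glob Xs j q s) k * S k (glob Xs i p r))"
      by simp
  qed
  then show ?thesis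
    unfolding congruence_action_def prod.case direct_sum_row_sum[OF assms(1,2)] direct_sum_row_sum[OF assms(3,4)]
    by simp
qed

text \<open>Up to sign, X and Y are blocks of S: X is the transpose of the block with rows in the
  opposite half of \<open>j\<close> and columns in half \<open>p\<close> of \<open>i\<close>, and Y
  is the block with rows in the opposite half of \<open>i\<close> and columns in half
  \<open>q\<close> of \<open>j\<close>.\<close>

lemma direct_sum_congruence_rect:
  assumes "i < length Xs" "r < part (Xs ! i) p" "j < length Xs" "s < part (Xs ! j) q"
  shows "congruence_action (total_size Xs) (pair_entry (direct_sum_pair Xs)) S (c, glob Xs i p r, glob Xs j q s) =
    rect_action (part (Xs ! j) (\<not> q)) (part (Xs ! i) (\<not> p)) (opencil (Xs ! i) p) (opencil (Xs ! j) (\<not> q))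
      (\<lambda>r k. - orient_sign q * S (glob Xs j (\<not> q) k) (glob Xs i p r))
      (\<lambda>k s. orient_sign p * S (glob Xs i (\<not> p) k) (glob Xs j q s)) (c, r, s)"
  unfolding direct_sum_congruence[OF assms] rect_action_def prod.case opencil_not
  by (simp add: sum_distrib_left sum_negf mult_ac)

text \<open>For a half paired with itself these two blocks of S coincide, so a single unknown Z is
  left.\<close>

lemma direct_sum_congruence_skew:
  assumes "i < length Xs" "r < part (Xs ! i) p" "s < part (Xs ! i) p"
  shows "congruence_action (total_size Xs) (pair_entry (direct_sum_pair Xs)) S (c, glob Xs i p r, glob Xs i p s) =
    skew_action (part (Xs ! i) (\<not> p)) (opencil (Xs ! i) p)
      (\<lambda>k s. orient_sign p * S (glob Xs i (\<not> p) k) (glob Xs i p s)) (c, r, s)"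
  unfolding direct_sum_congruence[OF assms(1,2,1,3)] skew_action_def prod.case
  by (simp add: sum_distrib_left mult_ac)

text \<open>An inverse of the global numbering, by which a matrix can be defined block by
  block.\<close>

lemma glob_decode:
  obtains d where "\<And>i p r. i < length Xs \<Longrightarrow> r < part (Xs ! i) p \<Longrightarrow> d (glob Xs i p r) = (i, p, r)"
proof
  fix i p r assume *: "i < length Xs" "r < part (Xs ! i) p"
  show "(SOME v. case v of (j, q, s) \<Rightarrow> j < length Xs \<and> s < part (Xs ! j) q \<and> glob Xs i p r = glob Xs j q s) = (i, p, r)"
  proof (rule some_equality)
    fix v assume "case v of (j, q, s) \<Rightarrow> j < length Xs \<and> s < part (Xs ! j) q \<and> glob Xs i p r = glob Xs j q s"
    then show "v = (i, p, r)" using glob_eq_iff[OF *] by (cases v) auto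
  qed (use * in simp)
qed

text \<open>Pairs of halves whose block can meet the strict upper triangle; of the two blocks
  joining different halves of one summand, the one with rows in half False lies above the
  diagonal.\<close>

definition block_index :: "summand list \<Rightarrow> (nat \<times> bool \<times> nat \<times> bool) set" where
  "block_index Xs = {(i, p, j, q). i < length Xs \<and> j < length Xs \<and> (i < j \<or> i = j \<and> (p = q \<or> \<not> p \<and> q))}"

text \<open>The tangent space of the congruence orbit is the product of its blocks: the sign-twisted blocks
  of \<open>S\<close> act independently on the blocks above the diagonal.\<close>

lemma complements_direct_sum:
  assumes off: "\<And>i j p q. i < j \<Longrightarrow> j < length Xs \<Longrightarrow>
      complements (block_positions (Xs ! i) p (Xs ! j) q) (block_tangent (Xs ! i) p (Xs ! j) q)
        {(c, r, s). pair_entry D c (glob Xs i p r) (glob Xs j q s)}"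
    and diag: "\<And>i. i < length Xs \<Longrightarrow>
      complements (block_positions (Xs ! i) False (Xs ! i) True) (block_tangent (Xs ! i) False (Xs ! i) True)
        {(c, r, s). pair_entry D c (glob Xs i False r) (glob Xs i True s)}"
    and none: "\<And>i p c r s. i < length Xs \<Longrightarrow> r < part (Xs ! i) p \<Longrightarrow> s < part (Xs ! i) p \<Longrightarrow>
      \<not> pair_entry D c (glob Xs i p r) (glob Xs i p s)"
  shows "complements (upper_positions (total_size Xs))
    (range (congruence_action (total_size Xs) (pair_entry (direct_sum_pair Xs)))) (star_positions (total_size Xs) D)"
proof -
  let ?n = "total_size Xs" and ?A = "pair_entry (direct_sum_pair Xs)"
  let ?J = "\<lambda>(i, p, j, q). if i = j \<and> p = q then upper_positions (part (Xs ! i) p)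
      else block_positions (Xs ! i) p (Xs ! j) q"
  let ?\<iota> = "\<lambda>(i, p, j, q) (c, r, s). (c, glob Xs i p r, glob Xs j q s)"
  let ?skew = "\<lambda>i p. skew_action (part (Xs ! i) (\<not> p)) (opencil (Xs ! i) p)"
  let ?rect = "\<lambda>i p j q. rect_action (part (Xs ! j) (\<not> q)) (part (Xs ! i) (\<not> p)) (opencil (Xs ! i) p) (opencil (Xs ! j) (\<not> q))"
  let ?T = "\<lambda>(i, p, j, q). if i = j \<and> p = q then range (?skew i p) else block_tangent (Xs ! i) p (Xs ! j) q"
  let ?S = "\<lambda>(i, p, j, q). if i = j \<and> p = q then {}
      else {(c, r, s). pair_entry D c (glob Xs i p r) (glob Xs j q s)}"
  have J: "r < part (Xs ! i) p \<and> s < part (Xs ! j) q"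
    if "(c, r, s) \<in> ?J (i, p, j, q)" for i p j q c r s
    using that by (auto simp: upper_positions_def block_positions_def rect_positions_def split: if_splits)
  show ?thesis
  proof (rule complements_glue[where K = "block_index Xs" and J = ?J and \<iota> = ?\<iota> and T' = ?T and S' = ?S])
    fix v assume v: "v \<in> upper_positions ?n"
    obtain c a b where cab: "v = (c, a, b)" by (cases v)
    have ab: "a < b" "b < ?n" "a < ?n" using v by (auto simp: cab upper_positions_def)
    obtain i p r where ipr: "i < length Xs" "r < part (Xs ! i) p" "a = glob Xs i p r" using glob_surj[OF ab(3)] .
    obtain j q s where jqs: "j < length Xs" "s < part (Xs ! j) q" "b = glob Xs j q s" using glob_surj[OF ab(2)] .
    have lt: "i < j \<or> i = j \<and> (\<not> p \<and> q \<or> p = q \<and> r < s)"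
      using ab(1) unfolding ipr(3) jqs(3) glob_less_iff[OF ipr(1,2) jqs(1,2)] .
    have "(i, p, j, q) \<in> block_index Xs" using lt ipr jqs by (auto simp: block_index_def)
    moreover have "(c, r, s) \<in> ?J (i, p, j, q)"
      using lt ipr(2) jqs(2) by (auto simp: upper_positions_def block_positions_def rect_positions_def)
    moreover have "v = ?\<iota> (i, p, j, q) (c, r, s)" by (simp add: cab ipr jqs)
    ultimately show "\<exists>k\<in>block_index Xs. \<exists>z\<in>?J k. v = ?\<iota> k z" by blast
  next
    fix k z assume k: "k \<in> block_index Xs" and z: "z \<in> ?J k"
    obtain i p j q where kk: "k = (i, p, j, q)" by (cases k)
    obtain c r s where zz: "z = (c, r, s)" by (cases z)
    have rs: "r < part (Xs ! i) p" "s < part (Xs ! j) q" using J z unfolding kk zz by blast+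
    have ij: "i < length Xs" "j < length Xs" using k by (auto simp: kk block_index_def)
    have "glob Xs i p r < glob Xs j q s"
      using k z by (auto simp: glob_less_iff[OF ij(1) rs(1) ij(2) rs(2)] kk zz block_index_def upper_positions_def)
    then show up: "?\<iota> k z \<in> upper_positions ?n"
      using glob_less[OF ij(2) rs(2)] by (simp add: kk zz upper_positions_def)
    show "?\<iota> k z \<in> star_positions ?n D \<longleftrightarrow> z \<in> ?S k"
    proof (cases "i = j \<and> p = q")
      case True
      then show ?thesis using none[OF ij(1) rs(1)] rs by (auto simp: kk zz star_positions_def)
    next
      case False
      then show ?thesis using up by (auto simp: kk zz star_positions_def upper_positions_def)
    qed
  next
    fix t k assume t: "t \<in> range (congruence_action ?n ?A)" and k: "k \<in> block_index Xs"
    obtain S where S: "t = congruence_action ?n ?A S" using t by blast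
    obtain i p j q where kk: "k = (i, p, j, q)" by (cases k)
    have ij: "i < length Xs" "j < length Xs" using k by (auto simp: kk block_index_def)
    show "\<exists>t'\<in>?T k. \<forall>z\<in>?J k. t (?\<iota> k z) = t' z"
    proof (cases "i = j \<and> p = q")
      case True
      let ?t = "?skew i p (\<lambda>k s. orient_sign p * S (glob Xs i (\<not> p) k) (glob Xs i p s))"
      have "t (?\<iota> k z) = ?t z" if z: "z \<in> ?J k" for z
      proof -
        obtain c r s where zz: "z = (c, r, s)" by (cases z)
        have "r < part (Xs ! i) p" "s < part (Xs ! j) q" using J z unfolding kk zz by blast+
        then show ?thesis
          using direct_sum_congruence_skew[OF ij(1), of r p s S c] True by (simp add: S kk zz)
      qed
      moreover have "?t \<in> ?T k" using True by (simp add: kk)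
      ultimately show ?thesis by blast
    next
      case False
      let ?t = "?rect i p j q (\<lambda>r k. - orient_sign q * S (glob Xs j (\<not> q) k) (glob Xs i p r))
          (\<lambda>k s. orient_sign p * S (glob Xs i (\<not> p) k) (glob Xs j q s))"
      have "t (?\<iota> k z) = ?t z" if z: "z \<in> ?J k" for z
      proof -
        obtain c r s where zz: "z = (c, r, s)" by (cases z)
        have "r < part (Xs ! i) p" "s < part (Xs ! j) q" using J z unfolding kk zz by blast+
        then show ?thesis
          using direct_sum_congruence_rect[OF ij(1) _ ij(2), of r p s q S c] by (simp add: S kk zz)
      qed
      moreover have "?t \<in> ?T k" using False by (auto simp: kk block_tangent_def rect_tangent_def)
      ultimately show ?thesis by blast
    qed
  next
    fix t' assume t': "\<And>k. k \<in> block_index Xs \<Longrightarrow> t' k \<in> ?T k"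
    have "\<exists>Z. t' (i, p, i, p) = ?skew i p Z" if "i < length Xs" for i p
      using t'[of "(i, p, i, p)"] that by (auto simp: block_index_def)
    then obtain Z where Z: "\<And>i p. i < length Xs \<Longrightarrow> t' (i, p, i, p) = ?skew i p (Z i p)" by metis
    have "\<exists>X Y. t' (i, p, j, q) = ?rect i p j q X Y"
      if "(i, p, j, q) \<in> block_index Xs" "\<not> (i = j \<and> p = q)" for i p j q
    proof -
      have "t' (i, p, j, q) \<in> block_tangent (Xs ! i) p (Xs ! j) q"
        using t'[OF that(1)] that(2) by (simp only: prod.case if_False)
      then show ?thesis by (auto simp: block_tangent_def rect_tangent_def)
    qed
    then obtain X Y where XY: "\<And>i p j q. (i, p, j, q) \<in> block_index Xs \<Longrightarrow> \<not> (i = j \<and> p = q) \<Longrightarrow>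
        t' (i, p, j, q) = ?rect i p j q (X i p j q) (Y i p j q)"
      by metis
    obtain d where d: "\<And>i p r. i < length Xs \<Longrightarrow> r < part (Xs ! i) p \<Longrightarrow> d (glob Xs i p r) = (i, p, r)"
      using glob_decode[of Xs] by blast
    \<comment> \<open>The block of S with rows in half \<open>p\<close> of \<open>i\<close> and
      columns in half \<open>q\<close> of \<open>j\<close> acts on the block with rows in the
      opposite half of \<open>i\<close> and the same columns. If that block lies on the diagonal,
      the entry comes from Z; if above it, from Y; if below it, the transposed block is meant and
      the entry comes from X.\<close>
    define S where "S a b = (case d a of (i, p, r) \<Rightarrow> case d b of (j, q, s) \<Rightarrow>
        if i = j \<and> p \<noteq> q then orient_sign q * Z i q r s
        else if i < j \<or> i = j \<and> p then orient_sign (\<not> p) * Y i (\<not> p) j q r s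
        else - orient_sign (\<not> p) * X j q i (\<not> p) s r)" for a b
    have "congruence_action ?n ?A S (?\<iota> k z) = t' k z" if k: "k \<in> block_index Xs" and z: "z \<in> ?J k" for k z
    proof -
      obtain i p j q where kk: "k = (i, p, j, q)" by (cases k)
      obtain c r s where zz: "z = (c, r, s)" by (cases z)
      have rs: "r < part (Xs ! i) p" "s < part (Xs ! j) q" using J z unfolding kk zz by blast+
      have ij: "i < length Xs" "j < length Xs" using k by (auto simp: kk block_index_def)
      show ?thesis
      proof (cases "i = j \<and> p = q")
        case True
        have "orient_sign p * S (glob Xs i (\<not> p) k') (glob Xs i p s') = Z i p k' s'"
          if "k' < part (Xs ! i) (\<not> p)" "s' < part (Xs ! i) p" for k' s'
          using that ij by (simp add: S_def d)
        then have "congruence_action ?n ?A S (c, glob Xs i p r, glob Xs i p s) = ?skew i p (Z i p) (c, r, s)"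
          using rs True unfolding direct_sum_congruence_skew[OF ij(1) rs(1), of s S c, OF rs(2)[folded conjunct1[OF True] conjunct2[OF True]]]
          by (simp add: skew_action_def)
        then show ?thesis using True Z[OF ij(1)] by (simp add: kk zz)
      next
        case False
        have lt: "i < j \<or> i = j \<and> \<not> p \<and> q" using k False by (auto simp: kk block_index_def)
        have "- orient_sign q * S (glob Xs j (\<not> q) k') (glob Xs i p r) = X i p j q r k'"
          if "k' < part (Xs ! j) (\<not> q)" for k'
          using that ij rs lt by (auto simp: S_def d)
        moreover have "orient_sign p * S (glob Xs i (\<not> p) k') (glob Xs j q s) = Y i p j q k' s"
          if "k' < part (Xs ! i) (\<not> p)" for k'
          using that ij rs lt by (auto simp: S_def d)
        ultimately have "congruence_action ?n ?A S (c, glob Xs i p r, glob Xs j q s) =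
            ?rect i p j q (X i p j q) (Y i p j q) (c, r, s)"
          unfolding direct_sum_congruence_rect[OF ij(1) rs(1) ij(2) rs(2)] rect_action_def prod.case by simp
        then show ?thesis using XY[of i p j q] k False by (simp add: kk zz)
      qed
    qed
    then show "\<exists>t\<in>range (congruence_action ?n ?A). \<forall>k\<in>block_index Xs. \<forall>z\<in>?J k. t (?\<iota> k z) = t' k z"
      by blast
  next
    fix k assume k: "k \<in> block_index Xs"
    obtain i p j q where kk: "k = (i, p, j, q)" by (cases k)
    consider "i = j \<and> p = q" | "i < j" | "i = j" "\<not> p" "q" using k by (auto simp: kk block_index_def)
    then show "complements (?J k) (?T k) (?S k)"
    proof cases
      case 1
      then show ?thesis using skew_action_onto by (simp add: kk)
    next
      case 2
      then show ?thesis using off[of i j p q] k by (simp add: kk block_index_def)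
    next
      case 3
      then show ?thesis using diag[of i] k by (simp add: kk block_index_def)
    qed
  qed
qed

section \<open>Star patterns\<close>

lemma four_block_mat_pos:
  assumes "A \<in> carrier_mat (part x False) (part y False)" "B \<in> carrier_mat (part x False) (part y True)"
    "C \<in> carrier_mat (part x True) (part y False)" "D \<in> carrier_mat (part x True) (part y True)"
    "r < part x p" "s < part y q"
  shows "four_block_mat A B C D $$ (pos x p r, pos y q s) =
    (if p then if q then D else C else if q then B else A) $$ (r, s)"
  using assms by (cases p; cases q) (auto simp: pos_def)

lemma arrow_stars_carrier:
  "D \<in> nw_stars p q \<union> ne_stars p q \<union> se_stars p q \<union> sw_stars p q \<Longrightarrow> D \<in> carrier_mat p q"
  by (auto simp: nw_stars_def ne_stars_def se_stars_def sw_stars_def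
      first_col_def last_col_def first_row_def last_row_def)

text \<open>In mirrored coordinates all four arrows read alike: first column for n \<le> m, last row
  for m \<le> n. The halves (True, True), (True, False), (False, True) and (False, False) correspond
  to NW, NE, SW and SE.\<close>

lemma arrow_stars_pattern:
  assumes "D \<in> (if p then if q then nw_stars n m else ne_stars n m else if q then sw_stars n m else se_stars n m)"
  obtains S where "S = {(i, j). mirror (\<not> q) m j = 0} \<and> n \<le> m \<or> S = {(i, j). Suc (mirror p n i) = n} \<and> m \<le> n"
    "\<forall>i<n. \<forall>j<m. D $$ (i, j) \<longleftrightarrow> (i, j) \<in> S"
proof -
  have "n \<le> m \<and> (\<forall>i<n. \<forall>j<m. D $$ (i, j) \<longleftrightarrow> mirror (\<not> q) m j = 0) \<or>
      m \<le> n \<and> (\<forall>i<n. \<forall>j<m. D $$ (i, j) \<longleftrightarrow> Suc (mirror p n i) = n)"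
    using assms
    by (cases p; cases q)
      (auto simp: nw_stars_def ne_stars_def se_stars_def sw_stars_def mirror_def
        first_col_def last_col_def first_row_def last_row_def)
  then show ?thesis
  proof (elim disjE conjE)
    assume "n \<le> m" "\<forall>i<n. \<forall>j<m. D $$ (i, j) \<longleftrightarrow> mirror (\<not> q) m j = 0"
    then show ?thesis by (intro that[of "{(i, j). mirror (\<not> q) m j = 0}"]) auto
  next
    assume "m \<le> n" "\<forall>i<n. \<forall>j<m. D $$ (i, j) \<longleftrightarrow> Suc (mirror p n i) = n"
    then show ?thesis by (intro that[of "{(i, j). Suc (mirror p n i) = n}"]) auto
  qed
qed

lemma complements_block_cong:
  assumes "complements (block_positions x p y q) T S"
    and "\<And>c r s. r < part x p \<Longrightarrow> s < part y q \<Longrightarrow> (c, r, s) \<in> S \<longleftrightarrow> P c r s"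
  shows "complements (block_positions x p y q) T {(c, r, s). P c r s}"
  by (rule complements_cong[OF assms(1)]) (use assms(2) in \<open>auto simp: block_positions_def rect_positions_def\<close>)

lemma no_stars_index [simp]: "i < p \<Longrightarrow> j < q \<Longrightarrow> no_stars p q $$ (i, j) = False"
  by (simp add: no_stars_def)

lemma no_stars_carrier [simp]: "no_stars p q \<in> carrier_mat p q"
  and no_stars_dim [simp]: "dim_row (no_stars p q) = p" "dim_col (no_stars p q) = q"
  by (simp_all add: no_stars_def)

lemma no_stars_pos:
  "r < part x p \<Longrightarrow> s < part y q \<Longrightarrow> a = summand_size x \<Longrightarrow> b = summand_size y \<Longrightarrow>
    no_stars a b $$ (pos x p r, pos y q s) = False"
  by (simp add: pos_less)

lemma offdiag_block_complements:
  assumes P: "P \<in> offdiag_block x y"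
  shows "complements (block_positions x p y q) (block_tangent x p y q)
    {(c, r, s). pair_entry P c (pos x p r) (pos y q s)}"
proof -
  have arrows: "\<exists>S. (S = {(i, j). mirror (\<not> q) m j = 0} \<and> n \<le> m \<or> S = {(i, j). Suc (mirror p n i) = n} \<and> m \<le> n) \<and>
      (\<forall>r<n. \<forall>s<m. Q $$ (pos x p r, pos y q s) \<longleftrightarrow> (r, s) \<in> S)"
    if Q: "Q \<in> offdiag_stars n m" and nm: "\<And>p. part x p = n" "\<And>q. part y q = m" for Q n m
  proof -
    obtain SE SW NE NW where Q': "Q = four_block_mat SE SW NE NW" "SE \<in> se_stars n m" "SW \<in> sw_stars n m"
      "NE \<in> ne_stars n m" "NW \<in> nw_stars n m"
      using Q unfolding offdiag_stars_def by blast
    let ?D = "if p then if q then NW else NE else if q then SW else SE"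
    have "?D \<in> (if p then if q then nw_stars n m else ne_stars n m else if q then sw_stars n m else se_stars n m)"
      using Q' by simp
    then obtain S where S: "S = {(i, j). mirror (\<not> q) m j = 0} \<and> n \<le> m \<or> S = {(i, j). Suc (mirror p n i) = n} \<and> m \<le> n"
      "\<forall>i<n. \<forall>j<m. ?D $$ (i, j) \<longleftrightarrow> (i, j) \<in> S"
      by (rule arrow_stars_pattern)
    have "Q $$ (pos x p r, pos y q s) = ?D $$ (r, s)" if rs: "r < n" "s < m" for r s
      unfolding Q'(1) by (rule four_block_mat_pos) (use Q' rs nm arrow_stars_carrier in auto)
    then have "\<forall>r<n. \<forall>s<m. Q $$ (pos x p r, pos y q s) \<longleftrightarrow> (r, s) \<in> S"
      using S(2) by simp
    then show ?thesis using S(1) by blast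
  qed
  show ?thesis
  proof (cases x)
    case x: (Hpair n \<mu>)
    show ?thesis
    proof (cases y)
      case y: (Hpair m \<nu>)
      show ?thesis
      proof (cases "\<mu> = \<nu>")
        case True
        then have P': "fst P = no_stars (2 * n) (2 * m)" "snd P \<in> offdiag_stars n m" using P by (auto simp: x y)
        obtain S where S: "S = {(i, j). mirror (\<not> q) m j = 0} \<and> n \<le> m \<or> S = {(i, j). Suc (mirror p n i) = n} \<and> m \<le> n"
          "\<forall>r<n. \<forall>s<m. snd P $$ (pos x p r, pos y q s) \<longleftrightarrow> (r, s) \<in> S"
          using arrows[OF P'(2)] by (auto simp: x y)
        show ?thesis
          using block_HH_same[OF S(1), of \<mu>] unfolding x y True
          by (rule complements_block_cong)
            (use S(2) P' in \<open>auto simp: x y True pair_entry_def no_stars_pos\<close>)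
      next
        case False
        then have "P = (no_stars (2 * n) (2 * m), no_stars (2 * n) (2 * m))" using P by (simp add: x y)
        then show ?thesis
          using block_HH_different[OF False] unfolding x y
          by (intro complements_block_cong) (auto simp: pair_entry_def no_stars_pos)
      qed
    next
      case y: (Kpair m)
      have "P = (no_stars (2 * n) (2 * m), no_stars (2 * n) (2 * m))" using P by (simp add: x y)
      then show ?thesis
        unfolding x y by (intro complements_block_cong[OF block_HK]) (auto simp: pair_entry_def no_stars_pos)
    next
      case y: (Lpair m)
      \<comment> \<open>The pattern [0, first column] is a \<open>four_block_mat\<close> without
        lower rows, so both row halves of H fall into its upper part.\<close>
      have P': "fst P = no_stars (2 * n) (2 * m + 1)" "snd P = four_block_mat (no_stars (2 * n) m)
          (first_col (2 * n) (m + 1)) (no_stars 0 m) (no_stars 0 (m + 1))"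
        using P by (simp_all add: x y)
      have pos: "pos (Hpair n \<mu>) p r < 2 * n" if "r < n" for r
        using pos_less[of r "Hpair n \<mu>" p] that by simp
      show ?thesis
      proof (cases q)
        case True
        then have q: "q = True" by simp
        show ?thesis unfolding x y q
          by (rule complements_block_cong[OF block_HL_first_column])
            (use pos P' in \<open>auto simp: x y pair_entry_def pos_def[of "Lpair m"] first_col_def\<close>)
      next
        case False
        then have q: "q = False" by simp
        show ?thesis unfolding x y q
          by (rule complements_block_cong[OF block_HL_onto])
            (use pos P' in \<open>auto simp: x y pair_entry_def pos_def[of "Lpair m"]\<close>)
      qed
    qed
  next
    case x: (Kpair n)
    show ?thesis
    proof (cases y)
      case (Hpair m \<nu>)
      then show ?thesis using P by (simp add: x)
    next
      case y: (Kpair m)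
      have P': "snd P = no_stars (2 * n) (2 * m)" "fst P \<in> offdiag_stars n m" using P by (auto simp: x y)
      obtain S where S: "S = {(i, j). mirror (\<not> q) m j = 0} \<and> n \<le> m \<or> S = {(i, j). Suc (mirror p n i) = n} \<and> m \<le> n"
        "\<forall>r<n. \<forall>s<m. fst P $$ (pos x p r, pos y q s) \<longleftrightarrow> (r, s) \<in> S"
        using arrows[OF P'(2)] by (auto simp: x y)
      show ?thesis
        using block_KK[OF S(1)] unfolding x y
        by (rule complements_block_cong) (use S(2) P' in \<open>auto simp: x y pair_entry_def no_stars_pos\<close>)
    next
      case y: (Lpair m)
      have P': "fst P = last_col (2 * n) (2 * m + 1)" "snd P = no_stars (2 * n) (2 * m + 1)"
        using P by (simp_all add: x y)
      have pos: "pos (Kpair n) p r < 2 * n" if "r < n" for r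
        using pos_less[of r "Kpair n" p] that by simp
      show ?thesis
      proof (cases q)
        case True
        then have q: "q = True" by simp
        \<comment> \<open>Column 2m of the whole block is column m of the right half, whose columns
          start at m.\<close>
        show ?thesis unfolding x y q
          by (rule complements_block_cong[OF block_KL_last_column])
            (use pos P' in \<open>auto simp: x y pair_entry_def pos_def[of "Lpair m"] last_col_def\<close>)
      next
        case False
        then have q: "q = False" by simp
        show ?thesis unfolding x y q
          by (rule complements_block_cong[OF block_KL_onto])
            (use pos P' in \<open>auto simp: x y pair_entry_def pos_def[of "Lpair m"] last_col_def\<close>)
      qed
    qed
  next
    case x: (Lpair n)
    show ?thesis
    proof (cases y)
      case (Hpair m \<nu>)
      then show ?thesis using P by (simp add: x)
    next
      case (Kpair m)
      then show ?thesis using P by (simp add: x)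
    next
      case y: (Lpair m)
      have P': "fst P = four_block_mat (no_stars n m) (no_stars n (m + 1))
         (no_stars (n + 1) m) (corner_star (n + 1) (m + 1))"
       "snd P = four_block_mat (no_stars n m) (transpose_mat (boxminus (m + 1) n))
         (boxminus (n + 1) m) (L_stars (n + 1) (m + 1))"
        using P by (simp_all add: x y)
      have fst_index: "fst P $$ (pos x p r, pos y q s) =
          (if p then if q then corner_star (n + 1) (m + 1) else no_stars (n + 1) m
           else if q then no_stars n (m + 1) else no_stars n m) $$ (r, s)"
        if "r < part x p" "s < part y q" for r s
        unfolding P' using that by (intro four_block_mat_pos) (auto simp: x y corner_star_def)
      have snd_index: "snd P $$ (pos x p r, pos y q s) =
          (if p then if q then L_stars (n + 1) (m + 1) else boxminus (n + 1) m
           else if q then transpose_mat (boxminus (m + 1) n) else no_stars n m) $$ (r, s)"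
        if "r < part x p" "s < part y q" for r s
        unfolding P' using that by (intro four_block_mat_pos) (auto simp: x y boxminus_def L_stars_def)
      have entry: "pair_entry P c (pos x p r) (pos y q s) \<longleftrightarrow>
          (if p then if q then if c then s = 0 \<or> r = n else r = n \<and> s = m else c \<and> r = n \<and> n \<le> s \<and> Suc s < m
           else q \<and> c \<and> s = m \<and> m \<le> r \<and> Suc r < n)"
        if "r < part x p" "s < part y q" for c r s
        unfolding pair_entry_def if_distrib[of "\<lambda>M. M $$ _"] fst_index[OF that] snd_index[OF that]
        using that by (cases p; cases q) (auto simp: x y corner_star_def L_stars_def boxminus_def)
      show ?thesis
        using entry block_LL_False_False[of n m] block_LL_False_True[of n m] block_LL_True_False[of n m]
          block_LL_True_True[of n m]
        unfolding x y
        by (cases p; cases q; simp only: if_True if_False simp_thms)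
          (erule complements_block_cong, simp)+
    qed
  qed
qed

lemma diag_block_entry:
  assumes "P \<in> diag_block x" "r < part x p" "s < part x q"
  shows "p = q \<Longrightarrow> \<not> pair_entry P c (pos x p r) (pos x q s)"
    and "pair_entry P c (pos x p r) (pos x q s) \<longleftrightarrow> pair_entry P c (pos x q s) (pos x p r)"
proof -
  have diag: "Q $$ (pos x p r, pos x q s) \<longleftrightarrow> (if p = q then False else if q then S $$ (r, s) else S $$ (s, r))"
    if "Q = four_block_mat (no_stars n n) S (transpose_mat S) (no_stars n n)" "S \<in> sw_stars n n" "\<And>p. part x p = n"
      "r < part x p" "s < part x q" for Q S n p q r s
  proof -
    have S: "S \<in> carrier_mat n n" using that(2) arrow_stars_carrier by blast
    have "Q $$ (pos x p r, pos x q s) =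
        (if p then if q then no_stars n n else transpose_mat S else if q then S else no_stars n n) $$ (r, s)"
      unfolding that(1) by (rule four_block_mat_pos) (use that S in auto)
    then show ?thesis using S that(3-) by (cases p; cases q) auto
  qed
  have main: "(p = q \<longrightarrow> \<not> pair_entry P c (pos x p r) (pos x q s)) \<and>
      (pair_entry P c (pos x p r) (pos x q s) \<longleftrightarrow> pair_entry P c (pos x q s) (pos x p r))"
  proof (cases x)
    case (Hpair n \<mu>)
    then have "fst P = no_stars (2 * n) (2 * n)" "snd P \<in> diag_stars n" using assms(1) by auto
    then obtain S where S: "S \<in> sw_stars n n" "fst P = no_stars (2 * n) (2 * n)"
        "snd P = four_block_mat (no_stars n n) S (transpose_mat S) (no_stars n n)"
      unfolding diag_stars_def by blast
    then show ?thesis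
      using diag[OF S(3,1) _ assms(2,3)] diag[OF S(3,1) _ assms(3,2)] assms(2,3) Hpair
      by (auto simp: pair_entry_def no_stars_pos)
  next
    case (Kpair n)
    then have "snd P = no_stars (2 * n) (2 * n)" "fst P \<in> diag_stars n" using assms(1) by auto
    then obtain S where S: "S \<in> sw_stars n n" "snd P = no_stars (2 * n) (2 * n)"
        "fst P = four_block_mat (no_stars n n) S (transpose_mat S) (no_stars n n)"
      unfolding diag_stars_def by blast
    then show ?thesis
      using diag[OF S(3,1) _ assms(2,3)] diag[OF S(3,1) _ assms(3,2)] assms(2,3) Kpair
      by (auto simp: pair_entry_def no_stars_pos)
  next
    case (Lpair n)
    then show ?thesis
      using assms pos_less[OF assms(2)] pos_less[OF assms(3)] by (auto simp: pair_entry_def)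
  qed
  then show "p = q \<Longrightarrow> \<not> pair_entry P c (pos x p r) (pos x q s)"
    and "pair_entry P c (pos x p r) (pos x q s) \<longleftrightarrow> pair_entry P c (pos x q s) (pos x p r)"
    by blast+
qed

text \<open>The two halves of one summand being different, this subblock behaves like one between
  two distinct summands with the same parameters.\<close>

lemma diag_block_complements:
  assumes P: "P \<in> diag_block x"
  shows "complements (block_positions x False x True) (block_tangent x False x True)
    {(c, r, s). pair_entry P c (pos x False r) (pos x True s)}"
proof -
  have diag: "\<exists>S. (S = {(i, j). mirror (\<not> True) n j = 0} \<and> n \<le> n \<or> S = {(i, j). Suc (mirror False n i) = n} \<and> n \<le> n) \<and>
      (\<forall>r<n. \<forall>s<n. Q $$ (pos x False r, pos x True s) \<longleftrightarrow> (r, s) \<in> S)"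
    if Q: "Q \<in> diag_stars n" and n: "\<And>p. part x p = n" for Q n
  proof -
    obtain W where W: "Q = four_block_mat (no_stars n n) W (transpose_mat W) (no_stars n n)" "W \<in> sw_stars n n"
      using Q unfolding diag_stars_def by blast
    have "W \<in> (if False then if True then nw_stars n n else ne_stars n n else if True then sw_stars n n else se_stars n n)"
      using W by simp
    then obtain S where S: "S = {(i, j). mirror (\<not> True) n j = 0} \<and> n \<le> n \<or> S = {(i, j). Suc (mirror False n i) = n} \<and> n \<le> n"
      "\<forall>i<n. \<forall>j<n. W $$ (i, j) \<longleftrightarrow> (i, j) \<in> S"
      by (rule arrow_stars_pattern)
    have Wc: "W \<in> carrier_mat n n" using W(2) arrow_stars_carrier by blast
    have "Q $$ (pos x False r, pos x True s) \<longleftrightarrow> (r, s) \<in> S" if "r < n" "s < n" for r s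
      using that Wc S(2) n by (simp add: W(1) pos_def)
    then show ?thesis using S(1) by blast
  qed
  show ?thesis
  proof (cases x)
    case x: (Hpair n \<mu>)
    have P': "fst P = no_stars (2 * n) (2 * n)" "snd P \<in> diag_stars n" using P by (auto simp: x)
    obtain S where S: "S = {(i, j). mirror (\<not> True) n j = 0} \<and> n \<le> n \<or> S = {(i, j). Suc (mirror False n i) = n} \<and> n \<le> n"
      "\<forall>r<n. \<forall>s<n. snd P $$ (pos x False r, pos x True s) \<longleftrightarrow> (r, s) \<in> S"
      using diag[OF P'(2)] by (auto simp: x)
    show ?thesis
      using block_HH_same[OF S(1), of \<mu>] unfolding x
      by (rule complements_block_cong) (use S(2) P' in \<open>auto simp: x pair_entry_def no_stars_pos\<close>)
  next
    case x: (Kpair n)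
    have P': "snd P = no_stars (2 * n) (2 * n)" "fst P \<in> diag_stars n" using P by (auto simp: x)
    obtain S where S: "S = {(i, j). mirror (\<not> True) n j = 0} \<and> n \<le> n \<or> S = {(i, j). Suc (mirror False n i) = n} \<and> n \<le> n"
      "\<forall>r<n. \<forall>s<n. fst P $$ (pos x False r, pos x True s) \<longleftrightarrow> (r, s) \<in> S"
      using diag[OF P'(2)] by (auto simp: x)
    show ?thesis
      using block_KK[OF S(1)] unfolding x
      by (rule complements_block_cong) (use S(2) P' in \<open>auto simp: x pair_entry_def no_stars_pos\<close>)
  next
    case x: (Lpair n)
    have P': "P = (no_stars (2 * n + 1) (2 * n + 1), no_stars (2 * n + 1) (2 * n + 1))" using P by (simp add: x)
    \<comment> \<open>With both sizes equal to n, a star in row i would need n \<le> i and i + 1 <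
      n, so the pattern is empty.\<close>
    show ?thesis unfolding x
      by (rule complements_block_cong[OF block_LL_False_True]) (use P' in \<open>auto simp: pair_entry_def pos_def\<close>)
  qed
qed

section \<open>From the blocks to the whole star pattern\<close>

lemma block_index_entry:
  assumes "i < length Xs" "r < summand_size (Xs ! i)" "j < length Xs" "s < summand_size (Xs ! j)"
  shows "block Xs D i j $$ (r, s) = D $$ (offset Xs i + r, offset Xs j + s)"
  using assms by (simp add: block_def)

lemma pair_entry_glob:
  assumes "i < length Xs" "r < part (Xs ! i) p" "j < length Xs" "s < part (Xs ! j) q"
  shows "pair_entry (D, D') c (glob Xs i p r) (glob Xs j q s) =
    pair_entry (block Xs D i j, block Xs D' i j) c (pos (Xs ! i) p r) (pos (Xs ! j) q s)"
  using assms by (simp add: pair_entry_def glob_def block_index_entry pos_less)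

lemma deformation_patternsD:
  assumes "(D, D') \<in> deformation_patterns Xs"
  shows "D \<in> carrier_mat (total_size Xs) (total_size Xs)" "D' \<in> carrier_mat (total_size Xs) (total_size Xs)"
    "i < length Xs \<Longrightarrow> (block Xs D i i, block Xs D' i i) \<in> diag_block (Xs ! i)"
    "i < j \<Longrightarrow> j < length Xs \<Longrightarrow> (block Xs D i j, block Xs D' i j) \<in> offdiag_block (Xs ! i) (Xs ! j)"
    "i < j \<Longrightarrow> j < length Xs \<Longrightarrow> block Xs D j i = transpose_mat (block Xs D i j)"
    "i < j \<Longrightarrow> j < length Xs \<Longrightarrow> block Xs D' j i = transpose_mat (block Xs D' i j)"
  using assms unfolding deformation_patterns_def by blast+

lemma complements_deformation_patterns:
  assumes D: "(D, D') \<in> deformation_patterns Xs"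
  shows "complements (upper_positions (total_size Xs))
    (range (congruence_action (total_size Xs) (pair_entry (direct_sum_pair Xs))))
    (star_positions (total_size Xs) (D, D'))"
proof (rule complements_direct_sum)
  fix i j p q assume ij: "i < j" "j < length Xs"
  show "complements (block_positions (Xs ! i) p (Xs ! j) q) (block_tangent (Xs ! i) p (Xs ! j) q)
        {(c, r, s). pair_entry (D, D') c (glob Xs i p r) (glob Xs j q s)}"
    by (rule complements_block_cong[OF offdiag_block_complements[OF deformation_patternsD(4)[OF D ij]]])
      (use ij in \<open>simp add: pair_entry_glob\<close>)
next
  fix i assume i: "i < length Xs"
  show "complements (block_positions (Xs ! i) False (Xs ! i) True) (block_tangent (Xs ! i) False (Xs ! i) True)
        {(c, r, s). pair_entry (D, D') c (glob Xs i False r) (glob Xs i True s)}"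
    by (rule complements_block_cong[OF diag_block_complements[OF deformation_patternsD(3)[OF D i]]])
      (use i in \<open>simp add: pair_entry_glob\<close>)
  fix p c r s assume rs: "r < part (Xs ! i) p" "s < part (Xs ! i) p"
  show "\<not> pair_entry (D, D') c (glob Xs i p r) (glob Xs i p s)"
    unfolding pair_entry_glob[OF i rs(1) i rs(2)]
    by (rule diag_block_entry(1)[OF deformation_patternsD(3)[OF D i] rs]) simp
qed

lemma pattern_entry_symmetric:
  assumes D: "(D, D') \<in> deformation_patterns Xs" and a: "a < total_size Xs" and b: "b < total_size Xs"
  shows "\<not> pair_entry (D, D') c a a" "pair_entry (D, D') c a b \<longleftrightarrow> pair_entry (D, D') c b a"
proof -
  obtain i p r where ipr: "i < length Xs" "r < part (Xs ! i) p" "a = glob Xs i p r" using glob_surj[OF a] .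
  obtain j q s where jqs: "j < length Xs" "s < part (Xs ! j) q" "b = glob Xs j q s" using glob_surj[OF b] .
  show "\<not> pair_entry (D, D') c a a"
    unfolding ipr(3) pair_entry_glob[OF ipr(1,2) ipr(1,2)]
    by (rule diag_block_entry(1)[OF deformation_patternsD(3)[OF D ipr(1)] ipr(2) ipr(2)]) simp
  have lt: "pair_entry (block Xs D j i, block Xs D' j i) c (pos (Xs ! j) q s) (pos (Xs ! i) p r) \<longleftrightarrow>
      pair_entry (block Xs D i j, block Xs D' i j) c (pos (Xs ! i) p r) (pos (Xs ! j) q s)"
    if "i < j" "j < length Xs" "r < part (Xs ! i) p" "s < part (Xs ! j) q" for i j p q r s
    using that deformation_patternsD(5,6)[OF D that(1,2)]
    by (simp add: pair_entry_def block_def pos_less)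
  show "pair_entry (D, D') c a b \<longleftrightarrow> pair_entry (D, D') c b a"
    unfolding ipr(3) jqs(3) pair_entry_glob[OF ipr(1,2) jqs(1,2)] pair_entry_glob[OF jqs(1,2) ipr(1,2)]
  proof (cases i j rule: linorder_cases)
    case less
    then show "pair_entry (block Xs D i j, block Xs D' i j) c (pos (Xs ! i) p r) (pos (Xs ! j) q s) \<longleftrightarrow>
        pair_entry (block Xs D j i, block Xs D' j i) c (pos (Xs ! j) q s) (pos (Xs ! i) p r)"
      using lt ipr jqs by blast
  next
    case equal
    then show "pair_entry (block Xs D i j, block Xs D' i j) c (pos (Xs ! i) p r) (pos (Xs ! j) q s) \<longleftrightarrow>
        pair_entry (block Xs D j i, block Xs D' j i) c (pos (Xs ! j) q s) (pos (Xs ! i) p r)"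
      using diag_block_entry(2)[OF deformation_patternsD(3)[OF D ipr(1)] ipr(2), of s q c] jqs(2) by blast
  next
    case greater
    then show "pair_entry (block Xs D i j, block Xs D' i j) c (pos (Xs ! i) p r) (pos (Xs ! j) q s) \<longleftrightarrow>
        pair_entry (block Xs D j i, block Xs D' j i) c (pos (Xs ! j) q s) (pos (Xs ! i) p r)"
      using lt ipr jqs by blast
  qed
qed

lemma star_symmetric_pattern:
  assumes D: "(D, D') \<in> deformation_patterns Xs"
  shows "star_symmetric (total_size Xs) D" "star_symmetric (total_size Xs) D'"
proof -
  have *: "star_symmetric (total_size Xs) M"
    if "M \<in> carrier_mat (total_size Xs) (total_size Xs)" "\<And>a b. M $$ (a, b) = pair_entry (D, D') c a b" for M c
    unfolding star_symmetric_def
  proof (intro conjI allI impI that(1))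
    show "\<not> M $$ (a, a)" if "a < total_size Xs" for a
      unfolding \<open>\<And>a b. M $$ (a, b) = pair_entry (D, D') c a b\<close>
      using pattern_entry_symmetric(1)[OF D that that] .
    show "transpose_mat M = M"
      by (rule eq_matI)
        (use that pattern_entry_symmetric(2)[OF D, of _ _ c] in \<open>auto simp del: that(2)\<close>)
  qed
  show "star_symmetric (total_size Xs) D"
    by (rule *[of _ False]) (use deformation_patternsD(1)[OF D] in \<open>simp_all add: pair_entry_def\<close>)
  show "star_symmetric (total_size Xs) D'"
    by (rule *[of _ True]) (use deformation_patternsD(2)[OF D] in \<open>simp_all add: pair_entry_def\<close>)
qed

section \<open>Existence of star patterns\<close>

fun type_rank :: "summand \<Rightarrow> nat" where
  "type_rank (Hpair n \<mu>) = 0"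
| "type_rank (Kpair n) = 1"
| "type_rank (Lpair n) = 2"

lemma sw_stars_nonempty: "\<exists>D. D \<in> sw_stars p q"
  and se_stars_nonempty: "\<exists>D. D \<in> se_stars p q"
  and ne_stars_nonempty: "\<exists>D. D \<in> ne_stars p q"
  and nw_stars_nonempty: "\<exists>D. D \<in> nw_stars p q"
  using le_cases[of p q] by (auto simp: sw_stars_def se_stars_def ne_stars_def nw_stars_def)

lemma offdiag_stars_nonempty: "\<exists>D. D \<in> offdiag_stars p q"
  unfolding offdiag_stars_def
  using sw_stars_nonempty[of p q] se_stars_nonempty[of p q] ne_stars_nonempty[of p q] nw_stars_nonempty[of p q]
  by blast

lemma diag_block_nonempty: "\<exists>P. P \<in> diag_block x"
  using sw_stars_nonempty by (cases x) (auto simp: diag_stars_def)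

text \<open>\<open>offdiag_block\<close> is empty for types in the order opposite to H, K, L;
  nondecreasing ranks exclude exactly these cases.\<close>

lemma offdiag_block_nonempty:
  assumes "type_rank x \<le> type_rank y"
  shows "\<exists>P. P \<in> offdiag_block x y"
  using assms offdiag_stars_nonempty by (cases x; cases y) auto

lemma offdiag_stars_carrier: "D \<in> offdiag_stars n m \<Longrightarrow> D \<in> carrier_mat (2 * n) (2 * m)"
  unfolding offdiag_stars_def mult_2
  by clarify (intro four_block_carrier_mat arrow_stars_carrier, simp_all)

lemma diag_stars_carrier: "D \<in> diag_stars n \<Longrightarrow> D \<in> carrier_mat (2 * n) (2 * n)"
  unfolding diag_stars_def mult_2
  by clarify (intro four_block_carrier_mat no_stars_carrier)

lemma diag_block_carrier:
  "P \<in> diag_block x \<Longrightarrow> fst P \<in> carrier_mat (summand_size x) (summand_size x) \<and>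
     snd P \<in> carrier_mat (summand_size x) (summand_size x)"
  using diag_stars_carrier by (cases x) auto

lemma offdiag_block_carrier:
  assumes "P \<in> offdiag_block x y"
  shows "fst P \<in> carrier_mat (summand_size x) (summand_size y) \<and>
     snd P \<in> carrier_mat (summand_size x) (summand_size y)"
proof -
  have LL: "four_block_mat A B C D \<in> carrier_mat (2 * n + 1) (2 * m + 1)"
    if "A \<in> carrier_mat n m" "D \<in> carrier_mat (n + 1) (m + 1)" for A B C D :: star_mat and n m
    using four_block_carrier_mat[OF that, of B C] by (simp add: mult_2)
  have HL: "four_block_mat (no_stars (2 * n) m) B C (no_stars 0 (m + 1)) \<in> carrier_mat (2 * n) (2 * m + 1)"
    for B C n m
    using four_block_carrier_mat[of "no_stars (2 * n) m" "2 * n" m "no_stars 0 (m + 1)" 0 "m + 1" B C]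
    by (simp add: mult_2)
  have LL': "corner_star p q \<in> carrier_mat p q" "L_stars p q \<in> carrier_mat p q" "last_col p q \<in> carrier_mat p q"
    for p q by (simp_all add: corner_star_def L_stars_def last_col_def)
  show ?thesis
    using assms offdiag_stars_carrier LL HL LL'
    by (cases x; cases y) (auto split: if_splits)
qed

text \<open>Keeps the claim about all patterns from being vacuous. A pattern is chosen for every
  diagonal and upper block; the entries are assembled by decoding global indices, lower blocks being
  the transposes of upper ones.\<close>

lemma deformation_patterns_nonempty:
  assumes sorted: "sorted (map type_rank Xs)"
  shows "deformation_patterns Xs \<noteq> {}"
proof -
  let ?n = "total_size Xs" and ?s = "\<lambda>i. summand_size (Xs ! i)"
  have "\<exists>P. P \<in> offdiag_block (Xs ! i) (Xs ! j)" if "i < j" "j < length Xs" for i j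
    using sorted_nth_mono[OF sorted, of i j] that by (intro offdiag_block_nonempty) simp
  then obtain P where P: "\<And>i j. i < j \<Longrightarrow> j < length Xs \<Longrightarrow> P i j \<in> offdiag_block (Xs ! i) (Xs ! j)"
    by metis
  obtain Q where Q: "\<And>x. Q x \<in> diag_block x" using diag_block_nonempty by metis
  have "\<forall>a. \<exists>v. a < ?n \<longrightarrow> fst v < length Xs \<and> snd v < ?s (fst v) \<and> a = offset Xs (fst v) + snd v"
    using offset_surj by (metis fst_conv snd_conv)
  then obtain d where d: "\<And>a. a < ?n \<Longrightarrow> fst (d a) < length Xs \<and> snd (d a) < ?s (fst (d a)) \<and>
      a = offset Xs (fst (d a)) + snd (d a)"
    by metis
  have d_offset: "d (offset Xs i + r) = (i, r)" if "i < length Xs" "r < ?s i" for i r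
    using d[OF offset_less_total[OF that]] offset_eq_iff[OF that, of "fst (d (offset Xs i + r))" "snd (d (offset Xs i + r))"]
    by (metis prod.collapse)
  define entry where "entry c v w = (if fst v < fst w then pair_entry (P (fst v) (fst w)) c (snd v) (snd w)
      else if fst w < fst v then pair_entry (P (fst w) (fst v)) c (snd w) (snd v)
      else pair_entry (Q (Xs ! fst v)) c (snd v) (snd w))" for c v w
  define M where "M c = mat ?n ?n (\<lambda>(a, b). entry c (d a) (d b))" for c
  have M: "M c $$ (offset Xs i + r, offset Xs j + s) = entry c (i, r) (j, s)"
    if "i < length Xs" "r < ?s i" "j < length Xs" "s < ?s j" for c i j r s
    using that offset_less_total[OF that(1,2)] offset_less_total[OF that(3,4)] by (simp add: M_def d_offset)
  define part' where "part' c R = (if c then snd R else fst R)" for c and R :: star_pair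
  have diag: "block Xs (M c) i i = part' c (Q (Xs ! i))" if "i < length Xs" for c i
  proof (rule eq_matI)
    show "dim_row (block Xs (M c) i i) = dim_row (part' c (Q (Xs ! i)))"
      "dim_col (block Xs (M c) i i) = dim_col (part' c (Q (Xs ! i)))"
      using diag_block_carrier[OF Q, of "Xs ! i"] by (auto simp: block_def part'_def)
    fix r s assume "r < dim_row (part' c (Q (Xs ! i)))" "s < dim_col (part' c (Q (Xs ! i)))"
    then have "r < ?s i" "s < ?s i"
      using diag_block_carrier[OF Q, of "Xs ! i"] by (auto simp: part'_def split: if_splits)
    then show "block Xs (M c) i i $$ (r, s) = part' c (Q (Xs ! i)) $$ (r, s)"
      using that by (simp add: block_index_entry M entry_def pair_entry_def part'_def)
  qed
  have upper: "block Xs (M c) i j = part' c (P i j)" if ij: "i < j" "j < length Xs" for c i j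
  proof (rule eq_matI)
    show "dim_row (block Xs (M c) i j) = dim_row (part' c (P i j))"
      "dim_col (block Xs (M c) i j) = dim_col (part' c (P i j))"
      using offdiag_block_carrier[OF P[OF ij]] by (auto simp: block_def part'_def)
    fix r s assume "r < dim_row (part' c (P i j))" "s < dim_col (part' c (P i j))"
    then have "r < ?s i" "s < ?s j"
      using offdiag_block_carrier[OF P[OF ij]] by (auto simp: part'_def split: if_splits)
    then show "block Xs (M c) i j $$ (r, s) = part' c (P i j) $$ (r, s)"
      using ij by (simp add: block_index_entry M entry_def pair_entry_def part'_def)
  qed
  have lower: "block Xs (M c) j i = transpose_mat (block Xs (M c) i j)" if ij: "i < j" "j < length Xs" for c i j
  proof (rule eq_matI)
    fix r s assume "r < dim_row (transpose_mat (block Xs (M c) i j))" "s < dim_col (transpose_mat (block Xs (M c) i j))"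
    then have rs: "r < ?s j" "s < ?s i" by (simp_all add: block_def)
    then have "transpose_mat (block Xs (M c) i j) $$ (r, s) = block Xs (M c) i j $$ (s, r)"
      by (simp add: block_def)
    then show "block Xs (M c) j i $$ (r, s) = transpose_mat (block Xs (M c) i j) $$ (r, s)"
      using rs ij by (simp add: block_index_entry M entry_def)
  qed (simp_all add: block_def)
  have "(M False, M True) \<in> deformation_patterns Xs"
    unfolding deformation_patterns_def
    using diag upper lower P Q by (auto simp: M_def part'_def)
  then show ?thesis by blast
qed

lemma sorted_canonical_summands: "sorted (map type_rank (canonical_summands hs ks ls))"
  by (auto simp: canonical_summands_def sorted_append sorted_map comp_def case_prod_beta
      intro!: sorted_wrt_mono_rel[of _ "\<lambda>_ _. True"])

theorem theorem2p1:
  fixes hs :: "(nat \<times> complex) list" and ks ls :: "nat list"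
  assumes "\<forall>(h, \<mu>) \<in> set hs. h \<ge> 1"
    and "\<forall>k \<in> set ks. k \<ge> 1"
  shows "deformation_patterns (canonical_summands hs ks ls) \<noteq> {} \<and>
    (\<forall>D \<in> deformation_patterns (canonical_summands hs ks ls).
       simplest_miniversal (total_size (canonical_summands hs ks ls))
         (direct_sum_pair (canonical_summands hs ks ls)) D)"
proof (intro conjI ballI)
  show "deformation_patterns (canonical_summands hs ks ls) \<noteq> {}"
    by (rule deformation_patterns_nonempty[OF sorted_canonical_summands])
  fix D assume D: "D \<in> deformation_patterns (canonical_summands hs ks ls)"
  obtain D1 D2 where D12: "D = (D1, D2)" by (cases D)
  show "simplest_miniversal (total_size (canonical_summands hs ks ls))
      (direct_sum_pair (canonical_summands hs ks ls)) D"
    using star_symmetric_pattern[OF D[unfolded D12]] complements_deformation_patterns[OF D[unfolded D12]]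
    unfolding D12 by (intro simplest_miniversal_of_complements skew_pair_direct_sum) simp_all
qed

end
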